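(* Every complex Jordan algebra of rank $3$ and dimension $5$ is isomorphic to exactly one of the sixteen algebras $\mathcal J^5_1,\dots,\mathcal J^5_{16}$ listed below (products are commutative, products of basis elements not listed are zero). (1)–(5) $\mathcal J^5_k$ ($k=1,\dots,5$) has basis $(e,v_1,v_2,v_3,v_4)$ with $e$ the unity, and the nonzero products among the $v_i$ are: $\mathcal J^5_1$: $v_1^2=v_3$, $v_1v_2=v_4$; $\mathcal J^5_2$: $v_1^2=v_2^2=v_3$, $v_1v_2=v_4$; $\mathcal J^5_3$: $v_1^2=v_4$; $\mathcal J^5_4$: $v_1^2=v_2^2=v_4$; $\mathcal J^5_5$: $v_1^2=v_2^2=v_3^2=v_4$. (6)–(9) $\mathcal J^5_k$ ($k=6,\dots,9$) has basis $(e_1,e_2,a,b,d)$ with $e_1^2=e_1$, $e_2^2=e_2$, $e_1a=a$, $e_1b=e_2b=\tfrac12 b$, $e_1d=e_2d=\tfrac12 d$, and additionally: $\mathcal J^5_6$: nothing more; $\mathcal J^5_7$: $b^2=a$; $\mathcal J^5_8$: $b^2=d^2=a$; $\mathcal J^5_9$: $ab=d$. (10)–(11) $\mathcal J^5_k$ ($k=10,11$) has basis $(e_1,e_2,a,b,d)$ with $e_1^2=e_1$, $e_2^2=e_2$, $e_1a=a$, $e_1b=b$, $e_1d=e_2d=\tfrac12 d$, and additionally: $\mathcal J^5_{10}$: nothing more; $\mathcal J^5_{11}$: $d^2=a$. (12) $\mathcal J^5_{12}$ has basis $(e_1,e_2,a,b,d)$ with $e_1^2=e_1$, $e_2^2=e_2$,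 $e_1a=a$, $e_1b=b$, $e_1d=d$. (13) $\mathcal J^5_{13}$ has basis $(e_1,e_2,e_3,a,b)$ with $e_i^2=e_i$ for $i=1,2,3$, $e_1a=e_2a=\tfrac12 a$, $e_1b=e_3b=\tfrac12 b$. (14)–(16) $\mathcal J^5_{14}=\mathbb C\times\mathcal J^4_{q,1}$, $\mathcal J^5_{15}=\mathbb C\times\mathcal J^4_{q,2}$, $\mathcal J^5_{16}=\mathbb C\times\mathcal J^4_{q,3}$ (direct products of algebras).
   Context: A Jordan algebra is a finite-dimensional commutative complex algebra with unity satisfying $x^2(xy)=x(x^2y)$. Its rank is the dimension of the (associative) subalgebra generated by the unity and a general element. For $0\le r\le m-1$, $\mathcal J^m_{q,r}$ is the $m$-dimensional algebra $\mathbb C\oplus W$, $W=\mathbb C^{m-1}$, with product $(\lambda,w)\cdot(\lambda',w')=(\lambda\lambda'-q(w,w'),\,\lambda w'+\lambda'w)$, where $q(\cdot,\cdot)$ is the polarization of the quadratic form $q(w)=\sum_{i=1}^r w_i^2$ of rank $r$ (so $q(w,w')=\sum_{i=1}^r w_iw_i'$). *)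

theory Defs
  imports "HOL-Analysis.Analysis"
begin

section \<open>Complex Jordan algebras and their rank\<close>

locale jordan_algebra = vector_space sc
  for sc :: "complex \<Rightarrow> 'a::ab_group_add \<Rightarrow> 'a" +
  fixes mul :: "'a \<Rightarrow> 'a \<Rightarrow> 'a" and one :: 'a
  assumes finite_dim: "\<exists>B. finite B \<and> span B = UNIV"
    and mult_add_left: "mul (x + y) z = mul x z + mul y z"
    and mult_scale_left: "mul (sc c x) y = sc c (mul x y)"
    and mult_commute: "mul x y = mul y x"
    and mult_one: "mul one x = x"
    and jordan_identity: "mul (mul x x) (mul x y) = mul x (mul (mul x x) y)"

inductive polynomial_fun :: "(complex \<Rightarrow> 'a::ab_group_add \<Rightarrow> 'a) \<Rightarrow> ('a \<Rightarrow> complex) \<Rightarrow> bool"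
  for sc where
  const: "polynomial_fun sc (\<lambda>_. c)"
| linear: "Vector_Spaces.linear sc (*) f \<Longrightarrow> polynomial_fun sc f"
| add: "polynomial_fun sc f \<Longrightarrow> polynomial_fun sc g \<Longrightarrow> polynomial_fun sc (\<lambda>x. f x + g x)"
| mult: "polynomial_fun sc f \<Longrightarrow> polynomial_fun sc g \<Longrightarrow> polynomial_fun sc (\<lambda>x. f x * g x)"

text \<open>A property holds for a general element if it holds on a nonempty Zariski-open set.
  Since the principal open sets (nonvanishing loci of polynomial functions) form a basis of the
  Zariski topology, it suffices to ask for a nonempty principal open set.\<close>

definition for_general :: "(complex \<Rightarrow> 'a::ab_group_add \<Rightarrow> 'a) \<Rightarrow> ('a \<Rightarrow> bool) \<Rightarrow> bool" where
  "for_general sc P \<longleftrightarrow>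
     (\<exists>p. polynomial_fun sc p \<and> (\<exists>x. p x \<noteq> 0) \<and> (\<forall>x. p x \<noteq> 0 \<longrightarrow> P x))"

context jordan_algebra
begin

definition subalgebra :: "'a set \<Rightarrow> bool" where
  "subalgebra S \<longleftrightarrow> subspace S \<and> (\<forall>x\<in>S. \<forall>y\<in>S. mul x y \<in> S)"

text \<open>Stated as a relation; the number \<open>r\<close> is unique, as any two nonempty Zariski-open sets meet.\<close>

definition has_rank :: "nat \<Rightarrow> bool" where
  "has_rank r \<longleftrightarrow> for_general sc (\<lambda>x. dim (subalgebra hull {one, x}) = r)"

end

section \<open>Isomorphisms of algebras\<close>

text \<open>A bijective multiplicative map automatically carries a unity to a unity.\<close>

definition algebra_isomorphic ::
  "(complex \<Rightarrow> 'a::ab_group_add \<Rightarrow> 'a) \<Rightarrow> ('a \<Rightarrow> 'a \<Rightarrow> 'a) \<Rightarrow>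
   (complex \<Rightarrow> 'b::ab_group_add \<Rightarrow> 'b) \<Rightarrow> ('b \<Rightarrow> 'b \<Rightarrow> 'b) \<Rightarrow> bool" where
  "algebra_isomorphic sc1 mul1 sc2 mul2 \<longleftrightarrow>
     (\<exists>f. Vector_Spaces.linear sc1 sc2 f \<and> bij f \<and>
          (\<forall>x y. f (mul1 x y) = mul2 (f x) (f y)))"

section \<open>Algebras given by the products of basis vectors\<close>

abbreviation basis_vec :: "5 \<Rightarrow> complex ^ 5" where
  "basis_vec i \<equiv> axis i 1"

text \<open>An entry \<open>((i, j), v)\<close> of a table means that the product of the basis vectors with indices
  \<open>i\<close> and \<open>j\<close>, in either order, is \<open>v\<close>; products that are not listed are zero.\<close>

type_synonym product_table = "((5 \<times> 5) \<times> (complex ^ 5)) list"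

definition basis_product :: "product_table \<Rightarrow> 5 \<Rightarrow> 5 \<Rightarrow> complex ^ 5" where
  "basis_product T i j =
     (case map_of T (i, j) of Some v \<Rightarrow> v
      | None \<Rightarrow> (case map_of T (j, i) of Some v \<Rightarrow> v | None \<Rightarrow> 0))"

definition table_mult :: "product_table \<Rightarrow> complex ^ 5 \<Rightarrow> complex ^ 5 \<Rightarrow> complex ^ 5" where
  "table_mult T x y = (\<Sum>i\<in>UNIV. \<Sum>j\<in>UNIV. (x $ i * y $ j) *s basis_product T i j)"

text \<open>The index type \<open>5\<close> consists of the residues \<open>0, 1, 2, 3, 4\<close>, which are used in this order
  for the five vectors of each basis.\<close>

definition tables_1_5 :: "product_table list" where
  "tables_1_5 =
    (let e = 0; v1 = 1; v2 = 2; v3 = 3; v4 = 4;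
         T = [((e, e), basis_vec e), ((e, v1), basis_vec v1), ((e, v2), basis_vec v2),
              ((e, v3), basis_vec v3), ((e, v4), basis_vec v4)]
     in [T @ [((v1, v1), basis_vec v3), ((v1, v2), basis_vec v4)],
         T @ [((v1, v1), basis_vec v3), ((v2, v2), basis_vec v3), ((v1, v2), basis_vec v4)],
         T @ [((v1, v1), basis_vec v4)],
         T @ [((v1, v1), basis_vec v4), ((v2, v2), basis_vec v4)],
         T @ [((v1, v1), basis_vec v4), ((v2, v2), basis_vec v4), ((v3, v3), basis_vec v4)]])"

definition tables_6_9 :: "product_table list" where
  "tables_6_9 =
    (let e1 = 0; e2 = 1; a = 2; b = 3; d = 4;
         T = [((e1, e1), basis_vec e1), ((e2, e2), basis_vec e2), ((e1, a), basis_vec a),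
              ((e1, b), (1/2) *s basis_vec b), ((e2, b), (1/2) *s basis_vec b),
              ((e1, d), (1/2) *s basis_vec d), ((e2, d), (1/2) *s basis_vec d)]
     in [T,
         T @ [((b, b), basis_vec a)],
         T @ [((b, b), basis_vec a), ((d, d), basis_vec a)],
         T @ [((a, b), basis_vec d)]])"

definition tables_10_11 :: "product_table list" where
  "tables_10_11 =
    (let e1 = 0; e2 = 1; a = 2; b = 3; d = 4;
         T = [((e1, e1), basis_vec e1), ((e2, e2), basis_vec e2), ((e1, a), basis_vec a),
              ((e1, b), basis_vec b),
              ((e1, d), (1/2) *s basis_vec d), ((e2, d), (1/2) *s basis_vec d)]
     in [T,
         T @ [((d, d), basis_vec a)]])"

definition table_12 :: product_table where
  "table_12 =
    (let e1 = 0; e2 = 1; a = 2; b = 3; d = 4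
     in [((e1, e1), basis_vec e1), ((e2, e2), basis_vec e2), ((e1, a), basis_vec a),
         ((e1, b), basis_vec b), ((e1, d), basis_vec d)])"

definition table_13 :: product_table where
  "table_13 =
    (let e1 = 0; e2 = 1; e3 = 2; a = 3; b = 4
     in [((e1, e1), basis_vec e1), ((e2, e2), basis_vec e2), ((e3, e3), basis_vec e3),
         ((e1, a), (1/2) *s basis_vec a), ((e2, a), (1/2) *s basis_vec a),
         ((e1, b), (1/2) *s basis_vec b), ((e3, b), (1/2) *s basis_vec b)])"

definition J5_tables :: "product_table list" where
  "J5_tables = tables_1_5 @ tables_6_9 @ tables_10_11 @ [table_12, table_13]"

section \<open>The four-dimensional algebras of a quadratic form and products with the ground field\<close>

text \<open>The algebra of a form of rank \<open>r\<close> on the three-dimensional space \<open>W\<close>. In the index type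
  \<open>3\<close> the indices \<open>1, 2, 3\<close> are distinct and exhaust the type (with \<open>3 = 0\<close>).\<close>

definition diag_form :: "nat \<Rightarrow> complex ^ 3 \<Rightarrow> complex ^ 3 \<Rightarrow> complex" where
  "diag_form r w w' = (\<Sum>i = 1..r. w $ of_nat i * w' $ of_nat i)"

definition Jq4_mult ::
  "nat \<Rightarrow> complex \<times> (complex ^ 3) \<Rightarrow> complex \<times> (complex ^ 3) \<Rightarrow> complex \<times> (complex ^ 3)" where
  "Jq4_mult r x y =
     (fst x * fst y - diag_form r (snd x) (snd y), fst x *s snd y + fst y *s snd x)"

definition Jq4_scale :: "complex \<Rightarrow> complex \<times> (complex ^ 3) \<Rightarrow> complex \<times> (complex ^ 3)" where
  "Jq4_scale = module_prod.scale (*) (*s)"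

definition prod_mult ::
  "('a \<Rightarrow> 'a \<Rightarrow> 'a) \<Rightarrow> ('b \<Rightarrow> 'b \<Rightarrow> 'b) \<Rightarrow> 'a \<times> 'b \<Rightarrow> 'a \<times> 'b \<Rightarrow> 'a \<times> 'b" where
  "prod_mult m1 m2 x y = (m1 (fst x) (fst y), m2 (snd x) (snd y))"

section \<open>The sixteen algebras\<close>

text \<open>The algebras number 1 to 13 live on \<open>complex ^ 5\<close>, those number 14 to 16 (with forms of
  rank 1, 2, 3) on \<open>complex \<times> (complex \<times> (complex ^ 3))\<close>.\<close>

definition isomorphic_to_J5 ::
  "(complex \<Rightarrow> 'a::ab_group_add \<Rightarrow> 'a) \<Rightarrow> ('a \<Rightarrow> 'a \<Rightarrow> 'a) \<Rightarrow> nat \<Rightarrow> bool" where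
  "isomorphic_to_J5 sc mul k \<longleftrightarrow>
     (if k \<le> 13 then algebra_isomorphic sc mul (*s) (table_mult (J5_tables ! (k - 1)))
      else algebra_isomorphic sc mul
             (module_prod.scale (*) Jq4_scale) (prod_mult (*) (Jq4_mult (k - 13))))"

end

theory Submission
  imports Defs "HOL-Computational_Algebra.Fundamental_Theorem_Algebra"
begin

text \<open>Let \<open>J\<close> be the algebra. An idempotent \<open>c\<close> splits \<open>J\<close> into the eigenspaces of multiplication by \<open>c\<close> for the
  eigenvalues \<open>1, 1/2, 0\<close> (Peirce decomposition), and rank three, which by density of general elements
  makes \<open>1, x, x\<^sup>2, x\<^sup>3\<close> dependent for every \<open>x\<close>, forces these pieces to be small.

  If \<open>1\<close> is a sum of three orthogonal idempotents \<open>e\<^sub>i\<close>, then \<open>J\<^sub>i\<^sub>i\<close> is spanned by \<open>e\<^sub>i\<close> and two dimensions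
  are left for the spaces \<open>J\<^sub>i\<^sub>j\<close>: algebras 13 to 16. If there are nontrivial idempotents but no
  such triple, then for a suitable \<open>c\<close> the eigenspaces for \<open>1\<close> and \<open>0\<close> are \<open>\<complex> c + N\<close> with \<open>N\<^sup>2 = 0\<close>
  and \<open>\<complex> (1 - c)\<close>, and products of elements of the eigenspace for \<open>1/2\<close> lie in \<open>N\<close>: algebras 6 to 12.
  Without nontrivial idempotents every element is a scalar plus some \<open>n\<close> with \<open>n\<^sup>3 = 0\<close>. Multiplication
  by such an \<open>n\<close> is nilpotent, so by linearity of the trace these \<open>n\<close> form an ideal \<open>N\<close>; as \<open>dim N = 4\<close>,
  \<open>N\<^sup>3 = 0\<close>, and a normal form of the symmetric bilinear map \<open>N \<times> N \<rightarrow> N\<^sup>2\<close> gives algebras 1 to 5.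

  The sixteen algebras are told apart by properties that only quantify over elements and mention
  products and scalar multiples, hence are invariant under isomorphism.\<close>


text \<open>Rank three enters in two forms only: the powers 1, x, x^2, x^3 of every element are
  dependent, and some element satisfies no relation of degree two. The dependence bounds the Peirce
  spaces: were one of them too large, an explicit element would have a minimal polynomial of degree
  four, with eigenvalues 2, 1, -1, 0 or with repeated ones. The special element excludes degenerate
  cases, such as a nil part that is zero or has zero products, because there every element satisfies
  a quadratic equation.

  The obstacle is the lack of associativity: the Jordan identity and its polarizations are the only
  source of relations between products. What is drawn from them is a linear combination of a few
  instances. Hence the algebra is moved to \<open>complex ^ 5\<close>, where such a combination is
  an identity in each coordinate that \<open>algebra\<close> can check.\<close>

lemma UNIV_5: "(UNIV :: 5 set) = {0, 1, 2, 3, 4}"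
proof -
  have "card {0, 1, 2, 3, 4 :: 5} = CARD(5)"
    by simp
  then show ?thesis
    by (metis card_subset_eq finite subset_UNIV)
qed

lemma forall_5: "(\<forall>i :: 5. P i) \<longleftrightarrow> P 0 \<and> P 1 \<and> P 2 \<and> P 3 \<and> P 4"
  using UNIV_5 by (metis UNIV_I insertE singletonD)

lemma sum_UNIV_5: "(\<Sum>i\<in>(UNIV :: 5 set). f i) = f 0 + f 1 + f 2 + f 3 + f 4"
  unfolding UNIV_5 by (simp add: ac_simps)

section \<open>Coordinates, and the sixteen products written in them\<close>

definition v5 :: "'b \<Rightarrow> 'b \<Rightarrow> 'b \<Rightarrow> 'b \<Rightarrow> 'b \<Rightarrow> 'b ^ 5" where
  "v5 a b c d e = (\<chi> i. if i = 0 then a else if i = 1 then b else if i = 2 then c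
                         else if i = 3 then d else e)"

lemma v5_nth [simp]:
  "v5 a b c d e $ 0 = a" "v5 a b c d e $ 1 = b" "v5 a b c d e $ 2 = c"
  "v5 a b c d e $ 3 = d" "v5 a b c d e $ 4 = e"
  by (simp_all add: v5_def)

lemma v5_eq_iff: "x = y \<longleftrightarrow> x $ 0 = y $ 0 \<and> x $ 1 = y $ 1 \<and> x $ 2 = y $ 2 \<and> x $ 3 = y $ 3 \<and> x $ 4 = y $ 4"
  for x y :: "'b ^ 5"
  by (simp add: vec_eq_iff forall_5)

lemma v5_inject [simp]:
  "v5 a b c d e = v5 a' b' c' d' e' \<longleftrightarrow> a = a' \<and> b = b' \<and> c = c' \<and> d = d' \<and> e = e'"
  by (simp add: v5_eq_iff)

lemma v5_zero [simp]: "v5 a b c d e = 0 \<longleftrightarrow> a = 0 \<and> b = 0 \<and> c = 0 \<and> d = 0 \<and> e = 0"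
  by (simp add: v5_eq_iff)

lemma v5_scale [simp]: "k *s v5 a b c d e = v5 (k * a) (k * b) (k * c) (k * d) (k * e)"
  by (simp add: v5_eq_iff)

text \<open>Index 0 is the unity of the factor C, index 1 that of the algebra of the form, and 2, 3,
  4 span W; the entries -1 come from the sign of -q. With this table all sixteen algebras live on
  one type.\<close>

definition Jq_table :: "nat \<Rightarrow> product_table" where
  "Jq_table r = [((0, 0), basis_vec 0), ((1, 1), basis_vec 1), ((1, 2), basis_vec 2),
      ((1, 3), basis_vec 3), ((1, 4), basis_vec 4),
      ((2, 2), (if 1 \<le> r then -1 else 0) *s basis_vec 1),
      ((3, 3), (if 2 \<le> r then -1 else 0) *s basis_vec 1),
      ((4, 4), (if 3 \<le> r then -1 else 0) *s basis_vec 1)]"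

definition all_tables :: "product_table list" where
  "all_tables = J5_tables @ [Jq_table 1, Jq_table 2, Jq_table 3]"

definition J5_mult :: "nat \<Rightarrow> complex ^ 5 \<Rightarrow> complex ^ 5 \<Rightarrow> complex ^ 5" where
  "J5_mult k = table_mult (all_tables ! (k - 1))"

lemmas table_defs = all_tables_def J5_tables_def tables_1_5_def tables_6_9_def tables_10_11_def
  table_12_def table_13_def Jq_table_def

text \<open>The first equation has \<open>Suc 0\<close> because simp rewrites the natural number 1
  to it.\<close>

lemma J5_mult_eq:
  "J5_mult (Suc 0) x y = v5
    (x $ 0 * y $ 0)
    ((x $ 0 * y $ 1 + x $ 1 * y $ 0))
    ((x $ 0 * y $ 2 + x $ 2 * y $ 0))
    ((x $ 0 * y $ 3 + x $ 3 * y $ 0) + x $ 1 * y $ 1)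
    ((x $ 0 * y $ 4 + x $ 4 * y $ 0) + (x $ 1 * y $ 2 + x $ 2 * y $ 1))"
  "J5_mult 2 x y = v5
    (x $ 0 * y $ 0)
    ((x $ 0 * y $ 1 + x $ 1 * y $ 0))
    ((x $ 0 * y $ 2 + x $ 2 * y $ 0))
    ((x $ 0 * y $ 3 + x $ 3 * y $ 0) + x $ 1 * y $ 1 + x $ 2 * y $ 2)
    ((x $ 0 * y $ 4 + x $ 4 * y $ 0) + (x $ 1 * y $ 2 + x $ 2 * y $ 1))"
  "J5_mult 3 x y = v5
    (x $ 0 * y $ 0)
    ((x $ 0 * y $ 1 + x $ 1 * y $ 0))
    ((x $ 0 * y $ 2 + x $ 2 * y $ 0))
    ((x $ 0 * y $ 3 + x $ 3 * y $ 0))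
    ((x $ 0 * y $ 4 + x $ 4 * y $ 0) + x $ 1 * y $ 1)"
  "J5_mult 4 x y = v5
    (x $ 0 * y $ 0)
    ((x $ 0 * y $ 1 + x $ 1 * y $ 0))
    ((x $ 0 * y $ 2 + x $ 2 * y $ 0))
    ((x $ 0 * y $ 3 + x $ 3 * y $ 0))
    ((x $ 0 * y $ 4 + x $ 4 * y $ 0) + x $ 1 * y $ 1 + x $ 2 * y $ 2)"
  "J5_mult 5 x y = v5
    (x $ 0 * y $ 0)
    ((x $ 0 * y $ 1 + x $ 1 * y $ 0))
    ((x $ 0 * y $ 2 + x $ 2 * y $ 0))
    ((x $ 0 * y $ 3 + x $ 3 * y $ 0))
    ((x $ 0 * y $ 4 + x $ 4 * y $ 0) + x $ 1 * y $ 1 + x $ 2 * y $ 2 + x $ 3 * y $ 3)"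
  "J5_mult 6 x y = v5
    (x $ 0 * y $ 0)
    (x $ 1 * y $ 1)
    ((x $ 0 * y $ 2 + x $ 2 * y $ 0))
    ((x $ 0 * y $ 3 + x $ 3 * y $ 0) / 2 + (x $ 1 * y $ 3 + x $ 3 * y $ 1) / 2)
    ((x $ 0 * y $ 4 + x $ 4 * y $ 0) / 2 + (x $ 1 * y $ 4 + x $ 4 * y $ 1) / 2)"
  "J5_mult 7 x y = v5
    (x $ 0 * y $ 0)
    (x $ 1 * y $ 1)
    ((x $ 0 * y $ 2 + x $ 2 * y $ 0) + x $ 3 * y $ 3)
    ((x $ 0 * y $ 3 + x $ 3 * y $ 0) / 2 + (x $ 1 * y $ 3 + x $ 3 * y $ 1) / 2)
    ((x $ 0 * y $ 4 + x $ 4 * y $ 0) / 2 + (x $ 1 * y $ 4 + x $ 4 * y $ 1) / 2)"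
  "J5_mult 8 x y = v5
    (x $ 0 * y $ 0)
    (x $ 1 * y $ 1)
    ((x $ 0 * y $ 2 + x $ 2 * y $ 0) + x $ 3 * y $ 3 + x $ 4 * y $ 4)
    ((x $ 0 * y $ 3 + x $ 3 * y $ 0) / 2 + (x $ 1 * y $ 3 + x $ 3 * y $ 1) / 2)
    ((x $ 0 * y $ 4 + x $ 4 * y $ 0) / 2 + (x $ 1 * y $ 4 + x $ 4 * y $ 1) / 2)"
  "J5_mult 9 x y = v5
    (x $ 0 * y $ 0)
    (x $ 1 * y $ 1)
    ((x $ 0 * y $ 2 + x $ 2 * y $ 0))
    ((x $ 0 * y $ 3 + x $ 3 * y $ 0) / 2 + (x $ 1 * y $ 3 + x $ 3 * y $ 1) / 2)
    ((x $ 0 * y $ 4 + x $ 4 * y $ 0) / 2 + (x $ 1 * y $ 4 + x $ 4 * y $ 1) / 2 + (x $ 2 * y $ 3 + x $ 3 * y $ 2))"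
  "J5_mult 10 x y = v5
    (x $ 0 * y $ 0)
    (x $ 1 * y $ 1)
    ((x $ 0 * y $ 2 + x $ 2 * y $ 0))
    ((x $ 0 * y $ 3 + x $ 3 * y $ 0))
    ((x $ 0 * y $ 4 + x $ 4 * y $ 0) / 2 + (x $ 1 * y $ 4 + x $ 4 * y $ 1) / 2)"
  "J5_mult 11 x y = v5
    (x $ 0 * y $ 0)
    (x $ 1 * y $ 1)
    ((x $ 0 * y $ 2 + x $ 2 * y $ 0) + x $ 4 * y $ 4)
    ((x $ 0 * y $ 3 + x $ 3 * y $ 0))
    ((x $ 0 * y $ 4 + x $ 4 * y $ 0) / 2 + (x $ 1 * y $ 4 + x $ 4 * y $ 1) / 2)"
  "J5_mult 12 x y = v5
    (x $ 0 * y $ 0)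
    (x $ 1 * y $ 1)
    ((x $ 0 * y $ 2 + x $ 2 * y $ 0))
    ((x $ 0 * y $ 3 + x $ 3 * y $ 0))
    ((x $ 0 * y $ 4 + x $ 4 * y $ 0))"
  "J5_mult 13 x y = v5
    (x $ 0 * y $ 0)
    (x $ 1 * y $ 1)
    (x $ 2 * y $ 2)
    ((x $ 0 * y $ 3 + x $ 3 * y $ 0) / 2 + (x $ 1 * y $ 3 + x $ 3 * y $ 1) / 2)
    ((x $ 0 * y $ 4 + x $ 4 * y $ 0) / 2 + (x $ 2 * y $ 4 + x $ 4 * y $ 2) / 2)"
  "J5_mult 14 x y = v5
    (x $ 0 * y $ 0)
    (x $ 1 * y $ 1 - x $ 2 * y $ 2)
    ((x $ 1 * y $ 2 + x $ 2 * y $ 1))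
    ((x $ 1 * y $ 3 + x $ 3 * y $ 1))
    ((x $ 1 * y $ 4 + x $ 4 * y $ 1))"
  "J5_mult 15 x y = v5
    (x $ 0 * y $ 0)
    (x $ 1 * y $ 1 - x $ 2 * y $ 2 - x $ 3 * y $ 3)
    ((x $ 1 * y $ 2 + x $ 2 * y $ 1))
    ((x $ 1 * y $ 3 + x $ 3 * y $ 1))
    ((x $ 1 * y $ 4 + x $ 4 * y $ 1))"
  "J5_mult 16 x y = v5
    (x $ 0 * y $ 0)
    (x $ 1 * y $ 1 - x $ 2 * y $ 2 - x $ 3 * y $ 3 - x $ 4 * y $ 4)
    ((x $ 1 * y $ 2 + x $ 2 * y $ 1))
    ((x $ 1 * y $ 3 + x $ 3 * y $ 1))
    ((x $ 1 * y $ 4 + x $ 4 * y $ 1))"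
  by (simp_all add: J5_mult_def v5_eq_iff table_mult_def basis_product_def table_defs Let_def sum_UNIV_5 axis_def
      algebra_simps add_divide_distrib)

section \<open>Invariants under isomorphism\<close>

text \<open>Substitute for membership in the radical: in the algebras 1 to 11, where the tests below
  use it, exactly the elements of the radical have cube zero.\<close>

definition cube_zero :: "('a::ab_group_add \<Rightarrow> 'a \<Rightarrow> 'a) \<Rightarrow> 'a \<Rightarrow> bool" where
  "cube_zero m x \<longleftrightarrow> m x (m x x) = 0"

text \<open>Membership of \<open>y\<close> in the Peirce 1/2-space of the idempotent
  \<open>g\<close>.\<close>

definition half_space :: "(complex \<Rightarrow> 'a \<Rightarrow> 'a) \<Rightarrow> ('a::ab_group_add \<Rightarrow> 'a \<Rightarrow> 'a) \<Rightarrow> 'a \<Rightarrow> 'a \<Rightarrow> bool" where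
  "half_space sc m g y \<longleftrightarrow> m g g = g \<and> sc 2 (m g y) = y"

definition local_algebra :: "('a::ab_group_add \<Rightarrow> 'a \<Rightarrow> 'a) \<Rightarrow> bool" where
  "local_algebra m \<longleftrightarrow> (\<forall>g. m g g = g \<longrightarrow> g = 0 \<or> (\<forall>y. m g y = y))"

text \<open>The product on the radical is a symmetric bilinear map; asked for is an isotropic vector
  outside its kernel.\<close>

definition has_isotropic :: "('a::ab_group_add \<Rightarrow> 'a \<Rightarrow> 'a) \<Rightarrow> bool" where
  "has_isotropic m \<longleftrightarrow> (\<exists>x y. cube_zero m x \<and> cube_zero m y \<and> m x x = 0 \<and> m x y \<noteq> 0)"

definition has_orthogonal_pair :: "('a::ab_group_add \<Rightarrow> 'a \<Rightarrow> 'a) \<Rightarrow> bool" where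
  "has_orthogonal_pair m \<longleftrightarrow>
     (\<exists>x y. cube_zero m x \<and> cube_zero m y \<and> m x y = 0 \<and> m x x \<noteq> 0 \<and> m y y \<noteq> 0)"

text \<open>Separates form rank 3 from rank 2: an isotropic vector outside the kernel has an
  anisotropic vector orthogonal to it only if the rank is at least three.\<close>

definition isotropic_orthogonal :: "('a::ab_group_add \<Rightarrow> 'a \<Rightarrow> 'a) \<Rightarrow> bool" where
  "isotropic_orthogonal m \<longleftrightarrow>
     (\<exists>x y z. cube_zero m x \<and> cube_zero m y \<and> cube_zero m z \<and>
        m x x = 0 \<and> m x z \<noteq> 0 \<and> m x y = 0 \<and> m y y \<noteq> 0)"

text \<open>Multiplication by \<open>g\<close> being a projection means that the eigenvalue 1/2 does
  not occur, so that the algebra is the direct product of the two Peirce spaces of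
  \<open>g\<close>.\<close>

definition decomposable :: "('a::ab_group_add \<Rightarrow> 'a \<Rightarrow> 'a) \<Rightarrow> bool" where
  "decomposable m \<longleftrightarrow>
     (\<exists>g. m g g = g \<and> g \<noteq> 0 \<and> (\<exists>y. m g y \<noteq> y) \<and> (\<forall>y. m g (m g y) = m g y))"

definition has_half_space :: "(complex \<Rightarrow> 'a \<Rightarrow> 'a) \<Rightarrow> ('a::ab_group_add \<Rightarrow> 'a \<Rightarrow> 'a) \<Rightarrow> bool" where
  "has_half_space sc m \<longleftrightarrow> (\<exists>g y. half_space sc m g y \<and> y \<noteq> 0)"

definition half_squares_zero :: "(complex \<Rightarrow> 'a \<Rightarrow> 'a) \<Rightarrow> ('a::ab_group_add \<Rightarrow> 'a \<Rightarrow> 'a) \<Rightarrow> bool" where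
  "half_squares_zero sc m \<longleftrightarrow> (\<forall>g y. half_space sc m g y \<longrightarrow> m y y = 0)"

text \<open>Satisfied by a kernel vector of the quadratic form; it only has to tell algebra 15 from
  the semisimple algebra 16.\<close>

definition has_radical_vector :: "('a::ab_group_add \<Rightarrow> 'a \<Rightarrow> 'a) \<Rightarrow> bool" where
  "has_radical_vector m \<longleftrightarrow> (\<exists>x. x \<noteq> 0 \<and> m x x = 0 \<and> (\<forall>y. m (m x y) (m x y) = 0))"

definition three_idempotents :: "('a::ab_group_add \<Rightarrow> 'a \<Rightarrow> 'a) \<Rightarrow> bool" where
  "three_idempotents m \<longleftrightarrow>
     (\<exists>f g h. m f f = f \<and> m g g = g \<and> m h h = h \<and> f \<noteq> 0 \<and> g \<noteq> 0 \<and> h \<noteq> 0 \<and>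
        m f g = 0 \<and> m f h = 0 \<and> m g h = 0)"

definition half_space_plane :: "(complex \<Rightarrow> 'a \<Rightarrow> 'a) \<Rightarrow> ('a::ab_group_add \<Rightarrow> 'a \<Rightarrow> 'a) \<Rightarrow> bool" where
  "half_space_plane sc m \<longleftrightarrow>
     (\<exists>g x y. half_space sc m g x \<and> half_space sc m g y \<and> x \<noteq> 0 \<and> (\<forall>c. y \<noteq> sc c x))"

definition nil_nonzero_square :: "('a::ab_group_add \<Rightarrow> 'a \<Rightarrow> 'a) \<Rightarrow> bool" where
  "nil_nonzero_square m \<longleftrightarrow> (\<exists>x. cube_zero m x \<and> m x x \<noteq> 0)"

definition nil_square_in_half :: "(complex \<Rightarrow> 'a \<Rightarrow> 'a) \<Rightarrow> ('a::ab_group_add \<Rightarrow> 'a \<Rightarrow> 'a) \<Rightarrow> bool" where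
  "nil_square_in_half sc m \<longleftrightarrow>
     (\<exists>g x. cube_zero m x \<and> m x x \<noteq> 0 \<and> half_space sc m g (m x x))"

text \<open>A decision tree whose leaves are the numbers of the algebras. An invariant has to be
  evaluated only on the algebras that reach its node.\<close>

definition algebra_type :: "(complex \<Rightarrow> 'a \<Rightarrow> 'a) \<Rightarrow> ('a::ab_group_add \<Rightarrow> 'a \<Rightarrow> 'a) \<Rightarrow> nat" where
  "algebra_type sc m =
    (if local_algebra m then
       (if has_isotropic m then
          (if has_orthogonal_pair m then (if isotropic_orthogonal m then 5 else 4) else 1)
        else (if has_orthogonal_pair m then 2 else 3))
     else if decomposable m then
       (if \<not> has_half_space sc m then 12 else if half_squares_zero sc m then 14
        else if has_radical_vector m then 15 else 16)
     else if three_idempotents m then 13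
     else if half_space_plane sc m then
       (if \<not> nil_nonzero_square m then 6 else if nil_square_in_half sc m then 9
        else if has_isotropic m then 8 else 7)
     else (if nil_nonzero_square m then 11 else 10))"

text \<open>Bi-totality carries the quantifiers and bi-uniqueness the equations, so parametricity
  proves the invariance from the shape of the definitions. The relation will be the graph of an
  isomorphism.\<close>

lemma algebra_type_transfer:
  includes lifting_syntax
  fixes R :: "'a::ab_group_add \<Rightarrow> 'b::ab_group_add \<Rightarrow> bool"
  assumes [transfer_rule]: "bi_total R" "bi_unique R" "(R ===> R ===> R) m1 m2"
    "((=) ===> R ===> R) sc1 sc2" "R 0 0"
  shows "algebra_type sc1 m1 = algebra_type sc2 m2"
proof -
  have "rel_fun R (=) (cube_zero m1) (cube_zero m2)"
    unfolding cube_zero_def[abs_def] by transfer_prover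
  note [transfer_rule] = this
  have "rel_fun R (rel_fun R (=)) (half_space sc1 m1) (half_space sc2 m2)"
    unfolding half_space_def[abs_def] by transfer_prover
  note [transfer_rule] = this
  have "local_algebra m1 = local_algebra m2"
    unfolding local_algebra_def by transfer_prover
  moreover have "has_isotropic m1 = has_isotropic m2"
    unfolding has_isotropic_def by transfer_prover
  moreover have "has_orthogonal_pair m1 = has_orthogonal_pair m2"
    unfolding has_orthogonal_pair_def by transfer_prover
  moreover have "isotropic_orthogonal m1 = isotropic_orthogonal m2"
    unfolding isotropic_orthogonal_def by transfer_prover
  moreover have "decomposable m1 = decomposable m2"
    unfolding decomposable_def by transfer_prover
  moreover have "has_half_space sc1 m1 = has_half_space sc2 m2"
    unfolding has_half_space_def by transfer_prover
  moreover have "half_squares_zero sc1 m1 = half_squares_zero sc2 m2"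
    unfolding half_squares_zero_def by transfer_prover
  moreover have "has_radical_vector m1 = has_radical_vector m2"
    unfolding has_radical_vector_def by transfer_prover
  moreover have "three_idempotents m1 = three_idempotents m2"
    unfolding three_idempotents_def by transfer_prover
  moreover have "half_space_plane sc1 m1 = half_space_plane sc2 m2"
    unfolding half_space_plane_def by transfer_prover
  moreover have "nil_nonzero_square m1 = nil_nonzero_square m2"
    unfolding nil_nonzero_square_def by transfer_prover
  moreover have "nil_square_in_half sc1 m1 = nil_square_in_half sc2 m2"
    unfolding nil_square_in_half_def by transfer_prover
  ultimately show ?thesis
    by (simp add: algebra_type_def)
qed

lemma algebra_type_isomorphic:
  assumes "algebra_isomorphic sc1 m1 sc2 m2"
  shows "algebra_type sc1 m1 = algebra_type sc2 m2"
proof -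
  obtain f where "Vector_Spaces.linear sc1 sc2 f" and "bij f"
    and mul: "\<And>x y. f (m1 x y) = m2 (f x) (f y)"
    using assms unfolding algebra_isomorphic_def by blast
  interpret f: Vector_Spaces.linear sc1 sc2 f by fact
  show ?thesis
  proof (rule algebra_type_transfer[where R = "\<lambda>x y. y = f x"])
    show "bi_total (\<lambda>x y. y = f x)" "bi_unique (\<lambda>x y. y = f x)"
      using \<open>bij f\<close> by (auto simp: bi_total_def bi_unique_def bij_def inj_def surj_def)
  qed (auto simp: rel_fun_def mul f.scale f.zero)
qed

lemma algebra_isomorphic_sym:
  assumes "algebra_isomorphic sc1 m1 sc2 m2"
  shows "algebra_isomorphic sc2 m2 sc1 m1"
proof -
  obtain f where "Vector_Spaces.linear sc1 sc2 f" and "bij f"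
    and mul: "\<And>x y. f (m1 x y) = m2 (f x) (f y)"
    using assms unfolding algebra_isomorphic_def by blast
  interpret f: Vector_Spaces.linear sc1 sc2 f by fact
  have f: "f (inv f y) = y" "inv f (f x) = x" for x y
    using \<open>bij f\<close> by (simp_all add: bij_def surj_f_inv_f)
  have "inv f (x + y) = inv f x + inv f y" "inv f (sc2 c x) = sc1 c (inv f x)" for c x y
    by (metis f f.add, metis f f.scale)
  then have "Vector_Spaces.linear sc2 sc1 (inv f)"
    by unfold_locales
  moreover have "inv f (m2 x y) = m1 (inv f x) (inv f y)" for x y
    by (metis f mul)
  ultimately show ?thesis
    using \<open>bij f\<close> bij_imp_bij_inv unfolding algebra_isomorphic_def by blast
qed

lemma algebra_isomorphic_trans:
  assumes "algebra_isomorphic sc1 m1 sc2 m2" "algebra_isomorphic sc2 m2 sc3 m3"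
  shows "algebra_isomorphic sc1 m1 sc3 m3"
proof -
  obtain f where f: "Vector_Spaces.linear sc1 sc2 f" "bij f" "\<And>x y. f (m1 x y) = m2 (f x) (f y)"
    using assms(1) unfolding algebra_isomorphic_def by blast
  obtain g where g: "Vector_Spaces.linear sc2 sc3 g" "bij g" "\<And>x y. g (m2 x y) = m3 (g x) (g y)"
    using assms(2) unfolding algebra_isomorphic_def by blast
  have "Vector_Spaces.linear sc1 sc3 (g \<circ> f)"
    using Vector_Spaces.linear_compose f(1) g(1) by blast
  moreover have "bij (g \<circ> f)"
    using f(2) g(2) by (rule bij_comp)
  ultimately show ?thesis
    using f(3) g(3) unfolding algebra_isomorphic_def by (metis comp_apply)
qed

lemma Jq_table_isomorphic:
  assumes "r \<le> 3"
  shows "algebra_isomorphic (*s) (table_mult (Jq_table r))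
           (module_prod.scale (*) Jq4_scale) (prod_mult (*) (Jq4_mult r))"
proof -
  define f :: "complex ^ 5 \<Rightarrow> complex \<times> (complex \<times> (complex ^ 3))"
    where "f x = (x $ 0, x $ 1, vector [x $ 2, x $ 3, x $ 4])" for x
  have c: "vector_space ((*) :: complex \<Rightarrow> complex \<Rightarrow> complex)"
    by unfold_locales (simp_all add: algebra_simps)
  then interpret P: vector_space_prod "(*) :: complex \<Rightarrow> complex \<Rightarrow> complex" "(*s) :: complex \<Rightarrow> complex ^ 3 \<Rightarrow> _"
    using c vec.vector_space_axioms by (simp add: vector_space_prod_def vector_space_pair_def)
  interpret Q: vector_space_prod "(*) :: complex \<Rightarrow> complex \<Rightarrow> complex" Jq4_scale
    unfolding Jq4_scale_def using c P.p.vector_space_axioms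
    by (simp add: vector_space_prod_def vector_space_pair_def)
  have r: "r = 0 \<or> r = 1 \<or> r = 2 \<or> r = 3"
    using assms by auto
  have "Vector_Spaces.linear (*s) (module_prod.scale (*) Jq4_scale) f"
  proof unfold_locales
    have "Jq4_scale c q = (c * fst q, c *s snd q)" for c q
      by (simp add: Jq4_scale_def P.scale_def)
    then show "f (c *s x) = module_prod.scale (*) Jq4_scale c (f x)" for c x
      by (simp add: f_def Q.scale_def vec_eq_iff forall_3 vector_3)
  qed (simp_all add: f_def vec_eq_iff forall_3 vector_3)
  moreover have "f (table_mult (Jq_table r) x y) = prod_mult (*) (Jq4_mult r) (f x) (f y)" for x y
    using r by (auto simp: f_def prod_mult_def Jq4_mult_def diag_form_def vec_eq_iff forall_3 vector_3
        table_mult_def basis_product_def Jq_table_def sum_UNIV_5 axis_def numeral_2_eq_2 numeral_3_eq_3)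
  moreover have "bij f"
  proof (rule bij_betw_byWitness[where f' = "\<lambda>p. v5 (fst p) (fst (snd p)) (snd (snd p) $ 1)
        (snd (snd p) $ 2) (snd (snd p) $ 3)"])
  qed (auto simp: f_def v5_eq_iff vec_eq_iff forall_3 vector_3 prod_eq_iff)
  ultimately show ?thesis
    unfolding algebra_isomorphic_def by blast
qed

lemma isomorphic_to_J5_iff:
  assumes "k \<in> {1..16}"
  shows "isomorphic_to_J5 sc m k \<longleftrightarrow> algebra_isomorphic sc m (*s) (J5_mult k)"
proof (cases "k \<le> 13")
  case True
  \<comment> \<open>Algebra \<open>k\<close> has list index \<open>k - 1\<close>: indices below 13
    stay inside \<open>J5_tables\<close>, and 14, 15, 16 reach the forms of rank
    \<open>k - 13\<close>.\<close>
  have "length J5_tables = 13"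
    by (simp add: J5_tables_def tables_1_5_def tables_6_9_def tables_10_11_def Let_def)
  moreover have "k - 1 < 13"
    using True by simp
  ultimately have "all_tables ! (k - 1) = J5_tables ! (k - 1)"
    using assms by (simp add: all_tables_def nth_append)
  then show ?thesis
    using True by (simp add: isomorphic_to_J5_def J5_mult_def)
next
  case False
  then have "k = 14 \<or> k = 15 \<or> k = 16"
    using assms by auto
  then have "J5_mult k = table_mult (Jq_table (k - 13))"
    by (auto simp: J5_mult_def table_defs Let_def)
  moreover have "k - 13 \<le> 3"
    using assms by auto
  ultimately show ?thesis
    using False Jq_table_isomorphic[of "k - 13"] algebra_isomorphic_trans algebra_isomorphic_sym
    unfolding isomorphic_to_J5_def by metis
qed

section \<open>Values of the invariants on the sixteen algebras\<close>

text \<open>Coordinate 0, and from algebra 6 on also coordinate 1, is multiplicative; when these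
  vanish, so does the cube.\<close>

lemma cube_zero_J5_mult:
  "cube_zero (J5_mult (Suc 0)) x \<longleftrightarrow> x $ 0 = 0"
  "cube_zero (J5_mult 2) x \<longleftrightarrow> x $ 0 = 0"
  "cube_zero (J5_mult 3) x \<longleftrightarrow> x $ 0 = 0"
  "cube_zero (J5_mult 4) x \<longleftrightarrow> x $ 0 = 0"
  "cube_zero (J5_mult 5) x \<longleftrightarrow> x $ 0 = 0"
  "cube_zero (J5_mult 6) x \<longleftrightarrow> x $ 0 = 0 \<and> x $ 1 = 0"
  "cube_zero (J5_mult 7) x \<longleftrightarrow> x $ 0 = 0 \<and> x $ 1 = 0"
  "cube_zero (J5_mult 8) x \<longleftrightarrow> x $ 0 = 0 \<and> x $ 1 = 0"
  "cube_zero (J5_mult 9) x \<longleftrightarrow> x $ 0 = 0 \<and> x $ 1 = 0"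
  "cube_zero (J5_mult 10) x \<longleftrightarrow> x $ 0 = 0 \<and> x $ 1 = 0"
  "cube_zero (J5_mult 11) x \<longleftrightarrow> x $ 0 = 0 \<and> x $ 1 = 0"
  by (auto simp: cube_zero_def J5_mult_eq v5_eq_iff algebra_simps)

lemma local_1_5:
  assumes k: "k \<in> {1, 2, 3, 4, 5}"
  shows "local_algebra (J5_mult k)"
  unfolding local_algebra_def
proof (intro allI impI)
  fix x
  assume idem: "J5_mult k x x = x"
  have "x $ 0 = 0 \<or> x $ 0 = 1"
    using k idem by (elim insertE emptyE) (simp_all add: J5_mult_eq v5_eq_iff)
  then show "x = 0 \<or> (\<forall>y. J5_mult k x y = y)"
    using k idem by (elim insertE emptyE disjE) (auto simp: J5_mult_eq v5_eq_iff)
qed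

text \<open>In all these tables basis vector 0 is an idempotent that annihilates basis vector
  1.\<close>

lemma not_local_6: "\<not> local_algebra (J5_mult 6)"
  and not_local_7: "\<not> local_algebra (J5_mult 7)"
  and not_local_8: "\<not> local_algebra (J5_mult 8)"
  and not_local_9: "\<not> local_algebra (J5_mult 9)"
  and not_local_10: "\<not> local_algebra (J5_mult 10)"
  and not_local_11: "\<not> local_algebra (J5_mult 11)"
  and not_local_12: "\<not> local_algebra (J5_mult 12)"
  and not_local_13: "\<not> local_algebra (J5_mult 13)"
  and not_local_14: "\<not> local_algebra (J5_mult 14)"
  and not_local_15: "\<not> local_algebra (J5_mult 15)"
  and not_local_16: "\<not> local_algebra (J5_mult 16)"
  unfolding local_algebra_def
  by (rule notI, drule spec[of _ "(v5 1 0 0 0 0)"], simp add: J5_mult_eq v5_eq_iff, drule spec[of _ "(v5 0 1 0 0 0)"], simp add: J5_mult_eq v5_eq_iff)+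

lemma has_isotropic_1: "has_isotropic (J5_mult 1)"
  unfolding has_isotropic_def half_space_def
  by (intro exI[of _ "(v5 0 0 1 0 0)"] exI[of _ "(v5 0 1 0 0 0)"]) (simp add: cube_zero_J5_mult J5_mult_eq v5_eq_iff)

text \<open>A radical element has nonzero square only if its coordinate 1 is nonzero, and the
  product of coordinates 1 is a coordinate of the product.\<close>

lemma not_has_orthogonal_pair_1: "\<not> has_orthogonal_pair (J5_mult 1)"
  and not_has_orthogonal_pair_3: "\<not> has_orthogonal_pair (J5_mult 3)"
  by (auto simp: has_orthogonal_pair_def cube_zero_J5_mult J5_mult_eq v5_eq_iff)

lemma not_has_isotropic_2: "\<not> has_isotropic (J5_mult 2)"
  and not_has_isotropic_3: "\<not> has_isotropic (J5_mult 3)"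
  and not_has_isotropic_7: "\<not> has_isotropic (J5_mult 7)"
  by (auto simp: has_isotropic_def cube_zero_J5_mult J5_mult_eq v5_eq_iff)

text \<open>As v1^2 = v2^2, the elements v1 + v2 and v1 - v2 are orthogonal.\<close>

lemma has_orthogonal_pair_2: "has_orthogonal_pair (J5_mult 2)"
  unfolding has_orthogonal_pair_def half_space_def
  by (intro exI[of _ "(v5 0 1 1 0 0)"] exI[of _ "(v5 0 1 (-1) 0 0)"]) (simp add: cube_zero_J5_mult J5_mult_eq v5_eq_iff)

lemma has_isotropic_4: "has_isotropic (J5_mult 4)"
  and has_isotropic_5: "has_isotropic (J5_mult 5)"
  unfolding has_isotropic_def
  by (intro exI[of _ "(v5 0 1 (\<i>) 0 0)"] exI[of _ "(v5 0 1 0 0 0)"], simp add: cube_zero_J5_mult J5_mult_eq v5_eq_iff)+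

lemma has_orthogonal_pair_4: "has_orthogonal_pair (J5_mult 4)"
  and has_orthogonal_pair_5: "has_orthogonal_pair (J5_mult 5)"
  unfolding has_orthogonal_pair_def
  by (intro exI[of _ "(v5 0 1 0 0 0)"] exI[of _ "(v5 0 0 1 0 0)"], simp add: cube_zero_J5_mult J5_mult_eq v5_eq_iff)+

text \<open>For a form of rank two, what is orthogonal to an isotropic vector outside the kernel is
  a multiple of it modulo the kernel, hence isotropic.\<close>

lemma not_isotropic_orthogonal_4: "\<not> isotropic_orthogonal (J5_mult 4)"
proof -
  have "c * c + d * d = 0" if "a * a + b * b = 0" "a * r + b * s \<noteq> 0" "a * c + b * d = 0" for a b c d r s :: complex
  proof -
    have "a \<noteq> 0"
      using that by auto
    \<comment> \<open>From a c = - b d and b^2 = - a^2 follows a^2 c^2 = b^2 d^2 = - a^2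
      d^2.\<close>
    moreover have "a * a * (c * c + d * d) = 0"
      using that(1,3) by algebra
    ultimately show ?thesis
      by simp
  qed
  then show ?thesis
    by (auto simp: isotropic_orthogonal_def cube_zero_J5_mult J5_mult_eq v5_eq_iff) metis+
qed

lemma isotropic_orthogonal_5: "isotropic_orthogonal (J5_mult 5)"
  unfolding isotropic_orthogonal_def half_space_def
  by (intro exI[of _ "(v5 0 1 (\<i>) 0 0)"] exI[of _ "(v5 0 0 0 1 0)"] exI[of _ "(v5 0 1 0 0 0)"]) (simp add: cube_zero_J5_mult J5_mult_eq v5_eq_iff)

text \<open>The first two coordinates of an idempotent are 0 or 1; if they are equal, the remaining
  equations force the nilpotent part to vanish.\<close>

lemma idempotent_cases_6_11:
  assumes k: "k \<in> {6, 7, 8, 9, 10, 11}" and idem: "J5_mult k x x = x"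
  shows "x = 0 \<or> x = v5 1 1 0 0 0 \<or> x $ 0 = 1 \<and> x $ 1 = 0 \<or> x $ 0 = 0 \<and> x $ 1 = 1"
proof -
  have "(x $ 0 = 0 \<or> x $ 0 = 1) \<and> (x $ 1 = 0 \<or> x $ 1 = 1)"
    using k idem by (elim insertE emptyE) (simp_all add: J5_mult_eq v5_eq_iff)
  then show ?thesis
    using k idem by (elim insertE emptyE conjE disjE) (auto simp: J5_mult_eq v5_eq_iff)
qed

lemma not_decomposable_6_11:
  assumes k: "k \<in> {6, 7, 8, 9, 10, 11}"
  shows "\<not> decomposable (J5_mult k)"
proof
  assume "decomposable (J5_mult k)"
  then obtain x y where idem: "J5_mult k x x = x" and "x \<noteq> 0" and y: "J5_mult k x y \<noteq> y"
    and c: "\<And>y. J5_mult k x (J5_mult k x y) = J5_mult k x y"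
    unfolding decomposable_def by blast
  have "x \<noteq> v5 1 1 0 0 0"
    using k y by (elim insertE emptyE) (auto simp: J5_mult_eq v5_eq_iff)
  then have x: "x $ 0 = 1 \<and> x $ 1 = 0 \<or> x $ 0 = 0 \<and> x $ 1 = 1"
    using idempotent_cases_6_11[OF k idem] \<open>x \<noteq> 0\<close> by blast
  \<comment> \<open>The last basis vector \<open>d\<close> is an eigenvector for 1/2 of both
    \<open>e1\<close> and \<open>e2\<close> in all six tables, so multiplying it by \<open>x\<close>
    halves its coordinate 4.\<close>
  show False
    using k x c[of "(v5 0 0 0 0 1)"] by (elim insertE emptyE disjE) (auto simp: J5_mult_eq v5_eq_iff)
qed

text \<open>The first two coordinates map the algebra onto C x C. Nonzero idempotents stay nonzero
  there, and two coordinates have no room for three disjoint supports.\<close>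

lemma not_three_idempotents_6_11:
  assumes k: "k \<in> {6, 7, 8, 9, 10, 11}"
  shows "\<not> three_idempotents (J5_mult k)"
proof
  assume "three_idempotents (J5_mult k)"
  then obtain x y z where idem: "J5_mult k x x = x" "J5_mult k y y = y" "J5_mult k z z = z"
    and nz: "x \<noteq> 0" "y \<noteq> 0" "z \<noteq> 0"
    and orth: "J5_mult k x y = 0" "J5_mult k x z = 0" "J5_mult k y z = 0"
    unfolding three_idempotents_def by blast
  have *: "u $ 0 * v $ 0 = 0 \<and> u $ 1 * v $ 1 = 0" if "J5_mult k u v = 0" for u v
    using k that by (elim insertE emptyE) (simp_all add: J5_mult_eq v5_eq_iff)
  have **: "u $ 0 = 1 \<or> u $ 1 = 1" if "J5_mult k u u = u" "u \<noteq> 0" for u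
    using idempotent_cases_6_11[OF k that(1)] that(2) by auto
  show False
    using *[OF orth(1)] *[OF orth(2)] *[OF orth(3)] **[OF idem(1) nz(1)] **[OF idem(2) nz(2)]
      **[OF idem(3) nz(3)] by auto
qed

lemma half_space_plane_6: "half_space_plane (*s) (J5_mult 6)"
  and half_space_plane_7: "half_space_plane (*s) (J5_mult 7)"
  and half_space_plane_8: "half_space_plane (*s) (J5_mult 8)"
  and half_space_plane_9: "half_space_plane (*s) (J5_mult 9)"
  unfolding half_space_plane_def half_space_def
  by (intro exI[of _ "(v5 1 0 0 0 0)"] exI[of _ "(v5 0 0 0 1 0)"] exI[of _ "(v5 0 0 0 0 1)"], simp add: J5_mult_eq v5_eq_iff)+

text \<open>For a nontrivial idempotent, coordinate 4 determines an element of the 1/2-space, which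
  is therefore at most a line.\<close>

lemma not_half_space_plane_10_11:
  assumes k: "k \<in> {10, 11}"
  shows "\<not> half_space_plane (*s) (J5_mult k)"
proof
  assume "half_space_plane (*s) (J5_mult k)"
  then obtain g x y where idem: "J5_mult k g g = g"
      and x: "2 *s J5_mult k g x = x" "x \<noteq> 0" and y: "2 *s J5_mult k g y = y"
      and c: "\<And>c. y \<noteq> c *s x"
    unfolding half_space_plane_def half_space_def by blast
  have g: "g $ 0 = 1 \<and> g $ 1 = 0 \<or> g $ 0 = 0 \<and> g $ 1 = 1"
    using k idempotent_cases_6_11[OF _ idem] x by (elim insertE emptyE) (auto simp: J5_mult_eq v5_eq_iff)
  have "x $ 4 \<noteq> 0"
    using k g x by (elim insertE emptyE) (auto simp: J5_mult_eq v5_eq_iff)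
  moreover from this have "y = (y $ 4 / x $ 4) *s x"
    using k g x(1) y by (elim insertE emptyE disjE) (auto simp: J5_mult_eq v5_eq_iff field_simps, (thin_tac "k = 11", algebra)+)
  ultimately show False
    using c by blast
qed

lemma not_nil_nonzero_square_6: "\<not> nil_nonzero_square (J5_mult 6)"
  and not_nil_nonzero_square_10: "\<not> nil_nonzero_square (J5_mult 10)"
  by (auto simp: nil_nonzero_square_def cube_zero_J5_mult J5_mult_eq v5_eq_iff)

lemma nil_nonzero_square_7: "nil_nonzero_square (J5_mult 7)"
  and nil_nonzero_square_8: "nil_nonzero_square (J5_mult 8)"
  unfolding nil_nonzero_square_def
  by (intro exI[of _ "(v5 0 0 0 1 0)"], simp add: cube_zero_J5_mult J5_mult_eq v5_eq_iff)+

lemma nil_nonzero_square_9: "nil_nonzero_square (J5_mult 9)"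
  unfolding nil_nonzero_square_def half_space_def
  by (intro exI[of _ "(v5 0 0 1 1 0)"]) (simp add: cube_zero_J5_mult J5_mult_eq v5_eq_iff)

lemma nil_nonzero_square_11: "nil_nonzero_square (J5_mult 11)"
  unfolding nil_nonzero_square_def half_space_def
  by (intro exI[of _ "(v5 0 0 0 0 1)"]) (simp add: cube_zero_J5_mult J5_mult_eq v5_eq_iff)

text \<open>Squares of nilpotent elements are multiples of \<open>a\<close>, on which an idempotent
  acts by its coordinate 0; that is 0 or 1, never 1/2.\<close>

lemma not_nil_square_in_half_7: "\<not> nil_square_in_half (*s) (J5_mult 7)"
  by (auto simp: nil_square_in_half_def half_space_def cube_zero_J5_mult J5_mult_eq v5_eq_iff)

lemma not_nil_square_in_half_8: "\<not> nil_square_in_half (*s) (J5_mult 8)"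
  by (auto simp: nil_square_in_half_def half_space_def cube_zero_J5_mult J5_mult_eq v5_eq_iff)
    (simp_all add: add.commute)

text \<open>The witness is (a + b)^2 = 2 d, where \<open>d\<close> lies in the 1/2-space of
  \<open>e1\<close>.\<close>

lemma nil_square_in_half_9: "nil_square_in_half (*s) (J5_mult 9)"
  unfolding nil_square_in_half_def half_space_def
  by (intro exI[of _ "(v5 1 0 0 0 0)"] exI[of _ "(v5 0 0 1 1 0)"]) (simp add: cube_zero_J5_mult J5_mult_eq v5_eq_iff)

lemma has_isotropic_8: "has_isotropic (J5_mult 8)"
  unfolding has_isotropic_def half_space_def
  by (intro exI[of _ "(v5 0 0 0 1 (\<i>))"] exI[of _ "(v5 0 0 0 1 0)"]) (simp add: cube_zero_J5_mult J5_mult_eq v5_eq_iff)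

lemma decomposable_12: "decomposable (J5_mult 12)"
  and decomposable_14: "decomposable (J5_mult 14)"
  and decomposable_15: "decomposable (J5_mult 15)"
  and decomposable_16: "decomposable (J5_mult 16)"
  unfolding decomposable_def
  by (intro exI[of _ "(v5 1 0 0 0 0)"] conjI exI[of _ "(v5 0 1 0 0 0)"]; simp add: J5_mult_eq v5_eq_iff)+

lemma not_has_half_space_12: "\<not> has_half_space (*s) (J5_mult 12)"
proof -
  have "x = 0" if "J5_mult 12 g g = g"
    "2 *s J5_mult 12 g x = x" for g x
  proof -
    have "g $ 0 = 0 \<or> g $ 0 = 1" "g $ 1 = 0 \<or> g $ 1 = 1"
      using that(1) by (simp_all add: J5_mult_eq v5_eq_iff)
    then show ?thesis
      using that by (elim disjE) (auto simp: J5_mult_eq v5_eq_iff)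
  qed
  then show ?thesis
    unfolding has_half_space_def half_space_def by blast
qed

lemma not_decomposable_13: "\<not> decomposable (J5_mult 13)"
proof
  assume "decomposable (J5_mult 13)"
  then obtain x where idem: "J5_mult 13 x x = x" and nz: "x \<noteq> 0"
    and y: "\<exists>y. J5_mult 13 x y \<noteq> y"
    and c: "\<And>y. J5_mult 13 x (J5_mult 13 x y) = J5_mult 13 x y"
    unfolding decomposable_def by blast
  have x: "x $ 0 = 0 \<or> x $ 0 = 1" "x $ 1 = 0 \<or> x $ 1 = 1" "x $ 2 = 0 \<or> x $ 2 = 1"
    using idem by (simp_all add: J5_mult_eq v5_eq_iff)
  \<comment> \<open>On basis vector 3 the idempotent acts by the mean of its coordinates 0 and 1, on
    basis vector 4 by that of 0 and 2. A projection allows no mean 1/2.\<close>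
  have "x $ 1 = x $ 0"
    using c[of "(v5 0 0 0 1 0)"] x(1,2) by (elim disjE) (simp_all add: J5_mult_eq v5_eq_iff)
  moreover have "x $ 2 = x $ 0"
    using c[of "(v5 0 0 0 0 1)"] x(1,3) by (elim disjE) (simp_all add: J5_mult_eq v5_eq_iff)
  ultimately show False
    using x(1) idem nz y by (elim disjE) (auto simp: J5_mult_eq v5_eq_iff)
qed

lemma three_idempotents_13: "three_idempotents (J5_mult 13)"
  unfolding three_idempotents_def half_space_def
  by (intro exI[of _ "(v5 1 0 0 0 0)"] exI[of _ "(v5 0 1 0 0 0)"] exI[of _ "(v5 0 0 1 0 0)"]) (simp add: cube_zero_J5_mult J5_mult_eq v5_eq_iff)

text \<open>For w in W with w^2 = -1 the element (1 + i w) / 2 is idempotent, and every vector of W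
  orthogonal to w lies in its 1/2-space.\<close>

lemma has_half_space_14: "has_half_space (*s) (J5_mult 14)"
  and has_half_space_15: "has_half_space (*s) (J5_mult 15)"
  and has_half_space_16: "has_half_space (*s) (J5_mult 16)"
  unfolding has_half_space_def half_space_def
  by (intro exI[of _ "(v5 0 (1/2) (\<i>/2) 0 0)"] exI[of _ "(v5 0 0 0 0 1)"], simp add: J5_mult_eq v5_eq_iff)+

text \<open>The 1/2-space of any idempotent lies in the kernel of the form of rank one, where all
  products vanish.\<close>

lemma half_squares_zero_14: "half_squares_zero (*s) (J5_mult 14)"
proof -
  have *: "x $ 0 = 0 \<and> x $ 1 = 0 \<and> x $ 2 = 0" if "J5_mult 14 g g = g"
    "2 *s J5_mult 14 g x = x" for g x
  proof -
    have g: "g $ 0 * g $ 0 = g $ 0" "g $ 1 * g $ 1 - g $ 2 * g $ 2 = g $ 1" "2 * g $ 1 * g $ 2 = g $ 2"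
      and x: "2 * g $ 0 * x $ 0 = x $ 0" "2 * (g $ 1 * x $ 1 - g $ 2 * x $ 2) = x $ 1" "2 * (g $ 1 * x $ 2 + g $ 2 * x $ 1) = x $ 2"
      using that by (simp_all add: J5_mult_eq v5_eq_iff algebra_simps)
    have "x $ 0 = 0"
      using g(1) x(1) by auto
    moreover have "x $ 1 = 0 \<and> x $ 2 = 0"
    proof (cases "g $ 2 = 0")
      case True
      then have "g $ 1 = 0 \<or> g $ 1 = 1"
        using g(2) by auto
      then show ?thesis
        using True x by auto
    next
      case False
      then have g1: "g $ 1 = 1 / 2"
        using g(3) by (simp add: field_simps)
      have "g $ 2 * x $ 2 = 0" "g $ 2 * x $ 1 = 0"
        using x(2,3) by (simp_all add: g1 algebra_simps)
      then show ?thesis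
        using False by simp
    qed
    ultimately show ?thesis
      by simp
  qed
  have "J5_mult 14 x x = 0" if "J5_mult 14 g g = g"
    "2 *s J5_mult 14 g x = x" for g x
    using *[OF that] by (simp add: J5_mult_eq v5_eq_iff)
  then show ?thesis
    unfolding half_squares_zero_def half_space_def by blast
qed

lemma not_half_squares_zero_15: "\<not> half_squares_zero (*s) (J5_mult 15)"
  and not_half_squares_zero_16: "\<not> half_squares_zero (*s) (J5_mult 16)"
  unfolding half_squares_zero_def half_space_def
  by (rule notI, drule spec[of _ "(v5 0 (1/2) (\<i>/2) 0 0)"], drule spec[of _ "(v5 0 0 0 1 0)"], simp add: J5_mult_eq v5_eq_iff)+

lemma has_radical_vector_15: "has_radical_vector (J5_mult 15)"
  unfolding has_radical_vector_def half_space_def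
  by (intro exI[of _ "(v5 0 0 0 0 1)"]) (simp add: cube_zero_J5_mult J5_mult_eq v5_eq_iff)

lemma not_has_radical_vector_16: "\<not> has_radical_vector (J5_mult 16)"
proof -
  \<comment> \<open>The first condition leaves only a W-part of \<open>x\<close>. Its product with
    the i-th vector of W is minus its i-th coordinate times the unity of the second factor, whose
    square is zero only if the coordinate is.\<close>
  have "x = 0" if "J5_mult 16 x x = 0"
    "\<And>y. J5_mult 16 (J5_mult 16 x y) (J5_mult 16 x y) = 0" for x
    using that(1) that(2)[of "(v5 0 0 1 0 0)"] that(2)[of "(v5 0 0 0 1 0)"] that(2)[of "(v5 0 0 0 0 1)"]
    by (auto simp: J5_mult_eq v5_eq_iff)
  then show ?thesis
    unfolding has_radical_vector_def by blast
qed

lemma algebra_type_J5_mult: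
  assumes "k \<in> {1..16}"
  shows "algebra_type (*s) (J5_mult k) = k"
proof -
  note is_local = local_1_5
    and not_half_space_plane = not_half_space_plane_10_11[simplified]
    and not_decomposable = not_decomposable_6_11[simplified]
    and not_three_idempotents = not_three_idempotents_6_11[simplified]
  \<comment> \<open>Only selected rewrite rules are used here, since full simplification would turn
    the index 1 into \<open>Suc 0\<close> and the facts about algebra 1 would no longer
    match.\<close>
  have "algebra_type (*s) (J5_mult 1) = 1"
    by (simp only: algebra_type_def is_local[of 1] insertI1 has_isotropic_1 not_has_orthogonal_pair_1 if_True if_False)
  moreover have "algebra_type (*s) (J5_mult 2) = 2"
    by (simp add: algebra_type_def is_local not_has_isotropic_2 has_orthogonal_pair_2)
  moreover have "algebra_type (*s) (J5_mult 3) = 3"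
    by (simp add: algebra_type_def is_local not_has_isotropic_3 not_has_orthogonal_pair_3)
  moreover have "algebra_type (*s) (J5_mult 4) = 4"
    by (simp add: algebra_type_def is_local has_isotropic_4 has_orthogonal_pair_4 not_isotropic_orthogonal_4)
  moreover have "algebra_type (*s) (J5_mult 5) = 5"
    by (simp add: algebra_type_def is_local has_isotropic_5 has_orthogonal_pair_5 isotropic_orthogonal_5)
  moreover have "algebra_type (*s) (J5_mult 6) = 6"
    by (simp add: algebra_type_def not_local_6 not_decomposable not_three_idempotents
        half_space_plane_6 not_nil_nonzero_square_6)
  moreover have "algebra_type (*s) (J5_mult 7) = 7"
    by (simp add: algebra_type_def not_local_7 not_decomposable not_three_idempotents
        half_space_plane_7 nil_nonzero_square_7 not_nil_square_in_half_7 not_has_isotropic_7)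
  moreover have "algebra_type (*s) (J5_mult 8) = 8"
    by (simp add: algebra_type_def not_local_8 not_decomposable not_three_idempotents
        half_space_plane_8 nil_nonzero_square_8 not_nil_square_in_half_8 has_isotropic_8)
  moreover have "algebra_type (*s) (J5_mult 9) = 9"
    by (simp add: algebra_type_def not_local_9 not_decomposable not_three_idempotents
        half_space_plane_9 nil_nonzero_square_9 nil_square_in_half_9)
  moreover have "algebra_type (*s) (J5_mult 10) = 10"
    by (simp add: algebra_type_def not_local_10 not_decomposable not_three_idempotents
        not_half_space_plane not_nil_nonzero_square_10)
  moreover have "algebra_type (*s) (J5_mult 11) = 11"
    by (simp add: algebra_type_def not_local_11 not_decomposable not_three_idempotents
        not_half_space_plane nil_nonzero_square_11)
  moreover have "algebra_type (*s) (J5_mult 12) = 12"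
    by (simp add: algebra_type_def not_local_12 decomposable_12 not_has_half_space_12)
  moreover have "algebra_type (*s) (J5_mult 13) = 13"
    by (simp add: algebra_type_def not_local_13 not_decomposable_13 three_idempotents_13)
  moreover have "algebra_type (*s) (J5_mult 14) = 14"
    by (simp add: algebra_type_def not_local_14 decomposable_14 has_half_space_14 half_squares_zero_14)
  moreover have "algebra_type (*s) (J5_mult 15) = 15"
    by (simp add: algebra_type_def not_local_15 decomposable_15 has_half_space_15
        not_half_squares_zero_15 has_radical_vector_15)
  moreover have "algebra_type (*s) (J5_mult 16) = 16"
    by (simp add: algebra_type_def not_local_16 decomposable_16 has_half_space_16
        not_half_squares_zero_16 not_has_radical_vector_16)
  moreover have "k \<in> {1, 2, 3, 4, 5, 6, 7, 8, 9, 10, 11, 12, 13, 14, 15, 16}"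
    using assms unfolding atLeastAtMost_iff insert_iff empty_iff by presburger
  ultimately show ?thesis
    by blast
qed

lemma isomorphic_to_J5_unique:
  assumes "k \<in> {1..16}" "isomorphic_to_J5 sc m k" "l \<in> {1..16}" "isomorphic_to_J5 sc m l"
  shows "k = l"
  using assms by (metis isomorphic_to_J5_iff algebra_type_isomorphic algebra_type_J5_mult)

text \<open>Sending the i-th basis vector to \<open>u i\<close> gives a map from the table algebra
  to \<open>m\<close>. Independence makes it injective, and equality of dimensions makes it
  bijective.\<close>

lemma isomorphic_table_mult:
  fixes m :: "complex ^ 5 \<Rightarrow> complex ^ 5 \<Rightarrow> complex ^ 5" and u :: "5 \<Rightarrow> complex ^ 5"
  assumes add: "\<And>x y z. m (x + y) z = m x z + m y z" and scale: "\<And>c x y. m (c *s x) y = c *s m x y"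
    and comm: "\<And>x y. m x y = m y x"
    and indep: "\<And>c. (\<Sum>i\<in>UNIV. c i *s u i) = 0 \<Longrightarrow> c = (\<lambda>_. 0)"
    and products: "\<And>i j. m (u i) (u j) = (\<Sum>k\<in>UNIV. basis_product T i j $ k *s u k)"
  shows "algebra_isomorphic (*s) m (*s) (table_mult T)"
proof -
  define g where "g x = (\<Sum>i\<in>UNIV. x $ i *s u i)" for x :: "complex ^ 5"
  have g_add: "g (x + y) = g x + g y" and g_scale: "g (c *s x) = c *s g x" for x y c
    by (simp_all add: g_def vec.scale_left_distrib sum.distrib vec.scale_sum_right)
  have lin: "Vector_Spaces.linear (*s) (*s) g"
    by unfold_locales (simp_all add: g_add g_scale)
  interpret g: Vector_Spaces.linear "(*s)" "(*s)" g
    by (rule lin)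
  have "inj g"
  proof (subst g.inj_iff_eq_0, intro allI impI)
    fix x assume "g x = 0"
    then have "($) x = (\<lambda>_. 0)"
      by (intro indep) (simp add: g_def)
    then show "x = 0"
      by (simp add: vec_eq_iff)
  qed
  then have "bij g"
    using vec.linear_injective_imp_surjective[OF lin] by (simp add: bij_def)
  have m_sum_left: "m (\<Sum>i\<in>A. f i) y = (\<Sum>i\<in>A. m (f i) y)" if "finite A" for f :: "5 \<Rightarrow> _" and A y
    using that
  proof (induction A)
    case empty
    show ?case
      using scale[of 0 0 y] by simp
  qed (simp add: add)
  have m_sum_right: "m y (\<Sum>i\<in>A. f i) = (\<Sum>i\<in>A. m y (f i))" if "finite A" for f :: "5 \<Rightarrow> _" and A y
    using m_sum_left[OF that] by (simp add: comm[of y])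
  have scale_right: "m x (c *s y) = c *s m x y" for c x y
    using scale by (simp add: comm[of x])
  have "g (table_mult T x y) = m (g x) (g y)" for x y
  proof -
    have "m (g x) (g y) = (\<Sum>i\<in>UNIV. \<Sum>j\<in>UNIV. (x $ i * y $ j) *s m (u i) (u j))"
      by (simp add: g_def m_sum_left m_sum_right scale scale_right vec.scale_sum_right mult.commute,
          rule sum.swap)
    also have "\<dots> = g (table_mult T x y)"
      unfolding products table_mult_def g.sum g_scale by (simp add: g_def)
    finally show ?thesis ..
  qed
  then have "algebra_isomorphic (*s) (table_mult T) (*s) m"
    using lin \<open>bij g\<close> unfolding algebra_isomorphic_def by blast
  then show ?thesis
    by (rule algebra_isomorphic_sym)
qed

section \<open>Consequences of having rank three\<close>

lemma (in vector_space) independent_family: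
  fixes f :: "'i \<Rightarrow> 'b"
  assumes "finite I" and c: "\<And>c. (\<Sum>i\<in>I. scale (c i) (f i)) = 0 \<Longrightarrow> \<forall>i\<in>I. c i = 0"
  shows "inj_on f I" and "independent (f ` I)"
proof -
  show inj: "inj_on f I"
  proof (rule inj_onI, rule ccontr)
    \<comment> \<open>A repeated vector would give the relation with coefficients 1 at
      \<open>i\<close> and -1 at \<open>j\<close>.\<close>
    fix i j assume ij: "i \<in> I" "j \<in> I" "f i = f j" "i \<noteq> j"
    have "(\<Sum>k\<in>I. scale (if k = i then 1 else if k = j then -1 else 0) (f k)) =
        (\<Sum>k\<in>I. (if k = i then f i else 0) - (if k = j then f j else 0))"
      by (rule sum.cong) (use ij in auto)
    also have "\<dots> = 0"
      using ij \<open>finite I\<close> by (simp add: sum_subtractf)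
    finally show False
      using c[of "\<lambda>k. if k = i then 1 else if k = j then -1 else 0"] ij by auto
  qed
  show "independent (f ` I)"
  proof (rule independent_if_scalars_zero)
    fix h x assume "(\<Sum>x\<in>f ` I. scale (h x) x) = 0" "x \<in> f ` I"
    then show "h x = 0"
      using c[of "\<lambda>i. h (f i)"] by (auto simp: sum.reindex[OF inj])
  qed (use \<open>finite I\<close> in simp)
qed

section \<open>From a general element to every element\<close>

text \<open>One variable is enough: polynomial functions are only compared along the line joining a
  given element to a general one.\<close>

definition is_poly :: "(complex \<Rightarrow> complex) \<Rightarrow> bool" where
  "is_poly f \<longleftrightarrow> (\<exists>p. \<forall>t. f t = poly p t)"

lemma is_poly_const: "is_poly (\<lambda>_. c)"
  unfolding is_poly_def by (intro exI[of _ "[:c:]"]) simp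

lemma is_poly_ident: "is_poly (\<lambda>t. t)"
  unfolding is_poly_def by (intro exI[of _ "[:0, 1:]"]) simp

lemma is_poly_add: "is_poly f \<Longrightarrow> is_poly g \<Longrightarrow> is_poly (\<lambda>t. f t + g t)"
  unfolding is_poly_def by (metis poly_add)

lemma is_poly_mult: "is_poly f \<Longrightarrow> is_poly g \<Longrightarrow> is_poly (\<lambda>t. f t * g t)"
  unfolding is_poly_def by (metis poly_mult)

lemma is_poly_sum: "(\<And>i. i \<in> A \<Longrightarrow> is_poly (f i)) \<Longrightarrow> is_poly (\<lambda>t. \<Sum>i\<in>A. f i t)"
  by (induction A rule: infinite_finite_induct) (auto simp: is_poly_const is_poly_add)

lemma is_poly_prod: "(\<And>i. i \<in> A \<Longrightarrow> is_poly (f i)) \<Longrightarrow> is_poly (\<lambda>t. \<Prod>i\<in>A. f i t)"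
  by (induction A rule: infinite_finite_induct) (auto simp: is_poly_const is_poly_mult)

lemma is_poly_det: "(\<And>i j. is_poly (\<lambda>t. M t $ i $ j)) \<Longrightarrow> is_poly (\<lambda>t. det (M t))"
  unfolding det_def by (intro is_poly_sum is_poly_mult is_poly_prod is_poly_const)

text \<open>Polynomials in one variable form an integral domain, and over the complex numbers a
  polynomial is determined by its values.\<close>

lemma is_poly_zero_product:
  assumes "is_poly f" "is_poly g" "\<And>t. f t * g t = 0" "f a \<noteq> 0"
  shows "g t = 0"
proof -
  obtain p q where pq: "\<And>t. f t = poly p t" "\<And>t. g t = poly q t"
    using assms(1,2) unfolding is_poly_def by auto
  have "poly (p * q) = poly 0"
    using assms(3) by (auto simp: pq)
  then have "p * q = 0"
    by (simp only: poly_eq_poly_eq_iff)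
  moreover have "p \<noteq> 0"
    using assms(4) pq(1) by auto
  ultimately show ?thesis
    by (simp add: pq)
qed

lemma UNIV_4': "(UNIV :: 4 set) = {0, 1, 2, 3}"
proof -
  have "card {0, 1, 2, 3 :: 4} = CARD(4)"
    by simp
  then show ?thesis
    by (metis card_subset_eq finite subset_UNIV)
qed

context jordan_algebra
begin

lemma mul_add_right: "mul z (x + y) = mul z x + mul z y"
  by (metis mult_add_left mult_commute)

lemma mul_scale_right: "mul y (sc c x) = sc c (mul y x)"
  by (metis mult_scale_left mult_commute)

lemma is_poly_polynomial_fun:
  assumes "polynomial_fun sc p"
  shows "is_poly (\<lambda>t. p (x + sc t y))"
  using assms
proof induction
  case (linear f)
  interpret f: Vector_Spaces.linear sc "(*)" f by fact
  show ?case
    by (simp add: f.add f.scale is_poly_add is_poly_mult is_poly_const is_poly_ident)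
qed (auto intro: is_poly_add is_poly_mult is_poly_const)

text \<open>Coordinate-free form of "all coordinates are polynomials in the parameter".\<close>

definition poly_curve :: "(complex \<Rightarrow> 'a) \<Rightarrow> bool" where
  "poly_curve f \<longleftrightarrow> (\<forall>h. Vector_Spaces.linear sc (*) h \<longrightarrow> is_poly (\<lambda>t. h (f t)))"

lemma vector_space_complex: "vector_space ((*) :: complex \<Rightarrow> complex \<Rightarrow> complex)"
  by unfold_locales (simp_all add: algebra_simps)

lemma linear_functional_iff:
  "Vector_Spaces.linear sc (*) h \<longleftrightarrow> (\<forall>x y. h (x + y) = h x + h y) \<and> (\<forall>c x. h (sc c x) = c * h x)"
  using vector_space_axioms vector_space_complex by (auto simp: Vector_Spaces.linear_iff)

lemma poly_curve_const: "poly_curve (\<lambda>_. x)"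
  by (simp add: poly_curve_def is_poly_const)

lemma poly_curve_line:
  assumes "poly_curve f" "poly_curve g"
  shows "poly_curve (\<lambda>t. f t + sc t (g t))"
  using assms unfolding poly_curve_def linear_functional_iff
  by (auto intro!: is_poly_add is_poly_mult is_poly_ident)

lemma poly_curve_mul:
  assumes "poly_curve f"
  shows "poly_curve (\<lambda>t. mul x (f t))"
  unfolding poly_curve_def
proof (intro allI impI)
  fix h assume "Vector_Spaces.linear sc (*) h"
  then have "Vector_Spaces.linear sc (*) (\<lambda>y. h (mul x y))"
    unfolding linear_functional_iff by (simp add: mul_add_right mul_scale_right)
  then show "is_poly (\<lambda>t. h (mul x (f t)))"
    using assms[unfolded poly_curve_def, rule_format, of "\<lambda>y. h (mul x y)"] by simp
qed

text \<open>The powers 1, x, x^2, x^3, indexed by the type \<open>4\<close> so that they can be the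
  columns of a square matrix with a determinant.\<close>

definition power4 :: "'a \<Rightarrow> 4 \<Rightarrow> 'a" where
  "power4 x i = (if i = 0 then one else if i = 1 then x else if i = 2 then mul x x else mul x (mul x x))"

lemma poly_curve_power4: "poly_curve (\<lambda>t. power4 (x + sc t y) i)"
proof -
  have mul: "poly_curve (\<lambda>t. mul (x + sc t y) (f t))" if "poly_curve f" for f
    using that by (simp add: mult_add_left mult_scale_left poly_curve_line poly_curve_mul)
  have line: "poly_curve (\<lambda>t. x + sc t y)"
    by (intro poly_curve_line poly_curve_const)
  consider "i = 0" | "i \<noteq> 0" "i = 1" | "i \<noteq> 0" "i \<noteq> 1" "i = 2" | "i \<noteq> 0" "i \<noteq> 1" "i \<noteq> 2"
    by blast
  then show ?thesis
    by cases (simp_all only: power4_def if_True if_False simp_thms poly_curve_const mul line)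
qed

lemma rank_3_generic:
  assumes "has_rank 3"
  shows "\<exists>p x1. polynomial_fun sc p \<and> p x1 \<noteq> 0 \<and> (\<forall>x. p x \<noteq> 0 \<longrightarrow> dim (subalgebra hull {one, x}) = 3)"
  using assms unfolding has_rank_def for_general_def by blast

lemma subalgebra_hull: "subalgebra (subalgebra hull S)"
  by (rule hull_in) (auto simp: subalgebra_def subspace_Inter)

lemma finite_basis: "\<exists>B. finite B \<and> independent B \<and> span B = UNIV"
proof -
  obtain S where S: "finite S" "span S = UNIV"
    using finite_dim by blast
  obtain B where "B \<subseteq> S" "independent B" "S \<subseteq> span B"
    using maximal_independent_subset by blast
  then show ?thesis
    using S span_mono[of S "span B"] by (metis finite_subset span_span top.extremum_uniqueI)
qed

text \<open>All four powers lie in a subalgebra of dimension three.\<close>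

lemma power4_relation_generic:
  assumes "dim (subalgebra hull {one, x}) = 3"
  shows "\<exists>c. (\<Sum>i\<in>UNIV. sc (c i) (power4 x i)) = 0 \<and> c \<noteq> (\<lambda>_. 0)"
proof (rule ccontr)
  assume "\<not> ?thesis"
  then have c: "(\<Sum>i\<in>UNIV. sc (c i) (power4 x i)) = 0 \<Longrightarrow> \<forall>i\<in>UNIV. c i = 0" for c
    by (metis ext)
  let ?H = "subalgebra hull {one, x}"
  have H: "one \<in> ?H" "x \<in> ?H"
    using hull_subset[of "{one, x}" subalgebra] by auto
  have mul: "mul y z \<in> ?H" if "y \<in> ?H" "z \<in> ?H" for y z
    using subalgebra_hull that unfolding subalgebra_def by blast
  obtain B where B: "finite B" "independent B" "span B = UNIV"
    using finite_basis by blast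
  interpret fin: finite_dimensional_vector_space sc B
    using B by unfold_locales
  have "range (power4 x) \<subseteq> ?H"
    by (auto simp: power4_def H mul)
  moreover have "independent (range (power4 x))"
    by (rule independent_family[OF _ c]) simp
  ultimately have "card (range (power4 x)) \<le> dim ?H"
    by (rule fin.independent_card_le_dim)
  moreover have "card (range (power4 x)) = 4"
    using card_image[OF independent_family(1)[OF _ c]] by simp
  ultimately show False
    using assms by simp
qed

text \<open>If the powers of \<open>x\<close> were independent, a linear map \<open>g\<close> would
  send them to the standard basis of C^4. Along the line from \<open>x\<close> to a general element
  the determinant of the images of the powers is a polynomial. It vanishes wherever \<open>p\<close>
  does not, so its product with \<open>p\<close> is zero and it vanishes identically; but at
  \<open>x\<close> it is 1.\<close>

lemma power4_relation:
  assumes "has_rank 3"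
  shows "\<exists>c. (\<Sum>i\<in>UNIV. sc (c i) (power4 x i)) = 0 \<and> c \<noteq> (\<lambda>_. 0)"
proof (rule ccontr)
  assume "\<not> ?thesis"
  then have c: "(\<Sum>i\<in>UNIV. sc (c i) (power4 x i)) = 0 \<Longrightarrow> \<forall>i\<in>UNIV. c i = 0" for c
    by (metis ext)
  have inj: "inj (power4 x)" and ind: "independent (range (power4 x))"
    using independent_family[OF _ c] by auto
  interpret P: vector_space_pair sc "(*s) :: complex \<Rightarrow> complex ^ 4 \<Rightarrow> _"
    by unfold_locales
  obtain g where g: "Vector_Spaces.linear sc ((*s) :: complex \<Rightarrow> complex ^ 4 \<Rightarrow> _) g"
    and "\<forall>y\<in>range (power4 x). g y = axis (inv (power4 x) y) 1"
    using P.linear_independent_extend[OF ind, of "\<lambda>y. axis (inv (power4 x) y) 1"] by blast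
  then have g_power: "g (power4 x i) = axis i 1" for i
    using inj by simp
  interpret g: Vector_Spaces.linear sc "(*s) :: complex \<Rightarrow> complex ^ 4 \<Rightarrow> _" g
    by (rule g)
  obtain p x1 where p: "polynomial_fun sc p" "p x1 \<noteq> 0" "\<And>x. p x \<noteq> 0 \<Longrightarrow> dim (subalgebra hull {one, x}) = 3"
    using rank_3_generic[OF assms] by blast
  define z where "z t = x + sc t (x1 - x)" for t
  define M where "M t = (\<chi> i j. g (power4 (z t) j) $ i)" for t
  have "det (M t) = 0" if pz: "p (z t) \<noteq> 0" for t
  proof -
    obtain c where c: "(\<Sum>i\<in>UNIV. sc (c i) (power4 (z t) i)) = 0" "c \<noteq> (\<lambda>_. 0)"
      using power4_relation_generic[OF p(3)[OF pz]] by blast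
    have "M t *v (\<chi> i. c i) = g (\<Sum>i\<in>UNIV. sc (c i) (power4 (z t) i))"
      by (simp add: M_def matrix_vector_mult_def vec_eq_iff g.sum g.scale mult.commute)
    then have "M t *v (\<chi> i. c i) = 0"
      by (simp add: c(1) g.zero)
    moreover have "(\<chi> i. c i) \<noteq> 0"
      using c(2) by (auto simp: vec_eq_iff)
    ultimately show ?thesis
      using matrix_left_invertible_ker[of "M t"] by (metis invertible_det_nz invertible_def)
  qed
  then have "p (z t) * det (M t) = 0" for t
    by (cases "p (z t) = 0") auto
  moreover have "is_poly (\<lambda>t. p (z t))"
    unfolding z_def using is_poly_polynomial_fun[OF p(1)] .
  moreover have "is_poly (\<lambda>t. det (M t))"
  proof (rule is_poly_det)
    fix i j
    have "Vector_Spaces.linear sc (*) (\<lambda>y. g y $ i)"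
      by (simp add: linear_functional_iff g.add g.scale)
    then show "is_poly (\<lambda>t. M t $ i $ j)"
      using poly_curve_power4[of x "x1 - x" j, unfolded poly_curve_def, rule_format, of "\<lambda>y. g y $ i"]
      by (simp add: M_def z_def)
  qed
  moreover have "p (z 1) \<noteq> 0"
    using p(2) by (simp add: z_def)
  ultimately have "det (M 0) = 0"
    by - (rule is_poly_zero_product[of "\<lambda>t. p (z t)" "\<lambda>t. det (M t)" 1 0])
  moreover have "M 0 = mat 1"
    by (simp add: M_def z_def g_power vec_eq_iff mat_def axis_def)
  ultimately show False
    by simp
qed

lemma subspace_mul: "subspace {z. mul y z \<in> span S}"
proof (rule subspaceI)
  have "mul y 0 = 0"
    using mul_add_right[of y 0 0] by simp
  then show "0 \<in> {z. mul y z \<in> span S}"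
    by (simp add: span_zero)
qed (simp_all add: mul_add_right mul_scale_right span_add span_scale)

text \<open>A quadratic relation for a general \<open>x\<close> would make the span of 1 and
  \<open>x\<close> a subalgebra of dimension at most two.\<close>

lemma power3_independent:
  assumes "has_rank 3"
  shows "\<exists>x. \<forall>a b c. sc a one + sc b x + sc c (mul x x) = 0 \<longrightarrow> a = 0 \<and> b = 0 \<and> c = 0"
proof -
  obtain p x where "polynomial_fun sc p" and p: "p x \<noteq> 0"
      "\<And>x. p x \<noteq> 0 \<Longrightarrow> dim (subalgebra hull {one, x}) = 3"
    using rank_3_generic[OF assms] by blast
  have "a = 0 \<and> b = 0 \<and> c = 0" if abc: "sc a one + sc b x + sc c (mul x x) = 0" for a b c
  proof (rule ccontr)
    assume nz: "\<not> ?thesis"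
    let ?S = "span {one, x}"
    have one_x: "one \<in> ?S" "x \<in> ?S"
      by (simp_all add: span_base)
    have xx: "mul x x \<in> ?S"
    proof (cases "c = 0")
      case True
      show ?thesis
      proof (cases "b = 0")
        case True
        \<comment> \<open>Here \<open>a\<close> is the only nonzero coefficient; a zero unity makes
          every element zero.\<close>
        then have "one = 0"
          using nz abc \<open>c = 0\<close> by (simp add: scale_eq_0_iff)
        then have "mul x x = mul one x"
          using mult_one[of x] mult_one[of "mul x x"] mult_scale_left[of 0 0] by simp
        then show ?thesis
          using one_x by (simp add: mult_one)
      next
        case False
        have "sc b x = sc (- a) one"
          using abc \<open>c = 0\<close> by (simp add: eq_neg_iff_add_eq_0 add.commute)
        then have "sc b (mul x x) = sc (- a) x"
          by (metis mult_one mult_scale_left)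
        then have "mul x x = sc (- a / b) x"
          using False by (metis (no_types) scale_scale nonzero_mult_div_cancel_left scale_one divide_inverse mult.commute right_inverse)
        then show ?thesis
          using one_x(2) by (simp only: span_scale)
      qed
    next
      case False
      have "sc c (mul x x) \<in> ?S"
        using abc one_x by (metis add.commute add_eq_0_iff span_add span_neg span_scale)
      then show ?thesis
        using False span_scale[of "sc c (mul x x)" _ "inverse c"] by simp
    qed
    have x: "mul x z \<in> ?S" if "z \<in> ?S" for z
      using that by (rule span_induct[OF _ subspace_mul]) (use xx in \<open>auto simp: mult_one mult_commute[of x one] one_x\<close>)
    have "mul z y \<in> ?S" if "y \<in> ?S" "z \<in> ?S" for y z
      using that(1) by (rule span_induct[OF _ subspace_mul])
        (use that(2) x in \<open>auto simp: mult_one mult_commute[of z]\<close>)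
    then have "subalgebra ?S"
      by (simp add: subalgebra_def)
    then have "subalgebra hull {one, x} \<subseteq> ?S"
      by (intro hull_minimal) (auto simp: one_x)
    then have "dim (subalgebra hull {one, x}) \<le> card {one, x}"
      by (intro dim_le_card) auto
    also have "\<dots> \<le> 2"
      by (simp add: card_insert_if)
    finally show False
      using p by simp
  qed
  then show ?thesis
    by blast
qed

end

section \<open>Jordan algebras of rank three on the standard space\<close>

text \<open>The last two assumptions are all that is kept of rank three: no element has degree above
  three, and some element has degree above two.\<close>

locale rank3_algebra =
  fixes mult :: "complex ^ 5 \<Rightarrow> complex ^ 5 \<Rightarrow> complex ^ 5" (infixl "\<cdot>" 70)
    and one :: "complex ^ 5" ("\<one>")
  assumes add_left: "(x + y) \<cdot> z = x \<cdot> z + y \<cdot> z"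
    and scale_left: "(c *s x) \<cdot> y = c *s (x \<cdot> y)"
    and commute: "x \<cdot> y = y \<cdot> x"
    and one_left [simp]: "\<one> \<cdot> x = x"
    and jordan: "(x \<cdot> x) \<cdot> (x \<cdot> y) = x \<cdot> ((x \<cdot> x) \<cdot> y)"
    and relation: "\<exists>a b c d. a *s \<one> + b *s x + c *s (x \<cdot> x) + d *s (x \<cdot> (x \<cdot> x)) = 0 \<and>
                     \<not> (a = 0 \<and> b = 0 \<and> c = 0 \<and> d = 0)"
    and generic: "\<exists>x. \<forall>a b c. a *s \<one> + b *s x + c *s (x \<cdot> x) = 0 \<longrightarrow> a = 0 \<and> b = 0 \<and> c = 0"

text \<open>Coordinates with respect to a basis carry the product over to
  \<open>complex ^ 5\<close>.\<close>

lemma rank3_algebra_transport: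
  assumes "jordan_algebra sc mul one" and rank: "jordan_algebra.has_rank sc mul one 3"
    and dim: "vector_space.dim sc (UNIV :: 'a::ab_group_add set) = 5"
  obtains m e where "rank3_algebra m e" "algebra_isomorphic sc mul (*s) m"
proof -
  interpret jordan_algebra sc mul one by fact
  obtain B where B: "finite B" "independent B" "span B = UNIV"
    using finite_basis by blast
  interpret fin: finite_dimensional_vector_space sc B
    using B by unfold_locales
  have "card B = CARD(5)"
    using dim fin.dim_UNIV by simp
  then obtain h :: "5 \<Rightarrow> 'a" where h: "bij_betw h UNIV B"
    using B(1) finite_same_card_bij[of "UNIV :: 5 set" B] by auto
  define f where "f v = (\<Sum>i\<in>UNIV. sc (v $ i) (h i))" for v :: "complex ^ 5"
  interpret P: vector_space_pair "(*s) :: complex \<Rightarrow> complex ^ 5 \<Rightarrow> _" sc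
    by unfold_locales
  have lin: "Vector_Spaces.linear (*s) sc f"
    by unfold_locales (simp_all add: f_def scale_left_distrib sum.distrib scale_sum_right)
  interpret f: Vector_Spaces.linear "(*s)" sc f
    by (rule lin)
  have "inj f"
  proof (subst f.inj_iff_eq_0, intro allI impI)
    fix v assume "f v = 0"
    then have sum: "(\<Sum>b\<in>B. sc (v $ inv h b) b) = 0"
      using h by (simp add: f_def sum.reindex_bij_betw[OF h, symmetric] bij_betw_def)
    have "\<forall>b\<in>B. v $ inv h b = 0"
      using independentD[OF B(2,1) order_refl sum] by blast
    then show "v = 0"
      using h by (auto simp: vec_eq_iff bij_betw_def)
  qed
  moreover have "surj f"
  proof -
    have "y \<in> range f" for y
    proof -
      have "subspace (range f)"
        by (rule f.subspace_image[OF vec.subspace_UNIV])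
      moreover have "h i \<in> range f" for i
      proof -
        have "f (axis i 1) = (\<Sum>j\<in>UNIV. if j = i then h i else 0)"
          unfolding f_def by (rule sum.cong) (auto simp: axis_def)
        then have "f (axis i 1) = h i"
          by simp
        then show ?thesis
          by (metis rangeI)
      qed
      then have "B \<subseteq> range f"
        using h by (auto simp: bij_betw_def)
      ultimately show ?thesis
        using B(3) span_minimal by blast
    qed
    then show ?thesis
      by blast
  qed
  ultimately have "bij f"
    by (simp add: bij_def)
  define g where "g = inv f"
  have fg [simp]: "f (g y) = y" and gf [simp]: "g (f x) = x" for x y
    using \<open>bij f\<close> by (simp_all add: g_def bij_def surj_f_inv_f)
  define m where "m x y = g (mul (f x) (f y))" for x y
  have f_m: "f (m x y) = mul (f x) (f y)" for x y
    by (simp add: m_def)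
  have f_eq: "x = y \<longleftrightarrow> f x = f y" for x y
    using \<open>inj f\<close> by (simp add: inj_eq)
  have "rank3_algebra m (g one)"
  proof
    fix x y z c
    show "m (x + y) z = m x z + m y z"
      by (simp add: f_eq f_m f.add mult_add_left)
    show "m (c *s x) y = c *s m x y"
      by (simp add: f_eq f_m f.scale mult_scale_left)
    show "m x y = m y x"
      by (simp add: f_eq f_m mult_commute)
    show "m (g one) x = x"
      by (simp add: f_eq f_m mult_one)
    show "m (m x x) (m x y) = m x (m (m x x) y)"
      by (simp add: f_eq f_m jordan_identity)
    obtain c where c: "(\<Sum>i\<in>UNIV. sc (c i) (power4 (f x) i)) = 0" "c \<noteq> (\<lambda>_. 0)"
      using power4_relation[OF rank] by blast
    then obtain i where "c i \<noteq> 0"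
      by auto
    moreover have "i \<in> {0, 1, 2, 3}"
      using UNIV_4' by blast
    moreover have "f (c 0 *s g one + c 1 *s x + c 2 *s m x x + c 3 *s m x (m x x)) = f 0"
      using c(1) unfolding UNIV_4' by (simp add: f_m f.add f.scale f.zero power4_def add.assoc)
    then have "c 0 *s g one + c 1 *s x + c 2 *s m x x + c 3 *s m x (m x x) = 0"
      using f_eq by blast
    ultimately show "\<exists>a b c d. a *s g one + b *s x + c *s m x x + d *s m x (m x x) = 0 \<and>
        \<not> (a = 0 \<and> b = 0 \<and> c = 0 \<and> d = 0)"
      by (metis insertE singletonD)
  next
    obtain x where x: "\<And>a b c. sc a one + sc b x + sc c (mul x x) = 0 \<Longrightarrow> a = 0 \<and> b = 0 \<and> c = 0"
      using power3_independent[OF rank] by blast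
    have "a = 0 \<and> b = 0 \<and> c = 0" if "a *s g one + b *s g x + c *s m (g x) (g x) = 0" for a b c
      using that[THEN arg_cong, of f] by (intro x) (simp add: f_m f.add f.scale f.zero)
    then show "\<exists>x. \<forall>a b c. a *s g one + b *s x + c *s m x x = 0 \<longrightarrow> a = 0 \<and> b = 0 \<and> c = 0"
      by blast
  qed
  moreover have "algebra_isomorphic (*s) m sc mul"
    unfolding algebra_isomorphic_def using lin \<open>bij f\<close> f_m by blast
  ultimately show ?thesis
    using that algebra_isomorphic_sym by blast
qed

lemma all_tables_nth:
  "all_tables ! 0 = [
    ((0, 0), basis_vec 0), ((0, 1), basis_vec 1), ((0, 2), basis_vec 2), ((0, 3), basis_vec 3),
    ((0, 4), basis_vec 4), ((1, 1), basis_vec 3), ((1, 2), basis_vec 4)]"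
  "all_tables ! Suc 0 = [
    ((0, 0), basis_vec 0), ((0, 1), basis_vec 1), ((0, 2), basis_vec 2), ((0, 3), basis_vec 3),
    ((0, 4), basis_vec 4), ((1, 1), basis_vec 3), ((2, 2), basis_vec 3), ((1, 2), basis_vec 4)]"
  "all_tables ! 2 = [
    ((0, 0), basis_vec 0), ((0, 1), basis_vec 1), ((0, 2), basis_vec 2), ((0, 3), basis_vec 3),
    ((0, 4), basis_vec 4), ((1, 1), basis_vec 4)]"
  "all_tables ! 3 = [
    ((0, 0), basis_vec 0), ((0, 1), basis_vec 1), ((0, 2), basis_vec 2), ((0, 3), basis_vec 3),
    ((0, 4), basis_vec 4), ((1, 1), basis_vec 4), ((2, 2), basis_vec 4)]"
  "all_tables ! 4 = [
    ((0, 0), basis_vec 0), ((0, 1), basis_vec 1), ((0, 2), basis_vec 2), ((0, 3), basis_vec 3),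
    ((0, 4), basis_vec 4), ((1, 1), basis_vec 4), ((2, 2), basis_vec 4), ((3, 3), basis_vec 4)]"
  "all_tables ! 5 = [
    ((0, 0), basis_vec 0), ((1, 1), basis_vec 1), ((0, 2), basis_vec 2), ((0, 3), (1/2) *s basis_vec 3),
    ((1, 3), (1/2) *s basis_vec 3), ((0, 4), (1/2) *s basis_vec 4), ((1, 4), (1/2) *s basis_vec 4)]"
  "all_tables ! 6 = [
    ((0, 0), basis_vec 0), ((1, 1), basis_vec 1), ((0, 2), basis_vec 2), ((0, 3), (1/2) *s basis_vec 3),
    ((1, 3), (1/2) *s basis_vec 3), ((0, 4), (1/2) *s basis_vec 4), ((1, 4), (1/2) *s basis_vec 4), ((3, 3), basis_vec 2)]"
  "all_tables ! 7 = [
    ((0, 0), basis_vec 0), ((1, 1), basis_vec 1), ((0, 2), basis_vec 2), ((0, 3), (1/2) *s basis_vec 3),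
    ((1, 3), (1/2) *s basis_vec 3), ((0, 4), (1/2) *s basis_vec 4), ((1, 4), (1/2) *s basis_vec 4), ((3, 3), basis_vec 2),
    ((4, 4), basis_vec 2)]"
  "all_tables ! 8 = [
    ((0, 0), basis_vec 0), ((1, 1), basis_vec 1), ((0, 2), basis_vec 2), ((0, 3), (1/2) *s basis_vec 3),
    ((1, 3), (1/2) *s basis_vec 3), ((0, 4), (1/2) *s basis_vec 4), ((1, 4), (1/2) *s basis_vec 4), ((2, 3), basis_vec 4)]"
  "all_tables ! 9 = [
    ((0, 0), basis_vec 0), ((1, 1), basis_vec 1), ((0, 2), basis_vec 2), ((0, 3), basis_vec 3),
    ((0, 4), (1/2) *s basis_vec 4), ((1, 4), (1/2) *s basis_vec 4)]"
  "all_tables ! 10 = [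
    ((0, 0), basis_vec 0), ((1, 1), basis_vec 1), ((0, 2), basis_vec 2), ((0, 3), basis_vec 3),
    ((0, 4), (1/2) *s basis_vec 4), ((1, 4), (1/2) *s basis_vec 4), ((4, 4), basis_vec 2)]"
  "all_tables ! 11 = [
    ((0, 0), basis_vec 0), ((1, 1), basis_vec 1), ((0, 2), basis_vec 2), ((0, 3), basis_vec 3),
    ((0, 4), basis_vec 4)]"
  "all_tables ! 12 = [
    ((0, 0), basis_vec 0), ((1, 1), basis_vec 1), ((2, 2), basis_vec 2), ((0, 3), (1/2) *s basis_vec 3),
    ((1, 3), (1/2) *s basis_vec 3), ((0, 4), (1/2) *s basis_vec 4), ((2, 4), (1/2) *s basis_vec 4)]"
  "all_tables ! 13 = Jq_table 1"
  "all_tables ! 14 = Jq_table 2"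
  "all_tables ! 15 = Jq_table 3"
  by (simp_all add: table_defs Let_def)

section \<open>Linear identities, checked coordinate by coordinate\<close>

lemmas coords = vector_add_component vector_minus_component vector_uminus_component
  vector_smult_component zero_index

text \<open>Proves a linear consequence of vector equations: in each coordinate the known equation
  becomes a scalar hypothesis from which \<open>algebra\<close> derives the goal.\<close>

lemma vec_lin1:
  assumes "a = b" "\<And>i. a $ i = b $ i \<Longrightarrow> x $ i = y $ i"
  shows "x = (y :: 'b ^ 'n)"
  using assms by (simp add: vec_eq_iff)

lemma vec_lin2:
  assumes "a = b" "c = d" "\<And>i. a $ i = b $ i \<Longrightarrow> c $ i = d $ i \<Longrightarrow> x $ i = y $ i"
  shows "x = (y :: 'b ^ 'n)"
  using assms by (simp add: vec_eq_iff)

lemma vec_lin3: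
  assumes "a = b" "c = d" "e = f"
    "\<And>i. a $ i = b $ i \<Longrightarrow> c $ i = d $ i \<Longrightarrow> e $ i = f $ i \<Longrightarrow> x $ i = y $ i"
  shows "x = (y :: 'b ^ 'n)"
  using assms by (simp add: vec_eq_iff)

text \<open>The roots of t^2 = a + b t; the sign convention fits relations of the form x^2 = a + b
  x.\<close>

lemma complex_quadratic_roots:
  fixes a b :: complex
  obtains r s where "r + s = b" "r * s = - a"
proof
  show "(b + csqrt (b^2 + 4 * a)) / 2 + (b - csqrt (b^2 + 4 * a)) / 2 = b"
    by (simp add: field_simps)
  have "csqrt (b^2 + 4 * a) ^ 2 = b^2 + 4 * a"
    by simp
  then show "(b + csqrt (b^2 + 4 * a)) / 2 * ((b - csqrt (b^2 + 4 * a)) / 2) = - a"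
    by (simp add: field_simps) algebra
qed

context rank3_algebra
begin

lemma add_right: "z \<cdot> (x + y) = z \<cdot> x + z \<cdot> y"
  by (metis add_left commute)

lemma scale_right: "y \<cdot> (c *s x) = c *s (y \<cdot> x)"
  by (metis scale_left commute)

lemma one_right [simp]: "x \<cdot> \<one> = x"
  by (metis one_left commute)

lemma zero_left [simp]: "0 \<cdot> x = 0"
  using add_left[of 0 0 x] by simp

lemma zero_right [simp]: "x \<cdot> 0 = 0"
  using add_right[of x 0 0] by simp

lemma minus_left: "(- x) \<cdot> y = - (x \<cdot> y)"
  using scale_left[of "-1" x y] by simp

lemma minus_right: "y \<cdot> (- x) = - (y \<cdot> x)"
  using scale_right[of y "-1" x] by simp

lemma diff_left: "(x - y) \<cdot> z = x \<cdot> z - y \<cdot> z"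
  using add_left[of x "- y" z] by (simp add: minus_left)

lemma diff_right: "z \<cdot> (x - y) = z \<cdot> x - z \<cdot> y"
  using add_right[of z x "- y"] by (simp add: minus_right)

lemmas bilinear = add_left add_right scale_left scale_right minus_left minus_right diff_left diff_right

lemma jordan_linearized:
  "(x \<cdot> z) \<cdot> (w \<cdot> y) + (z \<cdot> w) \<cdot> (x \<cdot> y) + (w \<cdot> x) \<cdot> (z \<cdot> y) =
   w \<cdot> ((x \<cdot> z) \<cdot> y) + x \<cdot> ((z \<cdot> w) \<cdot> y) + z \<cdot> ((w \<cdot> x) \<cdot> y)"
proof -
  define F where "F x = (x \<cdot> x) \<cdot> (x \<cdot> y) - x \<cdot> ((x \<cdot> x) \<cdot> y)" for x
  have F: "F v = 0" for v
    using jordan[of v y] by (simp add: F_def)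
  define D where "D = (x \<cdot> z) \<cdot> (w \<cdot> y) + (z \<cdot> w) \<cdot> (x \<cdot> y) + (w \<cdot> x) \<cdot> (z \<cdot> y)
     - (w \<cdot> ((x \<cdot> z) \<cdot> y) + x \<cdot> ((z \<cdot> w) \<cdot> y) + z \<cdot> ((w \<cdot> x) \<cdot> y))"
  \<comment> \<open>The third difference of the cubic map \<open>F\<close>. Summing over the six
    orders of the arguments yields each of the three terms twice.\<close>
  have "2 *s D = F (x + z + w) - F (x + z) - F (z + w) - F (w + x) + F x + F z + F w"
    unfolding F_def D_def bilinear commute[of z x] commute[of w z] commute[of x w]
    by (simp only: vec_eq_iff coords) algebra
  then have "D = 0"
    by (simp add: F)
  then show ?thesis
    by (simp add: D_def)
qed

lemma jordan_linearized_square: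
  "(x \<cdot> x) \<cdot> (w \<cdot> y) + 2 *s ((x \<cdot> w) \<cdot> (x \<cdot> y)) = w \<cdot> ((x \<cdot> x) \<cdot> y) + 2 *s (x \<cdot> ((x \<cdot> w) \<cdot> y))"
  by (rule vec_lin1[OF jordan_linearized[of x x w y]])
    (simp only: commute[of w x] coords, algebra)

section \<open>Peirce decomposition of one idempotent\<close>

definition idempotent :: "complex ^ 5 \<Rightarrow> bool" where
  "idempotent c \<longleftrightarrow> c \<cdot> c = c"

text \<open>With L the multiplication by \<open>c\<close> this is L (2 L - 1) (L - 1) = 0, the
  instance of the linearized identity in which two of the three arguments are
  \<open>c\<close>.\<close>

lemma peirce_eigen:
  assumes "idempotent c"
  shows "c \<cdot> (c \<cdot> (2 *s (c \<cdot> x) - 3 *s x) + x) = 0"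
  by (rule vec_lin1[OF jordan_linearized_square[of c x c,
        unfolded assms[unfolded idempotent_def] commute[of x c] commute[of "c \<cdot> x" c]]])
    (simp only: bilinear coords, algebra)

text \<open>The projections are the Lagrange polynomials L (2 L - 1), 4 L (1 - L) and (1 - L) (1 - 2
  L). They are exported because operators that preserve eigenspaces are later applied to these
  polynomials.\<close>

lemma peirce_decomposition:
  assumes "idempotent c"
  obtains x1 xh x0 where "x = x1 + xh + x0" "c \<cdot> x1 = x1" "c \<cdot> xh = (1/2) *s xh" "c \<cdot> x0 = 0"
    "x1 = 2 *s (c \<cdot> (c \<cdot> x)) - c \<cdot> x" "xh = 4 *s (c \<cdot> x) - 4 *s (c \<cdot> (c \<cdot> x))"
    "x0 = x - 3 *s (c \<cdot> x) + 2 *s (c \<cdot> (c \<cdot> x))"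
proof
  show "x = (2 *s (c \<cdot> (c \<cdot> x)) - c \<cdot> x) + (4 *s (c \<cdot> x) - 4 *s (c \<cdot> (c \<cdot> x))) +
      (x - 3 *s (c \<cdot> x) + 2 *s (c \<cdot> (c \<cdot> x)))"
    by (simp add: vec_eq_iff algebra_simps)
  note c = peirce_eigen[OF assms, of x, unfolded bilinear]
  show "c \<cdot> (2 *s (c \<cdot> (c \<cdot> x)) - c \<cdot> x) = 2 *s (c \<cdot> (c \<cdot> x)) - c \<cdot> x"
    by (rule vec_lin1[OF c]) (simp only: bilinear coords, algebra)
  show "c \<cdot> (4 *s (c \<cdot> x) - 4 *s (c \<cdot> (c \<cdot> x))) = (1/2) *s (4 *s (c \<cdot> x) - 4 *s (c \<cdot> (c \<cdot> x)))"
    by (rule vec_lin1[OF c]) (simp add: bilinear, algebra)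
  show "c \<cdot> (x - 3 *s (c \<cdot> x) + 2 *s (c \<cdot> (c \<cdot> x))) = 0"
    by (rule vec_lin1[OF c]) (simp only: bilinear coords, algebra)
qed (rule refl)+

text \<open>The linearized identity at \<open>c\<close>, \<open>a\<close>, \<open>b\<close> gives
  the equation multiplied by 1 - 2 \<alpha>. For eigenvalues 0 and 1 it says that multiplication by
  \<open>a\<close> preserves every Peirce space of \<open>c\<close>.\<close>

lemma peirce_product:
  assumes "idempotent c" "c \<cdot> a = \<alpha> *s a" "\<alpha> \<noteq> 1/2" "c \<cdot> b = \<beta> *s b"
  shows "c \<cdot> (a \<cdot> b) = \<beta> *s (a \<cdot> b)"
proof -
  have *: "(1 - 2 * \<alpha>) *s (c \<cdot> (a \<cdot> b)) = (1 - 2 * \<alpha>) *s (\<beta> *s (a \<cdot> b))"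
    by (rule vec_lin1[OF jordan_linearized_square[of c a b]])
      (simp only: assms(2,4) assms(1)[unfolded idempotent_def] bilinear coords, algebra)
  have "1 - 2 * \<alpha> \<noteq> 0"
    using assms(3) by (auto simp: field_simps)
  then show ?thesis
    using * by (metis vec.scale_left_imp_eq vector_mul_lcancel)
qed

text \<open>The product has eigenvalue 0 and eigenvalue 1 at once.\<close>

lemma peirce_product_zero:
  assumes "idempotent c" "c \<cdot> a = a" "c \<cdot> b = 0"
  shows "a \<cdot> b = 0"
  using peirce_product[OF assms(1), of a 1 b 0] peirce_product[OF assms(1), of b 0 a 1] assms
  by (simp add: commute[of b a])

text \<open>Says that a product of two elements of the 1/2-space has no component in the
  1/2-space.\<close>

lemma peirce_product_half:
  assumes "idempotent c" "c \<cdot> a = (1/2) *s a" "c \<cdot> b = (1/2) *s b"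
  shows "c \<cdot> (c \<cdot> (a \<cdot> b)) = c \<cdot> (a \<cdot> b)"
  by (rule vec_lin1[OF jordan_linearized[of a b c c]])
    (simp only: assms(2,3) commute[of a c] commute[of b c] commute[of "a \<cdot> b" c]
      assms(1)[unfolded idempotent_def] bilinear coords commute[of b a], algebra)

text \<open>On the 1/2-space, twice the multiplication by \<open>x\<close> depends on
  \<open>x\<close> compatibly with squares. In particular \<open>x\<close> acts with square zero if
  x^2 = 0.\<close>

lemma peirce_square_act:
  assumes "idempotent c" "c \<cdot> x = \<alpha> *s x" "\<alpha> = 0 \<or> \<alpha> = 1" "c \<cdot> u = (1/2) *s u"
  shows "x \<cdot> (x \<cdot> u) = (1/2) *s ((x \<cdot> x) \<cdot> u)"
proof -
  have xu: "c \<cdot> (x \<cdot> u) = (1/2) *s (x \<cdot> u)"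
    by (rule peirce_product[OF assms(1,2) _ assms(4)]) (use assms(3) in auto)
  have xx: "c \<cdot> (x \<cdot> x) = \<alpha> *s (x \<cdot> x)"
    by (rule peirce_product[OF assms(1,2) _ assms(2)]) (use assms(3) in auto)
  have "(x \<cdot> x) \<cdot> (u \<cdot> c) + 2 *s ((x \<cdot> u) \<cdot> (x \<cdot> c)) = u \<cdot> ((x \<cdot> x) \<cdot> c) + 2 *s (x \<cdot> ((x \<cdot> u) \<cdot> c))"
    by (rule jordan_linearized_square)
  then have "(1/2) *s ((x \<cdot> x) \<cdot> u) + (2 * \<alpha>) *s (x \<cdot> (x \<cdot> u)) = \<alpha> *s ((x \<cdot> x) \<cdot> u) + x \<cdot> (x \<cdot> u)"
    using assms(2,4) xu xx by (simp add: bilinear commute[of _ c] commute[of "x \<cdot> u" x] commute[of u "x \<cdot> x"])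
  then have *: "(1/2) *s ((x \<cdot> x) \<cdot> u) + (2 * \<alpha> - 1) *s (x \<cdot> (x \<cdot> u)) = \<alpha> *s ((x \<cdot> x) \<cdot> u)"
    by (rule vec_lin1) (simp only: coords, algebra)
  show ?thesis
    using assms(3)
  proof
    assume "\<alpha> = 0"
    show ?thesis
      by (rule vec_lin1[OF *[unfolded \<open>\<alpha> = 0\<close>]]) (simp only: coords, algebra)
  next
    assume "\<alpha> = 1"
    show ?thesis
      by (rule vec_lin1[OF *[unfolded \<open>\<alpha> = 1\<close>]]) (simp only: coords, algebra)
  qed
qed


section \<open>Bounds on Peirce spaces from the cubic relation\<close>

text \<open>Adding \<open>t\<close> times the complementary idempotent to \<open>x\<close> adds the
  eigenvalue \<open>t\<close>. If \<open>x\<close> had degree three inside the Peirce space, its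
  unique monic cubic would have every \<open>t\<close> as a root.\<close>

lemma quadratic_in_peirce_one:
  assumes c: "idempotent c" "c \<noteq> \<one>" and x: "c \<cdot> x = x"
  shows "\<exists>a b. x \<cdot> x = a *s c + b *s x"
proof (rule ccontr)
  assume no: "\<not> ?thesis"
  define f where "f = \<one> - c"
  have cc: "c \<cdot> c = c"
    using c by (simp add: idempotent_def)
  have f: "f \<cdot> f = f" "c \<cdot> f = 0" "f \<noteq> 0"
    using c cc by (simp_all add: f_def bilinear)
  have xx: "c \<cdot> (x \<cdot> x) = x \<cdot> x" and xxx: "c \<cdot> (x \<cdot> (x \<cdot> x)) = x \<cdot> (x \<cdot> x)"
    using peirce_product[OF c(1), of x 1 _ 1] x by simp_all
  have xf: "x \<cdot> f = 0" "(x \<cdot> x) \<cdot> f = 0"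
    using peirce_product_zero[OF c(1) x f(2)] peirce_product_zero[OF c(1) xx f(2)] by auto
  have indep: "a = 0 \<and> b = 0 \<and> g = 0" if eq: "a *s c + b *s x + g *s (x \<cdot> x) = 0" for a b g
  proof -
    have "g = 0"
    proof (rule ccontr)
      assume "g \<noteq> 0"
      then have "x \<cdot> x = (- a / g) *s c + (- b / g) *s x"
        by (intro vec_lin1[OF eq]) (simp add: field_simps, algebra)
      then show False
        using no by blast
    qed
    moreover have "b = 0"
    proof (rule ccontr)
      assume "b \<noteq> 0"
      have "b *s x = (- a) *s c"
        by (rule vec_lin1[OF eq]) (simp only: \<open>g = 0\<close> coords, algebra)
      then have "(1 / b) *s (b *s x) = (1 / b) *s ((- a) *s c)"
        by (rule arg_cong)
      then have xc: "x = (- a / b) *s c"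
        using \<open>b \<noteq> 0\<close> by simp
      have "x \<cdot> x = (- a / b) *s (c \<cdot> x)"
        using xc scale_left by metis
      then have "x \<cdot> x = 0 *s c + (- a / b) *s x"
        by (simp add: x)
      then show False
        using no by blast
    qed
    moreover have "c \<noteq> 0"
      using x no by (metis zero_left vec.scale_zero_right add.right_neutral)
    ultimately show ?thesis
      using eq by simp
  qed
  have cubic: "\<exists>a b g. a *s c + b *s x + g *s (x \<cdot> x) + x \<cdot> (x \<cdot> x) = 0 \<and> a + b * t + g * t^2 + t^3 = 0" for t
  proof -
    define z where "z = x + t *s f"
    have z2: "z \<cdot> z = x \<cdot> x + t^2 *s f"
      unfolding z_def by (simp add: bilinear xf f commute[of f x] power2_eq_square)
    have z3: "z \<cdot> (z \<cdot> z) = x \<cdot> (x \<cdot> x) + t^3 *s f"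
      unfolding z2 unfolding z_def
      by (simp add: bilinear xf f commute[of f x] commute[of f "x \<cdot> x"] power2_eq_square power3_eq_cube)
    obtain a b g d where rel: "a *s \<one> + b *s z + g *s (z \<cdot> z) + d *s (z \<cdot> (z \<cdot> z)) = 0"
      and nz: "\<not> (a = 0 \<and> b = 0 \<and> g = 0 \<and> d = 0)"
      using relation[of z] by blast
    have rel': "a *s (c + f) + b *s (x + t *s f) + g *s (x \<cdot> x + t^2 *s f) + d *s (x \<cdot> (x \<cdot> x) + t^3 *s f) = 0"
      using rel unfolding z3 unfolding z2 unfolding z_def f_def by (simp add: algebra_simps)
    have "c \<cdot> (a *s (c + f) + b *s (x + t *s f) + g *s (x \<cdot> x + t^2 *s f) + d *s (x \<cdot> (x \<cdot> x) + t^3 *s f)) = 0"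
      unfolding rel' by simp
    then have cx: "a *s c + b *s x + g *s (x \<cdot> x) + d *s (x \<cdot> (x \<cdot> x)) = 0"
      by (simp add: bilinear cc f x xx xxx)
    have "(a + b * t + g * t^2 + d * t^3) *s f = 0"
      by (rule vec_lin2[OF rel' cx]) (simp only: coords, algebra)
    then have ft: "a + b * t + g * t^2 + d * t^3 = 0"
      using f(3) by (metis vector_mul_eq_0)
    have "d \<noteq> 0"
      using nz indep[of a b g] cx by auto
    then have "(a / d) *s c + (b / d) *s x + (g / d) *s (x \<cdot> x) + x \<cdot> (x \<cdot> x) = 0"
      by (intro vec_lin1[OF cx]) (simp add: field_simps)
    moreover have "a / d + b / d * t + g / d * t^2 + t^3 = 0"
    proof -
      have "a / d + b / d * t + g / d * t^2 + t^3 = (a + b * t + g * t^2 + d * t^3) / d"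
        using \<open>d \<noteq> 0\<close> by (simp add: add_divide_distrib)
      then show ?thesis
        by (simp add: ft)
    qed
    ultimately show ?thesis
      by blast
  qed
  obtain a b g where abg: "a *s c + b *s x + g *s (x \<cdot> x) + x \<cdot> (x \<cdot> x) = 0"
    using cubic[of 0] by blast
  have roots: "a + b * t + g * t^2 + t^3 = 0" for t
  proof -
    obtain a' b' g' where *: "a' *s c + b' *s x + g' *s (x \<cdot> x) + x \<cdot> (x \<cdot> x) = 0"
      "a' + b' * t + g' * t^2 + t^3 = 0"
      using cubic[of t] by blast
    have "(a' - a) *s c + (b' - b) *s x + (g' - g) *s (x \<cdot> x) = 0"
      by (rule vec_lin2[OF abg *(1)]) (simp only: coords, algebra)
    then show ?thesis
      using indep[of "a' - a" "b' - b" "g' - g"] *(2) by simp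
  qed
  \<comment> \<open>The third difference of a monic cubic is 6, here at the points -1, 0, 1,
    2.\<close>
  have "6 = (a + b * 2 + g * 2^2 + 2^3) - 3 * (a + b * 1 + g * 1^2 + 1^3)
      + 3 * (a + b * 0 + g * 0^2 + 0^3) - (a + b * (-1) + g * (-1)^2 + (-1)^3)"
    by (simp add: algebra_simps)
  then have "(6 :: complex) = 0"
    unfolding roots by simp
  then show False
    by simp
qed


definition idempotent_triple :: "complex ^ 5 \<Rightarrow> complex ^ 5 \<Rightarrow> complex ^ 5 \<Rightarrow> bool" where
  "idempotent_triple e1 e2 e3 \<longleftrightarrow> idempotent e1 \<and> idempotent e2 \<and> idempotent e3 \<and>
     e1 \<noteq> 0 \<and> e2 \<noteq> 0 \<and> e3 \<noteq> 0 \<and> e1 \<cdot> e2 = 0 \<and> e1 \<cdot> e3 = 0 \<and> e2 \<cdot> e3 = 0 \<and> e1 + e2 + e3 = \<one>"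

text \<open>With \<open>r\<close>, \<open>s\<close> the roots of the quadratic, a double root gives
  square zero, while distinct roots make (x - r c) / (s - r) idempotent. This is trivial only if
  \<open>x\<close> is \<open>r\<close> or \<open>s\<close> times \<open>c\<close>, and then x - l c
  can be made zero.\<close>

lemma quadratic_split:
  assumes c: "idempotent c" and x: "c \<cdot> x = x" and ab: "x \<cdot> x = a *s c + b *s x"
  shows "(\<exists>l. (x - l *s c) \<cdot> (x - l *s c) = 0) \<or>
    (\<exists>g. idempotent g \<and> c \<cdot> g = g \<and> g \<noteq> 0 \<and> g \<noteq> c)"
proof -
  have cc: "c \<cdot> c = c"
    using c by (simp add: idempotent_def)
  have xc: "x \<cdot> c = x"
    using x by (simp add: commute)
  obtain r s where rs: "r + s = b" "r * s = - a"
    using complex_quadratic_roots .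
  have r: "(x - r *s c) \<cdot> (x - r *s c) = (s - r) *s (x - r *s c)"
    by (rule vec_lin1[OF ab]) (simp only: bilinear x xc cc coords, use rs in algebra)
  show ?thesis
  proof (cases "r = s \<or> x = r *s c \<or> x = s *s c")
    case True
    then have "(x - r *s c) \<cdot> (x - r *s c) = 0 \<or> (x - s *s c) \<cdot> (x - s *s c) = 0"
      using r by auto
    then show ?thesis
      by blast
  next
    case False
    define g where "g = (1 / (s - r)) *s (x - r *s c)"
    have "1 / (s - r) * (1 / (s - r) * (s - r)) = 1 / (s - r)"
      using False by simp
    then have "g \<cdot> g = g"
      unfolding g_def scale_left scale_right r vector_smult_assoc by simp
    moreover have "c \<cdot> g = g"
      by (simp add: g_def bilinear x cc)
    moreover have "g \<noteq> 0"
      using False unfolding g_def vector_mul_eq_0 by auto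
    moreover have "g \<noteq> c"
    proof
      assume "g = c"
      have "(s - r) * (1 / (s - r)) = 1"
        using False by auto
      then have "(s - r) *s g = x - r *s c"
        unfolding g_def vector_smult_assoc by simp
      then have "x = s *s c"
        unfolding \<open>g = c\<close>
        by (rule vec_lin1) (simp only: coords, algebra)
      then show False
        using False by simp
    qed
    ultimately show ?thesis
      by (auto simp: idempotent_def)
  qed
qed

lemma peirce_one_split:
  assumes c: "idempotent c" "c \<noteq> \<one>" and x: "c \<cdot> x = x"
  shows "(\<exists>l. (x - l *s c) \<cdot> (x - l *s c) = 0) \<or>
    (\<exists>g. idempotent g \<and> c \<cdot> g = g \<and> g \<noteq> 0 \<and> g \<noteq> c)"
  using quadratic_in_peirce_one[OF assms] quadratic_split[OF c(1) x] by blast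

lemma idempotent_triple_if_splits:
  assumes c: "idempotent c" "c \<noteq> \<one>" and g: "idempotent g" "c \<cdot> g = g" "g \<noteq> 0" "g \<noteq> c"
  shows "idempotent_triple g (c - g) (\<one> - c)"
  using assms by (simp add: idempotent_triple_def idempotent_def bilinear commute[of g c])

lemma idempotent_triple_perm:
  assumes "idempotent_triple e1 e2 e3"
  shows "idempotent_triple e2 e1 e3" "idempotent_triple e1 e3 e2"
  using assms by (simp_all add: idempotent_triple_def commute[of e2 e1] commute[of e3 e2] ac_simps)

text \<open>A larger space would contain a nilpotent element or split \<open>e1\<close> further; in
  both cases an element of degree four arises.\<close>

lemma idempotent_triple_peirce_one:
  assumes e: "idempotent_triple e1 e2 e3" and x: "e1 \<cdot> x = x"
  shows "\<exists>l. x = l *s e1"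
proof -
  have idem: "e1 \<cdot> e1 = e1" "e2 \<cdot> e2 = e2" "e3 \<cdot> e3 = e3" and nz: "e1 \<noteq> 0" "e2 \<noteq> 0" "e3 \<noteq> 0"
    and orth: "e1 \<cdot> e2 = 0" "e1 \<cdot> e3 = 0" "e2 \<cdot> e3 = 0" and one: "e1 + e2 + e3 = \<one>" and e1: "idempotent e1"
    using e by (auto simp: idempotent_triple_def idempotent_def)
  have orth': "e2 \<cdot> e1 = 0" "e3 \<cdot> e1 = 0" "e3 \<cdot> e2 = 0"
    using orth by (simp_all add: commute)
  have "e1 \<noteq> \<one>"
    using nz(2) orth(1) by auto
  then consider l where "(x - l *s e1) \<cdot> (x - l *s e1) = 0"
    | g where "idempotent g" "e1 \<cdot> g = g" "g \<noteq> 0" "g \<noteq> e1"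
    using peirce_one_split[OF e1 _ x] by blast
  then show ?thesis
  proof cases
    case 1
    define n where "n = x - l *s e1"
    have n: "n \<cdot> n = 0" "e1 \<cdot> n = n"
      using 1 by (simp_all add: n_def bilinear x idem)
    have ne: "n \<cdot> e1 = n" "n \<cdot> e2 = 0" "n \<cdot> e3 = 0" "e2 \<cdot> n = 0" "e3 \<cdot> n = 0"
      using n(2) peirce_product_zero[OF e1 n(2)] orth by (simp_all add: commute)
    have "n = 0"
    proof (rule ccontr)
      assume "n \<noteq> 0"
      \<comment> \<open>Its minimal polynomial is t^2 (t - 1) (t + 1), so its powers up to the third
        are independent.\<close>
      define z where "z = n + e2 - e3"
      have z: "z \<cdot> z = e2 + e3" "z \<cdot> (z \<cdot> z) = e2 - e3"
        by (simp_all add: z_def bilinear n ne idem orth orth')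
      obtain a b g d where rel: "a *s \<one> + b *s z + g *s (z \<cdot> z) + d *s (z \<cdot> (z \<cdot> z)) = 0"
        and nontriv: "\<not> (a = 0 \<and> b = 0 \<and> g = 0 \<and> d = 0)"
        using relation[of z] by blast
      have act: "y \<cdot> (a *s (e1 + e2 + e3) + b *s (n + e2 - e3) + g *s (e2 + e3) + d *s (e2 - e3)) = 0" for y
        using rel unfolding z(2) unfolding z(1) unfolding z_def one by simp
      have "a *s n = 0"
        using act[of n] by (simp add: bilinear n ne)
      then have "a = 0"
        using \<open>n \<noteq> 0\<close> by simp
      moreover have "b = 0"
        using act[of e1] \<open>n \<noteq> 0\<close> by (simp add: bilinear \<open>a = 0\<close> n ne idem orth orth')
      moreover have "(g + d) *s e2 = 0" "(g - d) *s e3 = 0"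
        using act[of e2] act[of e3] \<open>a = 0\<close> \<open>b = 0\<close>
        by (simp_all add: bilinear n ne idem orth orth' vec.scale_left_distrib vec.scale_left_diff_distrib)
      then have "g + d = 0" "g - d = 0"
        using nz by (metis vector_mul_eq_0)+
      then have "g = 0" "d = 0"
        by algebra+
      ultimately show False
        using nontriv by simp
    qed
    then show ?thesis
      by (auto simp: n_def)
  next
    case 2
    define h where "h = e1 - g"
    \<comment> \<open>It has the four distinct eigenvalues 2, 0, 1, -1 on \<open>g\<close>,
      \<open>h\<close>, \<open>e2\<close>, \<open>e3\<close>.\<close>
    define z where "z = 2 *s g + e2 - e3"
    have gg: "g \<cdot> g = g" and hnz: "h \<noteq> 0" and e1gh: "e1 = g + h"
      using 2 by (simp_all add: idempotent_def h_def)
    have gh: "g \<cdot> h = 0" "h \<cdot> g = 0" "h \<cdot> h = h" "e1 \<cdot> h = h"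
      using 2(2) by (simp_all add: h_def bilinear gg idem commute[of g e1])
    have ne: "g \<cdot> e2 = 0" "g \<cdot> e3 = 0" "h \<cdot> e2 = 0" "h \<cdot> e3 = 0"
      using peirce_product_zero[OF e1] 2(2) gh(4) orth by simp_all
    have ne': "e2 \<cdot> g = 0" "e3 \<cdot> g = 0" "e2 \<cdot> h = 0" "e3 \<cdot> h = 0"
      using ne by (simp_all add: commute)
    have z2: "z \<cdot> z = 4 *s g + e2 + e3"
      by (simp add: z_def bilinear ne ne' idem orth orth' gg)
    have z3: "z \<cdot> (z \<cdot> z) = 8 *s g + e2 - e3"
      unfolding z2 by (simp add: z_def bilinear ne ne' idem orth orth' gg)
    obtain a b c d where rel: "a *s \<one> + b *s z + c *s (z \<cdot> z) + d *s (z \<cdot> (z \<cdot> z)) = 0"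
      and nontriv: "\<not> (a = 0 \<and> b = 0 \<and> c = 0 \<and> d = 0)"
      using relation[of z] by blast
    have act: "y \<cdot> (a *s (g + h + e2 + e3) + b *s (2 *s g + e2 - e3) + c *s (4 *s g + e2 + e3) +
        d *s (8 *s g + e2 - e3)) = 0" for y
      using rel unfolding z3 unfolding z2 unfolding z_def one[symmetric] e1gh by simp
    have "a *s h = 0"
      using act[of h] by (simp add: bilinear ne ne' gh)
    then have "a = 0"
      using hnz by simp
    have "(a + 2 * b + 4 * c + 8 * d) *s g = 0" "(a + b + c + d) *s e2 = 0" "(a - b + c - d) *s e3 = 0"
      using act[of g] act[of e2] act[of e3]
      by (simp_all add: bilinear ne ne' idem orth orth' gg gh vec.scale_left_distrib vec.scale_left_diff_distrib mult.commute)
    then have "a + 2 * b + 4 * c + 8 * d = 0" "a + b + c + d = 0" "a - b + c - d = 0"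
      using nz 2(3) by (metis vector_mul_eq_0)+
    then have "b = 0" "c = 0" "d = 0"
      using \<open>a = 0\<close> by algebra+
    then show ?thesis
      using nontriv \<open>a = 0\<close> by simp
  qed
qed

lemma peirce_nil_one_or_zero:
  assumes c: "idempotent c" and x: "c \<cdot> x = x" "x \<cdot> x = 0" and y: "c \<cdot> y = 0" "y \<cdot> y = 0"
  shows "x = 0 \<or> y = 0"
proof (rule ccontr)
  assume nz: "\<not> ?thesis"
  \<comment> \<open>If neither \<open>x\<close> nor \<open>y\<close> vanishes, the minimal
    polynomial is t^2 (t - 1)^2: \<open>x\<close> doubles the eigenvalue 1 and \<open>y\<close> the
    eigenvalue 0.\<close>
  define z where "z = x + c + y"
  have cc: "c \<cdot> c = c"
    using c by (simp add: idempotent_def)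
  have xy: "x \<cdot> y = 0" "y \<cdot> x = 0" "x \<cdot> c = x" "y \<cdot> c = 0"
    using peirce_product_zero[OF c x(1) y(1)] x y by (simp_all add: commute)
  have z2: "z \<cdot> z = c + 2 *s x"
    unfolding z_def bilinear x y xy cc by (simp add: vec_eq_iff)
  have z3: "z \<cdot> (z \<cdot> z) = c + 3 *s x"
    unfolding z2 unfolding z_def bilinear x y xy cc by (simp add: vec_eq_iff)
  obtain a b g d where rel: "a *s \<one> + b *s z + g *s (z \<cdot> z) + d *s (z \<cdot> (z \<cdot> z)) = 0"
    and nontriv: "\<not> (a = 0 \<and> b = 0 \<and> g = 0 \<and> d = 0)"
    using relation[of z] by blast
  have act: "u \<cdot> (a *s \<one> + b *s (x + c + y) + g *s (c + 2 *s x) + d *s (c + 3 *s x)) = 0" for u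
    using rel unfolding z3 unfolding z2 unfolding z_def by simp
  have "a *s y = 0"
    using act[of y] by (simp add: bilinear x y xy cc)
  then have "a = 0"
    using nz by simp
  have "b *s y = 0"
    using act[of "\<one> - c"] by (simp add: bilinear x y xy cc \<open>a = 0\<close>)
  then have "b = 0"
    using nz by simp
  have "(g + d) *s x = 0"
    using act[of x] by (simp add: bilinear x y xy cc \<open>a = 0\<close> \<open>b = 0\<close> vec.scale_left_distrib)
  then have gd: "g + d = 0"
    using nz by (metis vector_mul_eq_0)
  have "(2 * g + 3 * d) *s x = 0"
    by (rule vec_lin1[OF act[of \<one>]])
      (simp only: bilinear one_left \<open>a = 0\<close> \<open>b = 0\<close> coords, use gd in algebra)
  then have "2 * g + 3 * d = 0"
    using nz by (metis vector_mul_eq_0)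
  then have "g = 0" "d = 0"
    using gd by algebra+
  then show False
    using nontriv \<open>a = 0\<close> \<open>b = 0\<close> by simp
qed


section \<open>Reading off a multiplication table from five vectors\<close>

definition indep5 :: "complex ^ 5 \<Rightarrow> complex ^ 5 \<Rightarrow> complex ^ 5 \<Rightarrow> complex ^ 5 \<Rightarrow> complex ^ 5 \<Rightarrow> bool" where
  "indep5 u0 u1 u2 u3 u4 \<longleftrightarrow>
     (\<forall>a b c d e. a *s u0 + b *s u1 + c *s u2 + d *s u3 + e *s u4 = 0 \<longrightarrow>
        a = 0 \<and> b = 0 \<and> c = 0 \<and> d = 0 \<and> e = 0)"

definition comb5 where
  "comb5 u0 u1 u2 u3 u4 v = v $ 0 *s u0 + v $ 1 *s u1 + v $ 2 *s u2 + v $ 3 *s u3 + v $ 4 *s u4"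
  for u0 u1 u2 u3 u4 v :: "complex ^ 5"

lemma isomorphic_J5I:
  assumes indep: "indep5 u0 u1 u2 u3 u4"
    and "u0 \<cdot> u0 = comb5 u0 u1 u2 u3 u4 (basis_product T 0 0)"
    and "u0 \<cdot> u1 = comb5 u0 u1 u2 u3 u4 (basis_product T 0 1)"
    and "u0 \<cdot> u2 = comb5 u0 u1 u2 u3 u4 (basis_product T 0 2)"
    and "u0 \<cdot> u3 = comb5 u0 u1 u2 u3 u4 (basis_product T 0 3)"
    and "u0 \<cdot> u4 = comb5 u0 u1 u2 u3 u4 (basis_product T 0 4)"
    and "u1 \<cdot> u1 = comb5 u0 u1 u2 u3 u4 (basis_product T 1 1)"
    and "u1 \<cdot> u2 = comb5 u0 u1 u2 u3 u4 (basis_product T 1 2)"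
    and "u1 \<cdot> u3 = comb5 u0 u1 u2 u3 u4 (basis_product T 1 3)"
    and "u1 \<cdot> u4 = comb5 u0 u1 u2 u3 u4 (basis_product T 1 4)"
    and "u2 \<cdot> u2 = comb5 u0 u1 u2 u3 u4 (basis_product T 2 2)"
    and "u2 \<cdot> u3 = comb5 u0 u1 u2 u3 u4 (basis_product T 2 3)"
    and "u2 \<cdot> u4 = comb5 u0 u1 u2 u3 u4 (basis_product T 2 4)"
    and "u3 \<cdot> u3 = comb5 u0 u1 u2 u3 u4 (basis_product T 3 3)"
    and "u3 \<cdot> u4 = comb5 u0 u1 u2 u3 u4 (basis_product T 3 4)"
    and "u4 \<cdot> u4 = comb5 u0 u1 u2 u3 u4 (basis_product T 4 4)"
    and T: "basis_product T 1 0 = basis_product T 0 1" "basis_product T 2 0 = basis_product T 0 2"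
      "basis_product T 3 0 = basis_product T 0 3" "basis_product T 4 0 = basis_product T 0 4"
      "basis_product T 2 1 = basis_product T 1 2" "basis_product T 3 1 = basis_product T 1 3"
      "basis_product T 4 1 = basis_product T 1 4" "basis_product T 3 2 = basis_product T 2 3"
      "basis_product T 4 2 = basis_product T 2 4" "basis_product T 4 3 = basis_product T 3 4"
  shows "algebra_isomorphic (*s) (\<cdot>) (*s) (table_mult T)"
proof -
  define u where "u i = (if i = 0 then u0 else if i = 1 then u1 else if i = 2 then u2 else if i = 3 then u3 else u4)"
    for i :: 5
  have u: "u 0 = u0" "u 1 = u1" "u 2 = u2" "u 3 = u3" "u 4 = u4"
    by (simp_all add: u_def)
  have comb: "(\<Sum>k\<in>UNIV. v $ k *s u k) = comb5 u0 u1 u2 u3 u4 v" for v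
    by (simp add: sum_UNIV_5 u comb5_def)
  show ?thesis
  proof (rule isomorphic_table_mult[where u = u])
    fix c assume "(\<Sum>i\<in>UNIV. c i *s u i) = 0"
    then have "c 0 = 0 \<and> c 1 = 0 \<and> c 2 = 0 \<and> c 3 = 0 \<and> c 4 = 0"
      using indep unfolding indep5_def by (simp add: sum_UNIV_5 u)
    then show "c = (\<lambda>_. 0)"
      by (simp add: fun_eq_iff forall_5)
  next
    have "\<forall>i j. u i \<cdot> u j = comb5 u0 u1 u2 u3 u4 (basis_product T i j)"
      unfolding forall_5 u T using assms(2-16)
      by (simp add: commute[of u1 u0] commute[of u2 u0] commute[of u3 u0] commute[of u4 u0] commute[of u2 u1]
          commute[of u3 u1] commute[of u4 u1] commute[of u3 u2] commute[of u4 u2] commute[of u4 u3])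
    then show "u i \<cdot> u j = (\<Sum>k\<in>UNIV. basis_product T i j $ k *s u k)" for i j
      by (simp add: comb)
  qed (simp_all add: bilinear commute)
qed

lemmas table_simps = comb5_def basis_product_def all_tables_nth Jq_table_def axis_def

abbreviation is_J5 :: "nat \<Rightarrow> bool" where
  "is_J5 k \<equiv> algebra_isomorphic (*s) (\<cdot>) (*s) (J5_mult k)"

text \<open>Supplies the next vector when a basis is built; shorter lists are padded with 0.\<close>

lemma not_spanned_by_four:
  "\<exists>x. \<forall>a b c d. x \<noteq> a *s u0 + b *s u1 + c *s u2 + d *s u3" for u0 u1 u2 u3 :: "complex ^ 5"
proof (rule ccontr)
  assume no: "\<not> ?thesis"
  have "x \<in> vec.span {u0, u1, u2, u3}" for x
  proof -
    obtain a b c d where "x = a *s u0 + b *s u1 + c *s u2 + d *s u3"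
      using no by blast
    then show ?thesis
      by (simp add: vec.span_add vec.span_scale vec.span_base)
  qed
  then have "vec.dim (UNIV :: (complex ^ 5) set) \<le> card {u0, u1, u2, u3}"
    by (intro vec.dim_le_card) auto
  also have "\<dots> \<le> 4"
    by (simp add: card_insert_if)
  finally show False
    using vec_dim_card[where 'a = complex and 'n = 5] by simp
qed

end

text \<open>A vector with nonzero value is scaled to value 1, and a vector polar to it is scaled if
  it is not isotropic. The last implication puts the value 1 first, which leaves three
  cases.\<close>

lemma binary_form_diagonal:
  fixes \<alpha> \<beta> \<gamma> :: complex
  defines "Q \<equiv> \<lambda>p q. \<alpha> * p^2 + 2 * \<beta> * p * q + \<gamma> * q^2"
  shows "\<exists>p q r s. p * s - q * r \<noteq> 0 \<and> \<alpha> * p * r + \<beta> * (p * s + q * r) + \<gamma> * q * s = 0 \<and>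
    (Q p q = 0 \<or> Q p q = 1) \<and> (Q r s = 0 \<or> Q r s = 1) \<and> (Q r s = 1 \<longrightarrow> Q p q = 1)"
proof (cases "\<exists>p q. Q p q \<noteq> 0")
  case False
  then have "Q 1 0 = 0" "Q 0 1 = 0" "Q 1 1 = 0"
    by auto
  then have "\<alpha> = 0" "\<gamma> = 0" "\<beta> = 0"
    by (simp_all add: Q_def)
  then show ?thesis
    by (intro exI[of _ 1] exI[of _ 0] exI[of _ 0] exI[of _ 1]) (simp add: Q_def)
next
  case True
  then obtain p0 q0 where pq0: "Q p0 q0 \<noteq> 0"
    by blast
  define p q where "p = p0 / csqrt (Q p0 q0)" and "q = q0 / csqrt (Q p0 q0)"
  have scale: "Q (x / csqrt t) (y / csqrt t) = Q x y / t" if "t \<noteq> 0" for x y t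
  proof -
    have "csqrt t * csqrt t = t"
      by (metis power2_csqrt power2_eq_square)
    then show ?thesis
      using that by (simp add: Q_def power2_eq_square add_divide_distrib)
  qed
  have Qpq: "Q p q = 1"
    using scale[OF pq0, of p0 q0] pq0 by (simp add: p_def q_def)
  text \<open>The vector polar to \<open>(p, q)\<close>; the determinant of the two vectors is \<open>Q p q\<close>.\<close>
  define r0 s0 where "r0 = - (\<beta> * p + \<gamma> * q)" and "s0 = \<alpha> * p + \<beta> * q"
  have det: "p * s0 - q * r0 = 1"
    using Qpq by (simp add: r0_def s0_def Q_def power2_eq_square algebra_simps)
  have polar: "\<alpha> * p * r0 + \<beta> * (p * s0 + q * r0) + \<gamma> * q * s0 = 0"
    by (simp add: r0_def s0_def algebra_simps)
  show ?thesis
  proof (cases "Q r0 s0 = 0")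
    case True
    then show ?thesis
      using det polar Qpq by (intro exI[of _ p] exI[of _ q] exI[of _ r0] exI[of _ s0]) simp
  next
    case False
    define k where "k = csqrt (Q r0 s0)"
    have "k \<noteq> 0"
      using False by (simp add: k_def)
    have "p * (s0 / k) - q * (r0 / k) = (p * s0 - q * r0) / k"
      by (simp add: diff_divide_distrib)
    then have "p * (s0 / k) - q * (r0 / k) \<noteq> 0"
      using det \<open>k \<noteq> 0\<close> by simp
    moreover have "\<alpha> * p * (r0 / k) + \<beta> * (p * (s0 / k) + q * (r0 / k)) + \<gamma> * q * (s0 / k) =
        (\<alpha> * p * r0 + \<beta> * (p * s0 + q * r0) + \<gamma> * q * s0) / k"
      by (simp add: add_divide_distrib distrib_left)
    moreover have "Q (r0 / k) (s0 / k) = 1"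
      using scale[OF False, of r0 s0] False by (simp add: k_def)
    ultimately show ?thesis
      using polar Qpq
      by (intro exI[of _ p] exI[of _ q] exI[of _ "r0 / k"] exI[of _ "s0 / k"]) simp
  qed
qed

definition indep2 :: "complex ^ 5 \<Rightarrow> complex ^ 5 \<Rightarrow> bool" where
  "indep2 x y \<longleftrightarrow> (\<forall>s t. s *s x + t *s y = 0 \<longrightarrow> s = 0 \<and> t = 0)"

lemma coefficient_zero:
  fixes x y w :: "complex ^ 5"
  assumes eq: "a *s x + b *s y + d *s w = 0" and w: "\<And>s t. w \<noteq> s *s x + t *s y"
  shows "d = 0"
proof (rule ccontr)
  assume "d \<noteq> 0"
  have "d *s w = (- a) *s x + (- b) *s y"
    by (rule vec_lin1[OF eq]) (simp only: coords, algebra)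
  then have "(1 / d) *s (d *s w) = (1 / d) *s ((- a) *s x + (- b) *s y)"
    by (rule arg_cong)
  then have "w = (1 / d * (- a)) *s x + (1 / d * (- b)) *s y"
    using \<open>d \<noteq> 0\<close> by (simp only: vec.scale_right_distrib vector_smult_assoc) simp
  then show False
    using w by blast
qed

lemma indep2I:
  assumes "x \<noteq> 0" "\<And>k. y \<noteq> k *s x"
  shows "indep2 x y"
  unfolding indep2_def
proof (intro allI impI)
  fix s t assume eq: "s *s x + t *s y = 0"
  have "t = 0"
    by (rule coefficient_zero[of s x 0 0 t y]) (use eq assms(2) in simp_all)
  then show "s = 0 \<and> t = 0"
    using eq assms(1) by simp
qed

lemma indep2_comb:
  assumes "indep2 x y" "a * d - b * c \<noteq> 0"
  shows "indep2 (a *s x + b *s y) (c *s x + d *s y)"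
  unfolding indep2_def
proof (intro allI impI)
  fix s t assume eq: "s *s (a *s x + b *s y) + t *s (c *s x + d *s y) = 0"
  have "(s * a + t * c) *s x + (s * b + t * d) *s y = 0"
    by (rule vec_lin1[OF eq]) (simp only: coords, algebra)
  then have "s * a + t * c = 0" "s * b + t * d = 0"
    using assms(1) unfolding indep2_def by blast+
  then have "s * (a * d - b * c) = 0" "t * (a * d - b * c) = 0"
    by algebra+
  then show "s = 0 \<and> t = 0"
    using assms(2) by simp
qed

context rank3_algebra
begin

text \<open>Serves wherever the products within a plane fall into a line; the three outcomes are the
  algebras 14 to 16, 6 to 8, and 3 to 5.\<close>

lemma diagonal_pair:
  assumes "u \<cdot> u = \<alpha> *s g" "u \<cdot> w = \<beta> *s g" "w \<cdot> w = \<gamma> *s g"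
  obtains p q r s x y where "x = p *s u + q *s w" "y = r *s u + s *s w" "p * s - q * r \<noteq> 0"
    "x \<cdot> y = 0" "x \<cdot> x = 0 \<and> y \<cdot> y = 0 \<or> x \<cdot> x = g \<and> y \<cdot> y = 0 \<or> x \<cdot> x = g \<and> y \<cdot> y = g"
proof -
  have product: "(p *s u + q *s w) \<cdot> (r *s u + s *s w) = (\<alpha> * p * r + \<beta> * (p * s + q * r) + \<gamma> * q * s) *s g" for p q r s
    by (simp only: bilinear assms commute[of w u] vec_eq_iff coords) algebra
  have square: "(p *s u + q *s w) \<cdot> (p *s u + q *s w) = (\<alpha> * p^2 + 2 * \<beta> * p * q + \<gamma> * q^2) *s g" for p q
    unfolding product by (simp add: power2_eq_square algebra_simps)
  obtain p q r s where det: "p * s - q * r \<noteq> 0"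
    and polar: "\<alpha> * p * r + \<beta> * (p * s + q * r) + \<gamma> * q * s = 0"
    and Q: "\<alpha> * p^2 + 2 * \<beta> * p * q + \<gamma> * q^2 = 0 \<or> \<alpha> * p^2 + 2 * \<beta> * p * q + \<gamma> * q^2 = 1"
      "\<alpha> * r^2 + 2 * \<beta> * r * s + \<gamma> * s^2 = 0 \<or> \<alpha> * r^2 + 2 * \<beta> * r * s + \<gamma> * s^2 = 1"
      "\<alpha> * r^2 + 2 * \<beta> * r * s + \<gamma> * s^2 = 1 \<longrightarrow> \<alpha> * p^2 + 2 * \<beta> * p * q + \<gamma> * q^2 = 1"
    using binary_form_diagonal[of \<alpha> \<beta> \<gamma>] by (elim exE conjE) (rule that)
  show ?thesis
    by (rule that[OF refl refl det]) (unfold square, unfold product polar, simp, use Q in \<open>metis vec.scale_one vec.scale_zero_left\<close>)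
qed

lemma indep5_span:
  assumes "indep5 u0 u1 u2 u3 u4"
  shows "\<exists>a b c d e. x = a *s u0 + b *s u1 + c *s u2 + d *s u3 + e *s u4"
proof -
  define M where "M = (\<chi> i j. v5 (u0 $ i) (u1 $ i) (u2 $ i) (u3 $ i) (u4 $ i) $ j)"
  have M: "M *v c = c $ 0 *s u0 + c $ 1 *s u1 + c $ 2 *s u2 + c $ 3 *s u3 + c $ 4 *s u4" for c
    by (simp add: M_def matrix_vector_mult_def vec_eq_iff sum_UNIV_5 mult.commute)
  have "c = 0" if "M *v c = 0" for c
    using assms[unfolded indep5_def, rule_format, OF that[unfolded M]] by (simp add: v5_eq_iff)
  then have "\<exists>B. B ** M = mat 1"
    unfolding matrix_left_invertible_ker by blast
  then have "\<exists>B. M ** B = mat 1"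
    using matrix_left_right_inverse by blast
  then obtain B where "M ** B = mat 1"
    by blast
  then have "M *v (B *v x) = x"
    by (simp add: matrix_vector_mul_assoc)
  then show ?thesis
    unfolding M by metis
qed

section \<open>Algebras 13 to 16: three orthogonal idempotents\<close>

text \<open>The parts for \<open>e1\<close> are decomposed again with respect to \<open>e2\<close>.
  This works because \<open>e2\<close> has eigenvalue 0 for \<open>e1\<close>, so multiplication by
  it preserves the Peirce spaces of \<open>e1\<close>.\<close>

lemma peirce_pair_decomposition:
  assumes e: "idempotent_triple e1 e2 e3"
  obtains a b c x12 x13 x23 where "v = a *s e1 + b *s e2 + c *s e3 + x12 + x13 + x23"
    "e1 \<cdot> x12 = (1/2) *s x12" "e2 \<cdot> x12 = (1/2) *s x12" "e3 \<cdot> x12 = 0"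
    "e1 \<cdot> x13 = (1/2) *s x13" "e2 \<cdot> x13 = 0" "e3 \<cdot> x13 = (1/2) *s x13"
    "e1 \<cdot> x23 = 0" "e2 \<cdot> x23 = (1/2) *s x23" "e3 \<cdot> x23 = (1/2) *s x23"
proof -
  have e1: "idempotent e1" and e2: "idempotent e2" and orth: "e1 \<cdot> e2 = 0"
    and one: "e1 + e2 + e3 = \<one>"
    using e by (auto simp: idempotent_triple_def)
  have e231: "idempotent_triple e2 e1 e3" "idempotent_triple e3 e1 e2"
    using e idempotent_triple_perm by blast+
  have e3_act: "e3 \<cdot> x = x - e1 \<cdot> x - e2 \<cdot> x" for x
  proof -
    have "e3 = \<one> - e1 - e2"
      using one by (simp add: algebra_simps)
    then show ?thesis
      by (simp add: bilinear)
  qed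
  have comm: "e1 \<cdot> (e2 \<cdot> y) = t *s (e2 \<cdot> y)" if "e1 \<cdot> y = t *s y" for y t
    by (rule peirce_product[OF e1, of e2 0]) (use orth that in auto)
  obtain v1 vh v0 where v: "v = v1 + vh + v0" "e1 \<cdot> v1 = v1" "e1 \<cdot> vh = (1/2) *s vh" "e1 \<cdot> v0 = 0"
    using peirce_decomposition[OF e1, of v] by blast
  obtain w1 wh w0 where w: "vh = w1 + wh + w0" "e2 \<cdot> w1 = w1" "e2 \<cdot> wh = (1/2) *s wh" "e2 \<cdot> w0 = 0"
    and w': "w1 = 2 *s (e2 \<cdot> (e2 \<cdot> vh)) - e2 \<cdot> vh" "wh = 4 *s (e2 \<cdot> vh) - 4 *s (e2 \<cdot> (e2 \<cdot> vh))"
      "w0 = vh - 3 *s (e2 \<cdot> vh) + 2 *s (e2 \<cdot> (e2 \<cdot> vh))"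
    using peirce_decomposition[OF e2, of vh] by blast
  obtain p1 ph p0 where p: "v0 = p1 + ph + p0" "e2 \<cdot> p1 = p1" "e2 \<cdot> ph = (1/2) *s ph" "e2 \<cdot> p0 = 0"
    and p': "p1 = 2 *s (e2 \<cdot> (e2 \<cdot> v0)) - e2 \<cdot> v0" "ph = 4 *s (e2 \<cdot> v0) - 4 *s (e2 \<cdot> (e2 \<cdot> v0))"
      "p0 = v0 - 3 *s (e2 \<cdot> v0) + 2 *s (e2 \<cdot> (e2 \<cdot> v0))"
    using peirce_decomposition[OF e2, of v0] by blast
  note vh = comm[OF v(3)] comm[OF comm[OF v(3)]]
  have v0: "e1 \<cdot> (e2 \<cdot> v0) = 0" "e1 \<cdot> (e2 \<cdot> (e2 \<cdot> v0)) = 0"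
    using comm[of v0 0] comm[of "e2 \<cdot> v0" 0] v(4) by simp_all
  have e1w: "e1 \<cdot> w1 = (1/2) *s w1" "e1 \<cdot> wh = (1/2) *s wh" "e1 \<cdot> w0 = (1/2) *s w0"
    unfolding w' bilinear vh v(3) by (simp_all only: vec_eq_iff coords, algebra+)
  have e1p: "e1 \<cdot> p1 = 0" "e1 \<cdot> ph = 0" "e1 \<cdot> p0 = 0"
    unfolding p' bilinear v0 v(4) by simp_all
  obtain a where a: "v1 = a *s e1"
    using idempotent_triple_peirce_one[OF e v(2)] by blast
  obtain b where b: "p1 = b *s e2"
    using idempotent_triple_peirce_one[OF e231(1) p(2)] by blast
  obtain d where d: "w1 = d *s e2"
    using idempotent_triple_peirce_one[OF e231(1) w(2)] by blast
  \<comment> \<open>A multiple of \<open>e2\<close> is annihilated by \<open>e1\<close>, whereas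
    \<open>w1\<close> has eigenvalue 1/2.\<close>
  have "w1 = 0"
    using e1w(1) orth by (simp add: d scale_right)
  have "e3 \<cdot> p0 = p0"
    by (simp add: e3_act e1p p(4))
  then obtain c where c: "p0 = c *s e3"
    using idempotent_triple_peirce_one[OF e231(2)] by blast
  show ?thesis
  proof (rule that[of a b c wh w0 ph])
    show "v = a *s e1 + b *s e2 + c *s e3 + wh + w0 + ph"
      using v(1) w(1) p(1) \<open>w1 = 0\<close> by (simp add: a b c)
    show "e1 \<cdot> wh = (1/2) *s wh" "e2 \<cdot> wh = (1/2) *s wh" "e1 \<cdot> w0 = (1/2) *s w0" "e2 \<cdot> w0 = 0"
      "e1 \<cdot> ph = 0" "e2 \<cdot> ph = (1/2) *s ph"
      by (fact e1w w p e1p)+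
    show "e3 \<cdot> wh = 0" "e3 \<cdot> w0 = (1/2) *s w0" "e3 \<cdot> ph = (1/2) *s ph"
      unfolding e3_act e1w w p e1p by (simp_all add: vec_eq_iff)
  qed
qed

text \<open>The idempotents with \<open>a\<close> and \<open>b\<close> exhaust dimension five, so no
  vector is left with eigenvalue 1/2 for both \<open>e2\<close> and \<open>e3\<close>, as a b would
  have. The square of \<open>a\<close> can only be s e1 + t e2.\<close>

lemma two_peirce_pairs:
  assumes e: "idempotent_triple e1 e2 e3"
    and a: "e1 \<cdot> a = (1/2) *s a" "e2 \<cdot> a = (1/2) *s a" "e3 \<cdot> a = 0" "a \<noteq> 0"
    and b: "e1 \<cdot> b = (1/2) *s b" "e2 \<cdot> b = 0" "e3 \<cdot> b = (1/2) *s b" "b \<noteq> 0"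
  shows "indep5 e1 e2 e3 a b" and "a \<cdot> b = 0" and "a \<cdot> a = 0"
proof -
  have idem: "e1 \<cdot> e1 = e1" "e2 \<cdot> e2 = e2" "e3 \<cdot> e3 = e3" and nz: "e1 \<noteq> 0" "e2 \<noteq> 0" "e3 \<noteq> 0"
    and orth: "e1 \<cdot> e2 = 0" "e1 \<cdot> e3 = 0" "e2 \<cdot> e3 = 0" and one: "e1 + e2 + e3 = \<one>"
    and e1: "idempotent e1" and e2: "idempotent e2" and e3: "idempotent e3"
    using e by (auto simp: idempotent_triple_def idempotent_def)
  have orth': "e2 \<cdot> e1 = 0" "e3 \<cdot> e1 = 0" "e3 \<cdot> e2 = 0"
    using orth by (simp_all add: commute)
  note acts = bilinear idem orth orth' a b
  show indep: "indep5 e1 e2 e3 a b"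
    unfolding indep5_def
  proof (intro allI impI)
    fix s t u p q
    assume eq: "s *s e1 + t *s e2 + u *s e3 + p *s a + q *s b = 0"
    have act: "y \<cdot> (s *s e1 + t *s e2 + u *s e3 + p *s a + q *s b) = 0" for y
      unfolding eq by simp
    have 2: "t *s e2 + (p / 2) *s a = 0" and 3: "u *s e3 + (q / 2) *s b = 0"
      using act[of e2] act[of e3] by (simp_all add: acts)
    have "e2 \<cdot> (t *s e2 + (p / 2) *s a) = 0" "e3 \<cdot> (u *s e3 + (q / 2) *s b) = 0"
      unfolding 2 3 by simp_all
    then have 22: "t *s e2 + (p / 4) *s a = 0" and 33: "u *s e3 + (q / 4) *s b = 0"
      by (simp_all add: acts)
    have "p *s a = 0" "q *s b = 0"
      by (rule vec_lin2[OF 2 22], simp, algebra) (rule vec_lin2[OF 3 33], simp, algebra)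
    then have "p = 0" "q = 0"
      using a b by simp_all
    then show "s = 0 \<and> t = 0 \<and> u = 0 \<and> p = 0 \<and> q = 0"
      using 2 3 eq nz by simp
  qed
  have coeffs: "s = s' \<and> t = t' \<and> u = u' \<and> p = p' \<and> q = q'"
    if eq: "s *s e1 + t *s e2 + u *s e3 + p *s a + q *s b = s' *s e1 + t' *s e2 + u' *s e3 + p' *s a + q' *s b"
    for s t u p q s' t' u' p' q'
  proof -
    have "(s - s') *s e1 + (t - t') *s e2 + (u - u') *s e3 + (p - p') *s a + (q - q') *s b = 0"
      by (rule vec_lin1[OF eq]) (simp only: coords, algebra)
    then show ?thesis
      using indep unfolding indep5_def by fastforce
  qed
  have ab2: "e2 \<cdot> (a \<cdot> b) = (1/2) *s (a \<cdot> b)"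
    using peirce_product[OF e2, of b 0 a "1/2"] a b by (simp add: commute[of b a])
  have ab3: "e3 \<cdot> (a \<cdot> b) = (1/2) *s (a \<cdot> b)"
    using peirce_product[OF e3, of a 0 b "1/2"] a b by simp
  obtain s t u p q where ab: "a \<cdot> b = s *s e1 + t *s e2 + u *s e3 + p *s a + q *s b"
    using indep5_span[OF indep] by blast
  have "0 *s e1 + t *s e2 + 0 *s e3 + (p/2) *s a + 0 *s b =
      (s/2) *s e1 + (t/2) *s e2 + (u/2) *s e3 + (p/2) *s a + (q/2) *s b"
    using ab2 unfolding ab by (simp add: acts)
  from coeffs[OF this] have "s = 0" "t = 0" "u = 0" "q = 0"
    by auto
  moreover have "0 *s e1 + 0 *s e2 + u *s e3 + 0 *s a + (q/2) *s b =
      (s/2) *s e1 + (t/2) *s e2 + (u/2) *s e3 + (p/2) *s a + (q/2) *s b"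
    using ab3 unfolding ab by (simp add: acts)
  from coeffs[OF this] have "p = 0"
    by auto
  ultimately show ab0: "a \<cdot> b = 0"
    by (simp add: ab)
  obtain s t u p q where aa: "a \<cdot> a = s *s e1 + t *s e2 + u *s e3 + p *s a + q *s b"
    using indep5_span[OF indep] by blast
  have "e3 \<cdot> (a \<cdot> a) = 0"
    using peirce_product[OF e3, of a 0 a 0] a by simp
  then have "0 *s e1 + 0 *s e2 + u *s e3 + 0 *s a + (q/2) *s b = 0 *s e1 + 0 *s e2 + 0 *s e3 + 0 *s a + 0 *s b"
    unfolding aa by (simp add: acts)
  from coeffs[OF this] have "u = 0" "q = 0"
    by auto
  have "s *s e1 + 0 *s e2 + 0 *s e3 + (p/4) *s a + 0 *s b = s *s e1 + 0 *s e2 + 0 *s e3 + (p/2) *s a + 0 *s b"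
    using peirce_product_half[OF e1 a(1) a(1)] \<open>u = 0\<close> \<open>q = 0\<close> unfolding aa by (simp add: acts)
  from coeffs[OF this] have "p = 0"
    by simp
  have aa: "a \<cdot> a = s *s e1 + t *s e2"
    unfolding aa \<open>u = 0\<close> \<open>q = 0\<close> \<open>p = 0\<close> by simp
  \<comment> \<open>Of the two remaining idempotents only \<open>e1\<close> acts on
    \<open>b\<close>, so this equation isolates \<open>s\<close>; the next instance of the Jordan
    identity isolates \<open>t\<close>.\<close>
  have "(a \<cdot> a) \<cdot> (b \<cdot> e3) = 0"
    using jordan_linearized_square[of a b e3] a(3) ab0 \<open>e3 \<cdot> (a \<cdot> a) = 0\<close>
    by (simp add: commute[of a e3] commute[of "a \<cdot> a" e3])
  then have "(s / 4) *s b = 0"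
    unfolding aa by (simp add: acts commute[of b e3])
  then have "s = 0"
    using b by simp
  have "(a \<cdot> a) \<cdot> (a \<cdot> e1) = a \<cdot> ((a \<cdot> a) \<cdot> e1)"
    by (rule jordan)
  then have "(t / 4) *s a = 0"
    unfolding aa \<open>s = 0\<close> by (simp add: acts commute[of a e1])
  then have "t = 0"
    using a by simp
  then show "a \<cdot> a = 0"
    by (simp add: aa \<open>s = 0\<close>)
qed

lemma isomorphic_J5_13:
  assumes e: "idempotent_triple e1 e2 e3"
    and a: "e1 \<cdot> a = (1/2) *s a" "e2 \<cdot> a = (1/2) *s a" "e3 \<cdot> a = 0" "a \<noteq> 0"
    and b: "e1 \<cdot> b = (1/2) *s b" "e2 \<cdot> b = 0" "e3 \<cdot> b = (1/2) *s b" "b \<noteq> 0"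
  shows "is_J5 13"
proof -
  have idem: "e1 \<cdot> e1 = e1" "e2 \<cdot> e2 = e2" "e3 \<cdot> e3 = e3"
    and orth: "e1 \<cdot> e2 = 0" "e1 \<cdot> e3 = 0" "e2 \<cdot> e3 = 0"
    using e by (auto simp: idempotent_triple_def idempotent_def)
  have "b \<cdot> b = 0"
    by (rule two_peirce_pairs(3)[OF _ b(1,3,2,4) a(1,3,2,4)]) (rule idempotent_triple_perm[OF e])
  then show ?thesis
    unfolding J5_mult_def using two_peirce_pairs[OF e a b] idem orth a b
    by (intro isomorphic_J5I[of e1 e2 e3 a b]) (simp_all add: table_simps)
qed

end

context rank3_algebra
begin

text \<open>Without a 1/2-space of \<open>e1\<close> the algebra is the product of C e1 and the
  Peirce space of f = e2 + e3. The latter is a quadratic form algebra, since squares in the joint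
  1/2-space of \<open>e2\<close> and \<open>e3\<close> are multiples of \<open>f\<close>.\<close>

lemma isomorphic_J5_14_16:
  assumes e: "idempotent_triple e1 e2 e3" and H: "\<And>x. e1 \<cdot> x = (1/2) *s x \<Longrightarrow> x = 0"
  shows "\<exists>k\<in>{14, 15, 16}. is_J5 k"
proof -
  have idem: "e1 \<cdot> e1 = e1" "e2 \<cdot> e2 = e2" "e3 \<cdot> e3 = e3" and nz: "e1 \<noteq> 0" "e2 \<noteq> 0" "e3 \<noteq> 0"
    and orth: "e1 \<cdot> e2 = 0" "e1 \<cdot> e3 = 0" "e2 \<cdot> e3 = 0" and one: "e1 + e2 + e3 = \<one>"
    and e1: "idempotent e1" and e2: "idempotent e2"
    using e by (auto simp: idempotent_triple_def idempotent_def)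
  have orth': "e2 \<cdot> e1 = 0" "e3 \<cdot> e1 = 0" "e3 \<cdot> e2 = 0"
    using orth by (simp_all add: commute)
  define J23 where "J23 x \<longleftrightarrow> e1 \<cdot> x = 0 \<and> e2 \<cdot> x = (1/2) *s x \<and> e3 \<cdot> x = (1/2) *s x" for x
  have J23_comb: "J23 (p *s x + q *s y)" if "J23 x" "J23 y" for p q x y
    using that by (simp add: J23_def bilinear mult.commute)
  have decomp: "\<exists>a b c x. v = a *s e1 + b *s e2 + c *s e3 + x \<and> J23 x" for v
  proof -
    obtain a b c x12 x13 x23 where d: "v = a *s e1 + b *s e2 + c *s e3 + x12 + x13 + x23"
      "e1 \<cdot> x12 = (1/2) *s x12" "e2 \<cdot> x12 = (1/2) *s x12" "e3 \<cdot> x12 = 0"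
      "e1 \<cdot> x13 = (1/2) *s x13" "e2 \<cdot> x13 = 0" "e3 \<cdot> x13 = (1/2) *s x13"
      "e1 \<cdot> x23 = 0" "e2 \<cdot> x23 = (1/2) *s x23" "e3 \<cdot> x23 = (1/2) *s x23"
      by (rule peirce_pair_decomposition[OF e, of v]) (rule that)
    have "v = a *s e1 + b *s e2 + c *s e3 + x23"
      using d(1) H[OF d(2)] H[OF d(5)] by simp
    moreover have "J23 x23"
      using d by (simp add: J23_def)
    ultimately show ?thesis
      by blast
  qed
  obtain u where u: "J23 u" and u_nz: "u \<noteq> 0"
  proof -
    obtain v where v: "\<forall>a b c d. v \<noteq> a *s e1 + b *s e2 + c *s e3 + d *s 0"
      using not_spanned_by_four by blast
    obtain a b c x where "v = a *s e1 + b *s e2 + c *s e3 + x" "J23 x"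
      using decomp[of v] by blast
    then show ?thesis
      using v that by (cases "x = 0") auto
  qed
  obtain w where w: "J23 w" and w_u: "\<And>d. w \<noteq> d *s u"
  proof -
    obtain v where v: "\<forall>a b c d. v \<noteq> a *s e1 + b *s e2 + c *s e3 + d *s u"
      using not_spanned_by_four by blast
    obtain a b c x where "v = a *s e1 + b *s e2 + c *s e3 + x" "J23 x"
      using decomp[of v] by blast
    then show ?thesis
      using v that[of x] by blast
  qed
  have uw: "indep2 u w"
    by (rule indep2I[OF u_nz w_u])
  define f where "f = e2 + e3"
  have f: "f \<cdot> f = f" "e1 \<cdot> f = 0" "f \<cdot> e1 = 0" "f \<noteq> 0"
  proof -
    have "e2 \<cdot> f = e2"
      by (simp add: f_def bilinear idem orth)
    then show "f \<noteq> 0"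
      using nz by auto
  qed (simp_all add: f_def bilinear idem orth orth')
  have square: "\<exists>q. x \<cdot> x = q *s f" if x: "J23 x" for x
  proof (cases "x = 0")
    case True
    then show ?thesis
      by (intro exI[of _ 0]) simp
  next
    case False
    have x': "e1 \<cdot> x = 0" "e2 \<cdot> x = (1/2) *s x" "e3 \<cdot> x = (1/2) *s x"
      using x by (auto simp: J23_def)
    obtain a b c y where xx: "x \<cdot> x = a *s e1 + b *s e2 + c *s e3 + y" and "J23 y"
      using decomp by blast
    then have y: "e1 \<cdot> y = 0" "e2 \<cdot> y = (1/2) *s y" "e3 \<cdot> y = (1/2) *s y"
      by (auto simp: J23_def)
    have "e1 \<cdot> (x \<cdot> x) = 0"
      using peirce_product[OF e1, of x 0 x 0] x' by simp
    then have "a = 0"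
      unfolding xx by (simp add: bilinear idem orth y nz)
    have *: "e2 \<cdot> (e2 \<cdot> (x \<cdot> x)) = e2 \<cdot> (x \<cdot> x)"
      by (rule peirce_product_half[OF e2]) (use x' in simp_all)
    have "(1/4) *s y = 0"
      by (rule vec_lin1[OF *]) (simp only: xx bilinear idem orth orth' y coords, simp)
    then have "y = 0"
      by simp
    have xx: "x \<cdot> x = b *s e2 + c *s e3"
      unfolding xx \<open>y = 0\<close> \<open>a = 0\<close> by simp
    \<comment> \<open>This instance forces the coefficients of \<open>e2\<close> and
      \<open>e3\<close> to agree.\<close>
    have "(x \<cdot> x) \<cdot> (x \<cdot> e2) = x \<cdot> ((x \<cdot> x) \<cdot> e2)"
      by (rule jordan)
    then have **: "(b / 4) *s x + (c / 4) *s x = (b / 2) *s x"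
      unfolding xx by (simp add: bilinear idem orth orth' x' commute[of x e2])
    have "(c - b) *s x = 0"
      by (rule vec_lin1[OF **]) (simp, algebra)
    then have "c - b = 0"
      using False by (metis vector_mul_eq_0)
    then show ?thesis
      unfolding xx f_def by (intro exI[of _ b]) (simp add: vec.scale_right_distrib)
  qed
  obtain \<alpha> \<gamma> where uu: "u \<cdot> u = \<alpha> *s f" and ww: "w \<cdot> w = \<gamma> *s f"
    using square u w by blast
  obtain \<delta> where "(u + w) \<cdot> (u + w) = \<delta> *s f"
    using square[of "u + w"] J23_comb[OF u w, of 1 1] by auto
  then have \<delta>: "\<alpha> *s f + u \<cdot> w + (u \<cdot> w + \<gamma> *s f) = \<delta> *s f"
    by (simp add: bilinear uu ww commute[of w u])
  define \<beta> where "\<beta> = (\<delta> - \<alpha> - \<gamma>) / 2"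
  have \<beta>: "2 * \<beta> = \<delta> - \<alpha> - \<gamma>"
    by (simp add: \<beta>_def)
  have uw': "u \<cdot> w = \<beta> *s f"
    by (rule vec_lin1[OF \<delta>]) (simp only: coords, use \<beta> in algebra)
  obtain p q r s x y where x_def: "x = p *s u + q *s w" and y_def: "y = r *s u + s *s w"
    and det: "p * s - q * r \<noteq> 0" and xy0: "x \<cdot> y = 0"
    and squares: "x \<cdot> x = 0 \<and> y \<cdot> y = 0 \<or> x \<cdot> x = f \<and> y \<cdot> y = 0 \<or> x \<cdot> x = f \<and> y \<cdot> y = f"
    by (rule diagonal_pair[OF uu uw' ww]) (rule that)
  have "J23 x" "J23 y"
    unfolding x_def y_def using J23_comb u w by auto
  then have xy: "e1 \<cdot> x = 0" "e1 \<cdot> y = 0" "e2 \<cdot> x = (1/2) *s x" "e3 \<cdot> x = (1/2) *s x"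
      "e2 \<cdot> y = (1/2) *s y" "e3 \<cdot> y = (1/2) *s y"
    by (auto simp: J23_def)
  have indep_xy: "indep2 x y"
    unfolding x_def y_def by (rule indep2_comb[OF uw det])
  \<comment> \<open>The factor i gives h^2 = -f, as the sign of -q requires, and likewise for i x
    and i y below. As \<open>h\<close> always contributes 1, the form has rank at least one.\<close>
  define h where "h = \<i> *s (e2 - e3)"
  have fh: "f \<cdot> h = h" "h \<cdot> h = - f" "e1 \<cdot> h = 0" "f \<cdot> x = x" "f \<cdot> y = y" "h \<cdot> x = 0" "h \<cdot> y = 0"
    by (simp_all only: f_def h_def bilinear idem orth orth' xy vec_eq_iff coords)
      (simp_all add: algebra_simps)
  have indep: "indep5 e1 f h (\<i> *s x) (\<i> *s y)"
    unfolding indep5_def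
  proof (intro allI impI)
    fix a b c d g
    assume eq: "a *s e1 + b *s f + c *s h + d *s (\<i> *s x) + g *s (\<i> *s y) = 0"
    have act: "v \<cdot> (a *s e1 + b *s f + c *s h + d *s (\<i> *s x) + g *s (\<i> *s y)) = 0" for v
      unfolding eq by simp
    have "a = 0"
      using act[of e1] nz by (simp add: bilinear idem f fh xy)
    have 2: "(b + c * \<i>) *s e2 + ((d * \<i> / 2) *s x + (g * \<i> / 2) *s y) = 0"
      by (rule vec_lin1[OF act[of e2]])
        (simp only: f_def h_def bilinear idem orth orth' xy coords, simp add: algebra_simps)
    have 3: "(b - c * \<i>) *s e3 + ((d * \<i> / 2) *s x + (g * \<i> / 2) *s y) = 0"
      by (rule vec_lin1[OF act[of e3]])
        (simp only: f_def h_def bilinear idem orth orth' xy coords, simp add: algebra_simps)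
    have "e3 \<cdot> ((b + c * \<i>) *s e2 + ((d * \<i> / 2) *s x + (g * \<i> / 2) *s y)) = 0"
      unfolding 2 by simp
    then have "(d * \<i> / 4) *s x + (g * \<i> / 4) *s y = 0"
      by (simp add: bilinear orth' xy)
    then have "d = 0" "g = 0"
      using indep_xy unfolding indep2_def by fastforce+
    then have "b + c * \<i> = 0" "b - c * \<i> = 0"
      using 2 3 nz by (metis add.right_neutral div_0 mult_zero_left vector_mul_eq_0 vector_smult_lzero)+
    then have "b = 0" "c * \<i> = 0"
      by algebra+
    then show "a = 0 \<and> b = 0 \<and> c = 0 \<and> d = 0 \<and> g = 0"
      using \<open>a = 0\<close> \<open>d = 0\<close> \<open>g = 0\<close> by simp
  qed
  consider "x \<cdot> x = 0" "y \<cdot> y = 0" | "x \<cdot> x = f" "y \<cdot> y = 0" | "x \<cdot> x = f" "y \<cdot> y = f"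
    using squares by blast
  then show ?thesis
  proof cases
    case 1
    then have "is_J5 14"
      unfolding J5_mult_def using fh f(1,2) xy(1,2) xy0 idem(1)
      by (intro isomorphic_J5I[OF indep]) (simp_all add: table_simps bilinear)
    then show ?thesis
      by blast
  next
    case 2
    then have "is_J5 15"
      unfolding J5_mult_def using fh f(1,2) xy(1,2) xy0 idem(1)
      by (intro isomorphic_J5I[OF indep]) (simp_all add: table_simps bilinear)
    then show ?thesis
      by blast
  next
    case 3
    then have "is_J5 16"
      unfolding J5_mult_def using fh f(1,2) xy(1,2) xy0 idem(1)
      by (intro isomorphic_J5I[OF indep]) (simp_all add: table_simps bilinear)
    then show ?thesis
      by blast
  qed
qed

lemma idempotent_triple_classification:
  assumes e: "idempotent_triple e1 e2 e3"
  shows "\<exists>k\<in>{13, 14, 15, 16}. is_J5 k"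
proof -
  have perm: "idempotent_triple e2 e1 e3" "idempotent_triple e3 e1 e2"
    using e idempotent_triple_perm by blast+
  define pair where "pair e e' e'' \<longleftrightarrow> (\<exists>x. x \<noteq> 0 \<and> e \<cdot> x = (1/2) *s x \<and> e' \<cdot> x = (1/2) *s x \<and> e'' \<cdot> x = 0)"
    for e e' e''
  have half: "pair c1 c2 c3 \<or> pair c1 c3 c2" if c: "idempotent_triple c1 c2 c3"
    and x: "x \<noteq> 0" "c1 \<cdot> x = (1/2) *s x" for c1 c2 c3 x
  proof (rule ccontr)
    assume no: "\<not> ?thesis"
    obtain a b c x12 x13 x23 where d: "x = a *s c1 + b *s c2 + c *s c3 + x12 + x13 + x23"
      "c1 \<cdot> x12 = (1/2) *s x12" "c2 \<cdot> x12 = (1/2) *s x12" "c3 \<cdot> x12 = 0"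
      "c1 \<cdot> x13 = (1/2) *s x13" "c2 \<cdot> x13 = 0" "c3 \<cdot> x13 = (1/2) *s x13"
      "c1 \<cdot> x23 = 0" "c2 \<cdot> x23 = (1/2) *s x23" "c3 \<cdot> x23 = (1/2) *s x23"
      by (rule peirce_pair_decomposition[OF c, of x]) (rule that)
    have "x12 = 0"
      using no d(2-4) unfolding pair_def by blast
    have "x13 = 0"
      using no d(5-7) unfolding pair_def by blast
    have cc: "c1 \<cdot> c1 = c1" "c1 \<cdot> c2 = 0" "c1 \<cdot> c3 = 0" "c1 \<noteq> 0"
      using c by (auto simp: idempotent_triple_def idempotent_def)
    have "c1 \<cdot> x = a *s c1"
      by (subst d(1)) (simp add: bilinear cc d(2-) \<open>x12 = 0\<close> \<open>x13 = 0\<close>)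
    then have "c1 \<cdot> (c1 \<cdot> x) = c1 \<cdot> x"
      by (simp add: scale_right cc)
    then have "(1/4) *s x = (1/2) *s x"
      by (simp add: x scale_right)
    then have "(1/4) *s x = 0"
      by (rule vec_lin1) (simp only: coords, algebra)
    then show False
      using x(1) by simp
  qed
  show ?thesis
  proof (cases "(\<exists>x. x \<noteq> 0 \<and> e1 \<cdot> x = (1/2) *s x) \<and> (\<exists>x. x \<noteq> 0 \<and> e2 \<cdot> x = (1/2) *s x) \<and>
      (\<exists>x. x \<noteq> 0 \<and> e3 \<cdot> x = (1/2) *s x)")
    case False
    then have "\<exists>k\<in>{14, 15, 16}. is_J5 k"
      using isomorphic_J5_14_16[OF e] isomorphic_J5_14_16[OF perm(1)] isomorphic_J5_14_16[OF perm(2)] by blast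
    then show ?thesis
      by blast
  next
    case True
    have "pair e1 e2 e3 \<or> pair e1 e3 e2" "pair e2 e1 e3 \<or> pair e2 e3 e1" "pair e3 e1 e2 \<or> pair e3 e2 e1"
      using True half[OF e] half[OF perm(1)] half[OF perm(2)] by blast+
    \<comment> \<open>Each of the three indices belongs to a nonzero joint 1/2-space. Covering three
      vertices by edges needs two edges, and these share a vertex.\<close>
    then consider "pair e1 e2 e3" "pair e1 e3 e2" | "pair e2 e1 e3" "pair e2 e3 e1" | "pair e3 e1 e2" "pair e3 e2 e1"
      unfolding pair_def by blast
    then have "is_J5 13"
    proof cases
      case 1
      then show ?thesis
        using isomorphic_J5_13[OF e] unfolding pair_def by blast
    next
      case 2
      then show ?thesis
        using isomorphic_J5_13[OF perm(1)] unfolding pair_def by blast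
    next
      case 3
      then show ?thesis
        using isomorphic_J5_13[OF perm(2)] unfolding pair_def by blast
    qed
    then show ?thesis
      by blast
  qed
qed

end

section \<open>No three orthogonal idempotents\<close>

context rank3_algebra
begin

lemma nil_square_cube:
  assumes "x \<cdot> x = 0"
  shows "x \<cdot> (x \<cdot> (x \<cdot> w)) = 0"
  using jordan_linearized_square[of x w x] assms by (simp add: commute[of w x] commute[of "x \<cdot> w" x])

lemma peirce_one_nilpotent_part:
  assumes no: "\<And>e1 e2 e3. \<not> idempotent_triple e1 e2 e3" and c: "idempotent c" "c \<noteq> \<one>" and x: "c \<cdot> x = x"
  obtains l n where "x = l *s c + n" "c \<cdot> n = n" "n \<cdot> n = 0"
proof -
  obtain l where l: "(x - l *s c) \<cdot> (x - l *s c) = 0"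
    using peirce_one_split[OF c x] idempotent_triple_if_splits[OF c] no by blast
  show ?thesis
    by (rule that[of l "x - l *s c"]) (use l c x in \<open>simp_all add: idempotent_def bilinear\<close>)
qed

end

text \<open>The last assumption is reached by exchanging \<open>c\<close> and 1 - c if necessary:
  nonzero elements of square zero cannot occur on both sides.\<close>

locale rank3_peirce = rank3_algebra +
  fixes c
  assumes no_triple: "\<not> idempotent_triple e1 e2 e3"
    and idem: "idempotent c" and c_one: "c \<noteq> \<one>" and c_zero: "c \<noteq> 0"
    and peirce_zero: "c \<cdot> y = 0 \<Longrightarrow> \<exists>l. y = l *s (\<one> - c)"
begin

definition f where "f = \<one> - c"

definition nil1 where "nil1 n \<longleftrightarrow> c \<cdot> n = n \<and> n \<cdot> n = 0"

definition half where "half u \<longleftrightarrow> c \<cdot> u = (1/2) *s u"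

lemma f: "f \<cdot> f = f" "c \<cdot> f = 0" "f \<cdot> c = 0" "f \<noteq> 0" "c + f = \<one>" and cc: "c \<cdot> c = c"
  using idem c_one by (simp_all add: f_def idempotent_def bilinear)

lemma nil1_act: "nil1 n \<Longrightarrow> c \<cdot> n = n" "nil1 n \<Longrightarrow> n \<cdot> c = n" "nil1 n \<Longrightarrow> f \<cdot> n = 0"
  "nil1 n \<Longrightarrow> n \<cdot> f = 0" "nil1 n \<Longrightarrow> n \<cdot> n = 0"
  by (simp_all add: nil1_def f_def bilinear commute[of n c])

lemma half_act: "half u \<Longrightarrow> c \<cdot> u = (1/2) *s u" "half u \<Longrightarrow> u \<cdot> c = (1/2) *s u"
  "half u \<Longrightarrow> f \<cdot> u = (1/2) *s u" "half u \<Longrightarrow> u \<cdot> f = (1/2) *s u"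
  by (simp_all add: half_def f_def bilinear commute[of u c] vec_eq_iff)

lemma half_comb: "half u \<Longrightarrow> half w \<Longrightarrow> half (p *s u + q *s w)"
  by (simp add: half_def bilinear mult.commute)

text \<open>The sum x + y is l c + n with n^2 = 0. If l = 0, squaring gives the claim; otherwise
  multiplying the squared equation by \<open>x\<close> and by \<open>y\<close> shows x = y.\<close>

lemma nil1_mult_zero:
  assumes x: "nil1 x" and y: "nil1 y"
  shows "x \<cdot> y = 0"
proof -
  have "c \<cdot> (x + y) = x + y"
    using assms by (simp add: nil1_act bilinear)
  then obtain l n where n: "x + y = l *s c + n" "n \<cdot> n = 0"
    using peirce_one_nilpotent_part[OF no_triple idem c_one] by blast
  have "(x + y - l *s c) \<cdot> (x + y - l *s c) = 0"
    using n by simp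
  then have eq: "2 *s (x \<cdot> y) - (2 * l) *s x - (2 * l) *s y + l^2 *s c = 0"
    using assms by (simp add: bilinear nil1_act cc commute[of y x] power2_eq_square vec_eq_iff algebra_simps)
  define w where "w = x \<cdot> y"
  have act: "v \<cdot> (2 *s w - (2 * l) *s x - (2 * l) *s y + l^2 *s c) = 0" for v
    using eq unfolding w_def by simp
  have xw: "2 *s (x \<cdot> w) - (2 * l) *s w + l^2 *s x = 0"
    using act[of x] x by (simp add: bilinear nil1_act w_def[symmetric])
  have yw: "2 *s (y \<cdot> w) - (2 * l) *s w + l^2 *s y = 0"
    using act[of y] y by (simp add: bilinear nil1_act commute[of y x] w_def[symmetric])
  have xxw: "x \<cdot> (x \<cdot> w) = 0" "y \<cdot> (y \<cdot> w) = 0"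
    using nil_square_cube[of x y] nil_square_cube[of y x] assms by (simp_all add: w_def nil1_act commute[of y x])
  have "x \<cdot> (2 *s (x \<cdot> w) - (2 * l) *s w + l^2 *s x) = 0" "y \<cdot> (2 *s (y \<cdot> w) - (2 * l) *s w + l^2 *s y) = 0"
    unfolding xw yw by simp_all
  then have "l *s (x \<cdot> w) = 0" "l *s (y \<cdot> w) = 0"
    using xxw x y by (simp_all add: bilinear nil1_act)
  show ?thesis
  proof (cases "l = 0")
    case True
    then show ?thesis
      using eq by simp
  next
    case False
    then have "x \<cdot> w = 0" "y \<cdot> w = 0"
      using \<open>l *s (x \<cdot> w) = 0\<close> \<open>l *s (y \<cdot> w) = 0\<close> by simp_all
    have "l^2 *s (x - y) = 0"
      by (rule vec_lin2[OF xw[unfolded \<open>x \<cdot> w = 0\<close>] yw[unfolded \<open>y \<cdot> w = 0\<close>]]) (simp only: coords, algebra)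
    then have "x = y"
      using False by simp
    then show ?thesis
      using x by (simp add: nil1_act)
  qed
qed

lemma nil1_comb: "nil1 x \<Longrightarrow> nil1 y \<Longrightarrow> nil1 (p *s x + q *s y)"
  using nil1_mult_zero[of x y] nil1_mult_zero[of y x] by (simp add: nil1_def bilinear)

lemma nil1_scale: "nil1 x \<Longrightarrow> nil1 (p *s x)"
  by (simp add: nil1_def bilinear)

lemma nil1_half_mult: "nil1 n \<Longrightarrow> half u \<Longrightarrow> half (n \<cdot> u)"
  using peirce_product[OF idem, of n 1 u "1/2"] by (simp add: nil1_def half_def)

lemma nil1_nil1_half: "nil1 n \<Longrightarrow> half u \<Longrightarrow> n \<cdot> (n \<cdot> u) = 0"
  using peirce_square_act[OF idem, of n 1 u] by (simp add: nil1_def half_def)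

lemma decomposition:
  obtains p q n u where "v = p *s c + q *s f + n + u" "nil1 n" "half u"
proof -
  obtain v1 u v0 where v: "v = v1 + u + v0" "c \<cdot> v1 = v1" "c \<cdot> u = (1/2) *s u" "c \<cdot> v0 = 0"
    using peirce_decomposition[OF idem, of v] by blast
  obtain p n where "v1 = p *s c + n" "c \<cdot> n = n" "n \<cdot> n = 0"
    using peirce_one_nilpotent_part[OF no_triple idem c_one v(2)] by blast
  moreover obtain q where "v0 = q *s f"
    using peirce_zero[OF v(4)] unfolding f_def by blast
  ultimately show ?thesis
    using that[of p q n u] v by (simp add: nil1_def half_def)
qed

text \<open>Multiplying by \<open>f\<close> twice separates the eigenvalues 1 and 1/2 of
  \<open>f\<close>; multiplying by \<open>n\<close> separates \<open>n\<close> from the multiple of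
  \<open>c\<close>.\<close>

lemma parts_zero:
  assumes eq: "p *s c + q *s f + n + u = 0" and n: "nil1 n" and u: "half u"
  shows "p = 0 \<and> q = 0 \<and> n = 0 \<and> u = 0"
proof -
  have "f \<cdot> (p *s c + q *s f + n + u) = 0"
    unfolding eq by simp
  then have 1: "q *s f + (1/2) *s u = 0"
    using n u by (simp add: bilinear f cc nil1_act half_act)
  then have "f \<cdot> (q *s f + (1/2) *s u) = 0"
    by simp
  then have 2: "q *s f + (1/4) *s u = 0"
    using u by (simp add: bilinear f half_act)
  have "u = 0"
    by (rule vec_lin2[OF 1 2]) (simp only: coords, algebra)
  have "q = 0"
    using 1 \<open>u = 0\<close> f by simp
  have pn: "p *s c + n = 0"
    using eq \<open>u = 0\<close> \<open>q = 0\<close> by simp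
  then have "n \<cdot> (p *s c + n) = 0"
    by simp
  then have "p *s n = 0"
    using n by (simp add: bilinear nil1_act)
  then have "p = 0"
    using pn c_zero by auto
  then show ?thesis
    using pn \<open>u = 0\<close> \<open>q = 0\<close> by simp
qed

lemma parts_unique:
  assumes eq: "p *s c + q *s f + n + u = p' *s c + q' *s f + n' + u'" and "nil1 n" "half u" "nil1 n'" "half u'"
  shows "p = p' \<and> q = q' \<and> n = n' \<and> u = u'"
proof -
  have "(p - p') *s c + (q - q') *s f + (1 *s n + (-1) *s n') + (1 *s u + (-1) *s u') = 0"
    by (rule vec_lin1[OF eq]) (simp only: coords, algebra)
  then show ?thesis
    using parts_zero[OF _ nil1_comb[OF assms(2,4)] half_comb[OF assms(3,5)]] by fastforce
qed

lemma nil1_zero: "nil1 0" and half_zero: "half 0"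
  by (simp_all add: nil1_def half_def)

lemma half_mult:
  assumes "half u" "half w"
  obtains p q n where "u \<cdot> w = p *s c + q *s f + n" "nil1 n"
proof -
  obtain p q n v where uw: "u \<cdot> w = p *s c + q *s f + n + v" and n: "nil1 n" and v: "half v"
    by (rule decomposition[of "u \<cdot> w"]) (rule that)
  have *: "c \<cdot> (c \<cdot> (u \<cdot> w)) = c \<cdot> (u \<cdot> w)"
    using peirce_product_half[OF idem] assms unfolding half_def by blast
  have "(1/4) *s v = 0"
    by (rule vec_lin1[OF *])
      (simp only: uw bilinear cc f nil1_act[OF n] half_act[OF v] coords, simp)
  then show ?thesis
    using that uw n by simp
qed

text \<open>The Jordan identity at \<open>u\<close> and \<open>c\<close> makes \<open>u\<close> an
  eigenvector of \<open>n\<close> with eigenvalue (q - p) / 2. As \<open>n\<close> acts with square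
  zero on the 1/2-space, p = q.\<close>

lemma half_square:
  assumes u: "half u"
  obtains p n where "u \<cdot> u = p *s \<one> + n" "nil1 n" "n \<cdot> u = 0"
proof (cases "u = 0")
  case True
  then show ?thesis
    using that[of 0 0] nil1_zero by simp
next
  case False
  obtain p q n where uu: "u \<cdot> u = p *s c + q *s f + n" and n: "nil1 n"
    by (rule half_mult[OF u u]) (rule that)
  have "(u \<cdot> u) \<cdot> (u \<cdot> c) = u \<cdot> ((u \<cdot> u) \<cdot> c)"
    by (rule jordan)
  then have eq: "(1/4 * p) *s u + (1/4 * q) *s u + (1/2) *s (n \<cdot> u) = (1/2 * p) *s u + n \<cdot> u"
    using u n unfolding uu
    by (simp add: bilinear cc f nil1_act half_act commute[of u n])
  have nu: "n \<cdot> u = (1/2 * (q - p)) *s u"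
    by (rule vec_lin1[OF eq]) (simp only: coords, algebra)
  have "n \<cdot> (n \<cdot> u) = 0"
    by (rule nil1_nil1_half[OF n u])
  then have "(1/2 * (q - p) * (1/2 * (q - p))) *s u = 0"
    by (simp only: nu scale_right vector_smult_assoc)
  then have "1/2 * (q - p) * (1/2 * (q - p)) = 0"
    using False by (metis vector_mul_eq_0)
  then have "q = p"
    by simp
  show ?thesis
  proof (rule that[of p n])
    show "u \<cdot> u = p *s \<one> + n"
      unfolding uu \<open>q = p\<close> f_def by (simp add: vec_eq_iff algebra_simps)
    show "n \<cdot> u = 0"
      using nu \<open>q = p\<close> by simp
  qed (rule n)
qed

text \<open>Suppose u^2 has a nonzero scalar part \<alpha>. The nilpotent element \<open>a\<close>
  moves \<open>u\<close> to w = a u, and comparing the squares of u + w and u - w shows w = 0,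
  whereas u w has the component (\<alpha>/2) a.\<close>

lemma half_square_nil:
  assumes a: "nil1 a" "a \<noteq> 0" and u: "half u"
  shows "nil1 (u \<cdot> u) \<and> (u \<cdot> u) \<cdot> u = 0"
proof -
  obtain \<alpha> n where uu: "u \<cdot> u = \<alpha> *s \<one> + n" and n: "nil1 n" and nu: "n \<cdot> u = 0"
    by (rule half_square[OF u]) (rule that)
  have "\<alpha> = 0"
  proof (rule ccontr)
    assume "\<alpha> \<noteq> 0"
    have "(u \<cdot> u) \<cdot> (u \<cdot> u) = u \<cdot> ((u \<cdot> u) \<cdot> u)"
      by (rule jordan)
    then have eq: "\<alpha> *s (\<alpha> *s \<one> + n) + \<alpha> *s n = \<alpha> *s (\<alpha> *s \<one> + n)"
      unfolding uu using n nu uu by (simp add: bilinear nil1_act commute[of u n])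
    have "\<alpha> *s n = 0"
      by (rule vec_lin1[OF eq]) (simp only: coords, algebra)
    then have "n = 0"
      using \<open>\<alpha> \<noteq> 0\<close> by simp
    have uu: "u \<cdot> u = \<alpha> *s \<one>"
      using uu \<open>n = 0\<close> by simp
    define w where "w = a \<cdot> u"
    have w: "half w"
      unfolding w_def by (rule nil1_half_mult[OF a(1) u])
    have aw: "a \<cdot> w = 0"
      unfolding w_def by (rule nil1_nil1_half[OF a(1) u])
    \<comment> \<open>Here the terms u w cancel and c (u w) = (\<alpha>/2) a remains.\<close>
    have J: "(u \<cdot> c) \<cdot> (a \<cdot> u) + (c \<cdot> a) \<cdot> (u \<cdot> u) + (a \<cdot> u) \<cdot> (c \<cdot> u) =
        a \<cdot> ((u \<cdot> c) \<cdot> u) + u \<cdot> ((c \<cdot> a) \<cdot> u) + c \<cdot> ((a \<cdot> u) \<cdot> u)"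
      by (rule jordan_linearized)
    have cuw: "c \<cdot> (u \<cdot> w) = (1/2 * \<alpha>) *s a"
      by (rule vec_lin1[OF J])
        (simp only: half_act[OF u] nil1_act[OF a(1)] uu bilinear w_def[symmetric] commute[of w u] coords one_right,
          algebra)
    obtain p q m where uw: "u \<cdot> w = p *s c + q *s f + m" and m: "nil1 m"
      by (rule half_mult[OF u w]) (rule that)
    have "p *s c + 0 *s f + m + 0 = 0 *s c + 0 *s f + (1/2 * \<alpha>) *s a + 0"
      using cuw unfolding uw using m by (simp add: bilinear cc f nil1_act)
    from parts_unique[OF this m half_zero nil1_scale[OF a(1)] half_zero]
    have "p = 0" and m': "m = (1/2 * \<alpha>) *s a"
      by auto
    have uw: "u \<cdot> w = q *s f + (1/2 * \<alpha>) *s a"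
      using uw \<open>p = 0\<close> m' by simp
    obtain \<gamma> n' where ww: "w \<cdot> w = \<gamma> *s \<one> + n'" and n': "nil1 n'" and n'w: "n' \<cdot> w = 0"
      by (rule half_square[OF w]) (rule that)
    \<comment> \<open>By \<open>half_square\<close> the square of u + t w has equal coefficients at
      \<open>c\<close> and \<open>f\<close>, and its nilpotent part annihilates u + t w. The signs
      of \<open>t\<close> separate the even and odd terms.\<close>
    have key: "q = 0 \<and> t *s (\<alpha> *s w) + n' \<cdot> u = 0" if "t = 1 \<or> t = - 1" for t
    proof -
      have tt: "t * t = 1"
        using that by auto
      obtain \<delta> n'' where sq: "(1 *s u + t *s w) \<cdot> (1 *s u + t *s w) = \<delta> *s \<one> + n''"
        and n'': "nil1 n''" "n'' \<cdot> (1 *s u + t *s w) = 0"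
        by (rule half_square[OF half_comb[OF u w, of 1 t]]) (rule that)
      have "(\<alpha> + \<gamma>) *s c + (\<alpha> + \<gamma> + 2 * t * q) *s f + ((t * \<alpha>) *s a + 1 *s n') + 0 = \<delta> *s c + \<delta> *s f + n'' + 0"
      proof -
        have "(1 *s u + t *s w) \<cdot> (1 *s u + t *s w) = u \<cdot> u + (2 * t) *s (u \<cdot> w) + (t * t) *s (w \<cdot> w)"
          by (simp only: bilinear commute[of w u] vec_eq_iff coords) algebra
        then have sq': "\<alpha> *s \<one> + (2 * t) *s (q *s f + (1/2 * \<alpha>) *s a) + 1 *s (\<gamma> *s \<one> + n') = \<delta> *s \<one> + n''"
          using sq unfolding uu uw ww tt by (rule subst)
        show ?thesis
          by (rule vec_lin2[OF sq' f(5)]) (simp only: coords, algebra)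
      qed
      from parts_unique[OF this nil1_comb[OF a(1) n'] half_zero n''(1) half_zero]
      have "2 * t * q = 0" "n'' = (t * \<alpha>) *s a + n'"
        by auto
      moreover from this have "((t * \<alpha>) *s a + n') \<cdot> (1 *s u + t *s w) = 0"
        using n''(2) by simp
      then have "t *s (\<alpha> *s w) + n' \<cdot> u = 0"
        by (simp add: bilinear aw n'w w_def[symmetric])
      ultimately show ?thesis
        using that by auto
    qed
    have 1: "1 *s (\<alpha> *s w) + n' \<cdot> u = 0" and 2: "(-1) *s (\<alpha> *s w) + n' \<cdot> u = 0"
      using key[of 1] key[of "-1"] by auto
    have "\<alpha> *s w = 0"
      by (rule vec_lin2[OF 1 2]) (simp only: coords, algebra)
    then have "w = 0"
      using \<open>\<alpha> \<noteq> 0\<close> by simp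
    then have "(1/2 * \<alpha>) *s a = 0"
      using uw key[of 1] by simp
    then show False
      using \<open>\<alpha> \<noteq> 0\<close> a(2) by simp
  qed
  then show ?thesis
    using uu n nu by simp
qed

end

context rank3_peirce
begin

section \<open>Algebras 6 to 12\<close>

lemma nil1_exists: "\<exists>n. nil1 n \<and> n \<noteq> 0"
proof (rule ccontr)
  assume "\<not> ?thesis"
  then have no: "n = 0" if "nil1 n" for n
    using that by blast
  obtain v where v: "\<And>r s t. r *s \<one> + s *s v + t *s (v \<cdot> v) = 0 \<Longrightarrow> r = 0 \<and> s = 0 \<and> t = 0"
    using generic by blast
  obtain p q n u where vd: "v = p *s c + q *s f + n + u" and n: "nil1 n" and u: "half u"
    by (rule decomposition[of v]) (rule that)
  obtain r n' where uu: "u \<cdot> u = r *s \<one> + n'" and n': "nil1 n'" and "n' \<cdot> u = 0"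
    by (rule half_square[OF u]) (rule that)
  have vd: "v = p *s c + q *s f + u" and uu: "u \<cdot> u = r *s \<one>"
    using vd uu no[OF n] no[OF n'] by simp_all
  \<comment> \<open>Without nilpotent part, \<open>v\<close> behaves like a 2 x 2 matrix of trace p
    + q and determinant p q - r, and satisfies the corresponding quadratic equation.\<close>
  have "(p * q - r) *s \<one> + (- p - q) *s v + 1 *s (v \<cdot> v) = 0"
    by (rule vec_lin1[OF f(5)])
      (simp only: vd uu bilinear cc f(1-3) half_act[OF u] coords, drule sym, simp add: field_simps)
  then show False
    using v[of "p * q - r" "- p - q" 1] by simp
qed

lemma half_mult_nil1:
  assumes "half u" "half w"
  shows "nil1 (u \<cdot> w)"
proof -
  obtain a where a: "nil1 a" "a \<noteq> 0"
    using nil1_exists by blast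
  have sq: "nil1 (v \<cdot> v)" if "half v" for v
    using half_square_nil[OF a that] by simp
  have "half (1 *s u + 1 *s w)"
    by (rule half_comb[OF assms])
  then have "nil1 ((1/2) *s ((1 *s u + 1 *s w) \<cdot> (1 *s u + 1 *s w)) + (-1/2) *s (1 *s (u \<cdot> u) + 1 *s (w \<cdot> w)))"
    using sq assms by (intro nil1_comb) auto
  moreover have "(1/2) *s ((1 *s u + 1 *s w) \<cdot> (1 *s u + 1 *s w)) + (-1/2) *s (1 *s (u \<cdot> u) + 1 *s (w \<cdot> w)) = u \<cdot> w"
    by (simp add: bilinear commute[of w u] vec_eq_iff)
  ultimately show ?thesis
    by simp
qed

lemma indep5_one_two:
  assumes "nil1 a" "a \<noteq> 0" "half u" "half w" "indep2 u w"
  shows "indep5 c f a u w"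
  unfolding indep5_def
proof (intro allI impI)
  fix p q r s t assume eq: "p *s c + q *s f + r *s a + s *s u + t *s w = 0"
  then have "p *s c + q *s f + r *s a + (s *s u + t *s w) = 0"
    by (simp add: add.assoc)
  from parts_zero[OF this nil1_scale[OF assms(1)] half_comb[OF assms(3,4)]]
  show "p = 0 \<and> q = 0 \<and> r = 0 \<and> s = 0 \<and> t = 0"
    using assms(2,5) unfolding indep2_def by auto
qed

lemma indep5_two_one:
  assumes "nil1 a" "nil1 b" "indep2 a b" "half u" "u \<noteq> 0"
  shows "indep5 c f a b u"
  unfolding indep5_def
proof (intro allI impI)
  fix p q r s t assume eq: "p *s c + q *s f + r *s a + s *s b + t *s u = 0"
  then have "p *s c + q *s f + (r *s a + s *s b) + (t *s u + 0 *s u) = 0"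
    by (simp add: add.assoc)
  from parts_zero[OF this nil1_comb[OF assms(1,2)] half_comb[OF assms(4,4)]]
  show "p = 0 \<and> q = 0 \<and> r = 0 \<and> s = 0 \<and> t = 0"
    using assms(3,5) unfolding indep2_def by auto
qed

lemma nil1_multiple:
  assumes "nil1 a" "a \<noteq> 0" "half u" "half w" "indep2 u w" "nil1 n"
  shows "\<exists>k. n = k *s a"
proof -
  obtain p q r s t where n: "n = p *s c + q *s f + r *s a + s *s u + t *s w"
    using indep5_span[OF indep5_one_two[OF assms(1-5)], of n] by blast
  have "0 *s c + 0 *s f + n + 0 = p *s c + q *s f + r *s a + (s *s u + t *s w)"
    unfolding n by (simp add: add.assoc)
  from parts_unique[OF this assms(6) half_zero nil1_scale[OF assms(1)] half_comb[OF assms(3,4)]]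
  show ?thesis
    by blast
qed

text \<open>With d = a b the five basis vectors are found, and the nilpotent part is the line of
  \<open>a\<close>. If a u = d, then u^2 = k a, and u^2 u = 0 yields k d = 0, hence u^2 = 0.\<close>

lemma isomorphic_J5_9:
  assumes a: "nil1 a" and b: "half b" and ab: "a \<cdot> b \<noteq> 0"
  shows "is_J5 9"
proof -
  have a_nz: "a \<noteq> 0"
    using ab by auto
  define d where "d = a \<cdot> b"
  have d: "half d" "a \<cdot> d = 0" "d \<noteq> 0"
    unfolding d_def using nil1_half_mult[OF a b] nil1_nil1_half[OF a b] ab by auto
  have bd: "indep2 b d"
    unfolding indep2_def
  proof (intro allI impI)
    fix s t assume eq: "s *s b + t *s d = 0"
    have "a \<cdot> (s *s b + t *s d) = 0"
      unfolding eq by simp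
    then have "s *s d = 0"
      by (simp add: bilinear d d_def[symmetric])
    then show "s = 0 \<and> t = 0"
      using d(3) eq by simp
  qed
  have square: "u \<cdot> u = 0" if u: "half u" "a \<cdot> u = d" for u
  proof -
    have sq: "nil1 (u \<cdot> u)" "(u \<cdot> u) \<cdot> u = 0"
      using half_square_nil[OF a a_nz u(1)] by auto
    obtain k where k: "u \<cdot> u = k *s a"
      using nil1_multiple[OF a a_nz b d(1) bd sq(1)] by blast
    then have "k *s d = 0"
      using sq(2) u(2) by (simp add: scale_left)
    then show ?thesis
      using k d(3) by simp
  qed
  have bb: "b \<cdot> b = 0"
    by (rule square[OF b]) (simp add: d_def)
  \<comment> \<open>Because a d = 0, both b + d and b - d are sent to \<open>d\<close> by
    \<open>a\<close>, so their squares vanish as well.\<close>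
  have "(1 *s b + 1 *s d) \<cdot> (1 *s b + 1 *s d) = 0" "(1 *s b + (-1) *s d) \<cdot> (1 *s b + (-1) *s d) = 0"
    by (rule square[OF half_comb[OF b d(1)]], simp add: bilinear d d_def[symmetric])+
  then have 1: "2 *s (b \<cdot> d) + d \<cdot> d = 0" and 2: "- (2 *s (b \<cdot> d)) + d \<cdot> d = 0"
    by (simp_all add: bilinear bb commute[of d b] vec_eq_iff algebra_simps)
  have bd0: "b \<cdot> d = 0" and dd: "d \<cdot> d = 0"
    by (rule vec_lin2[OF 1 2], simp only: coords, algebra)+
  show ?thesis
    unfolding J5_mult_def
    using indep5_one_two[OF a a_nz b d(1) bd] d_def bb bd0 dd d(2) cc f nil1_act[OF a] half_act[OF b] half_act[OF d(1)]
    by (intro isomorphic_J5I[of c f a b d]) (simp_all add: table_simps)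
qed

lemma isomorphic_J5_6_8:
  assumes a: "nil1 a" "a \<noteq> 0" and uw: "half u" "half w" "indep2 u w"
    and zero: "\<And>n u. nil1 n \<Longrightarrow> half u \<Longrightarrow> n \<cdot> u = 0"
  shows "\<exists>k\<in>{6, 7, 8}. is_J5 k"
proof -
  obtain \<alpha> \<beta> \<gamma> where uu: "u \<cdot> u = \<alpha> *s a" and uw': "u \<cdot> w = \<beta> *s a" and ww: "w \<cdot> w = \<gamma> *s a"
    using nil1_multiple[OF a uw half_mult_nil1] uw by metis
  obtain p q r s x y where x_def: "x = p *s u + q *s w" and y_def: "y = r *s u + s *s w"
    and det: "p * s - q * r \<noteq> 0" and xy0: "x \<cdot> y = 0"
    and squares: "x \<cdot> x = 0 \<and> y \<cdot> y = 0 \<or> x \<cdot> x = a \<and> y \<cdot> y = 0 \<or> x \<cdot> x = a \<and> y \<cdot> y = a"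
    by (rule diagonal_pair[OF uu uw' ww]) (rule that)
  have xy: "half x" "half y"
    unfolding x_def y_def using half_comb uw by auto
  have "indep2 x y"
    unfolding x_def y_def by (rule indep2_comb[OF uw(3) det])
  note indep = indep5_one_two[OF a xy this]
  consider "x \<cdot> x = 0" "y \<cdot> y = 0" | "x \<cdot> x = a" "y \<cdot> y = 0" | "x \<cdot> x = a" "y \<cdot> y = a"
    using squares by blast
  then show ?thesis
  proof cases
    case 1
    then have "is_J5 6"
      unfolding J5_mult_def using xy0 cc f nil1_act[OF a(1)] half_act[OF xy(1)] half_act[OF xy(2)] zero[OF a(1)] xy
      by (intro isomorphic_J5I[OF indep]) (simp_all add: table_simps)
    then show ?thesis
      by blast
  next
    case 2
    then have "is_J5 7"
      unfolding J5_mult_def using xy0 cc f nil1_act[OF a(1)] half_act[OF xy(1)] half_act[OF xy(2)] zero[OF a(1)] xy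
      by (intro isomorphic_J5I[OF indep]) (simp_all add: table_simps)
    then show ?thesis
      by blast
  next
    case 3
    then have "is_J5 8"
      unfolding J5_mult_def using xy0 cc f nil1_act[OF a(1)] half_act[OF xy(1)] half_act[OF xy(2)] zero[OF a(1)] xy
      by (intro isomorphic_J5I[OF indep]) (simp_all add: table_simps)
    then show ?thesis
      by blast
  qed
qed

lemma isomorphic_J5_10_11:
  assumes ab: "nil1 a" "nil1 b" "indep2 a b" and u: "half u" "u \<noteq> 0"
    and zero: "\<And>n u. nil1 n \<Longrightarrow> half u \<Longrightarrow> n \<cdot> u = 0"
  shows "\<exists>k\<in>{10, 11}. is_J5 k"
proof (cases "u \<cdot> u = 0")
  case True
  have "is_J5 10"
    unfolding J5_mult_def
    using True indep5_two_one[OF ab u] cc f nil1_act[OF ab(1)] nil1_act[OF ab(2)] nil1_mult_zero[OF ab(1,2)]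
      half_act[OF u(1)] zero[OF ab(1) u(1)] zero[OF ab(2) u(1)]
    by (intro isomorphic_J5I[of c f a b u]) (simp_all add: table_simps)
  then show ?thesis
    by blast
next
  case False
  define n where "n = u \<cdot> u"
  have n: "nil1 n" "n \<noteq> 0"
    using half_mult_nil1[OF u(1) u(1)] False by (simp_all add: n_def)
  \<comment> \<open>A new basis of the nilpotent part is needed, in which u^2 takes the place of
    \<open>a\<close>.\<close>
  have "\<exists>b'. nil1 b' \<and> indep2 n b'"
  proof (cases "\<exists>k. a = k *s n")
    case True
    then obtain k where k: "a = k *s n"
      by blast
    have "b \<noteq> l *s n" for l
    proof
      assume "b = l *s n"
      then have "l *s a + (- k) *s b = 0"
        by (simp add: k mult.commute)
      then have "l = 0 \<and> - k = 0"
        using ab(3) unfolding indep2_def by blast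
      then have "1 *s a + 1 *s b = 0"
        using k \<open>b = l *s n\<close> by simp
      then show False
        using ab(3) unfolding indep2_def by (metis one_neq_zero)
    qed
    then show ?thesis
      using indep2I[OF n(2)] ab(2) by blast
  next
    case False
    then show ?thesis
      using indep2I[OF n(2)] ab(1) by blast
  qed
  then obtain b' where b': "nil1 b'" "indep2 n b'"
    by blast
  have "is_J5 11"
    unfolding J5_mult_def
    using n_def indep5_two_one[OF n(1) b' u] cc f nil1_act[OF n(1)] nil1_act[OF b'(1)] nil1_mult_zero[OF n(1) b'(1)]
      half_act[OF u(1)] zero[OF n(1) u(1)] zero[OF b'(1) u(1)]
    by (intro isomorphic_J5I[of c f n b' u]) (simp_all add: table_simps)
  then show ?thesis
    by blast
qed

lemma isomorphic_J5_12:
  assumes H: "\<And>u. half u \<Longrightarrow> u = 0"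
  shows "is_J5 12"
proof -
  have decomp: "\<exists>p q n. v = p *s c + q *s f + n \<and> nil1 n" for v
  proof -
    obtain p q n u where "v = p *s c + q *s f + n + u" "nil1 n" "half u"
      by (rule decomposition[of v]) (rule that)
    then show ?thesis
      using H[of u] by auto
  qed
  have new: "\<exists>n. nil1 n \<and> (\<forall>s t. n \<noteq> s *s x + t *s y)" for x y
  proof -
    obtain v where v: "\<forall>p q s t. v \<noteq> p *s c + q *s f + s *s x + t *s y"
      using not_spanned_by_four by blast
    obtain p q n where n: "v = p *s c + q *s f + n" "nil1 n"
      using decomp by blast
    have "n \<noteq> s *s x + t *s y" for s t
      using v n(1) by (metis add.assoc)
    then show ?thesis
      using n(2) by blast
  qed
  obtain a where a: "nil1 a" "\<forall>s t. a \<noteq> s *s 0 + t *s 0"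
    using new by blast
  obtain b where b: "nil1 b" "\<forall>s t. b \<noteq> s *s a + t *s 0"
    using new by blast
  obtain d where d: "nil1 d" "\<forall>s t. d \<noteq> s *s a + t *s b"
    using new by blast
  have ab: "indep2 a b"
    by (rule indep2I) (use a b in auto)
  have "indep5 c f a b d"
    unfolding indep5_def
  proof (intro allI impI)
    fix p q r s t assume eq: "p *s c + q *s f + r *s a + s *s b + t *s d = 0"
    then have "p *s c + q *s f + (1 *s (r *s a + s *s b) + t *s d) + 0 = 0"
      by (simp add: add.assoc)
    from parts_zero[OF this nil1_comb[OF nil1_comb[OF a(1) b(1)] d(1)] half_zero]
    have "p = 0" "q = 0" and abd: "r *s a + s *s b + t *s d = 0"
      by auto
    have "t = 0"
      by (rule coefficient_zero[OF abd]) (use d(2) in blast)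
    then show "p = 0 \<and> q = 0 \<and> r = 0 \<and> s = 0 \<and> t = 0"
      using \<open>p = 0\<close> \<open>q = 0\<close> abd ab unfolding indep2_def by auto
  qed
  then show ?thesis
    unfolding J5_mult_def
    using cc f nil1_act[OF a(1)] nil1_act[OF b(1)] nil1_act[OF d(1)] nil1_mult_zero[OF a(1) b(1)]
      nil1_mult_zero[OF a(1) d(1)] nil1_mult_zero[OF b(1) d(1)]
    by (intro isomorphic_J5I[of c f a b d]) (simp_all add: table_simps)
qed

lemma isomorphic_J5_6_12: "\<exists>k\<in>{6..12}. is_J5 k"
proof (cases "\<exists>n u. nil1 n \<and> half u \<and> n \<cdot> u \<noteq> 0")
  case True
  then have "is_J5 9"
    using isomorphic_J5_9 by blast
  then show ?thesis
    by (intro bexI[of _ 9]) auto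
next
  case False
  then have zero: "n \<cdot> u = 0" if "nil1 n" "half u" for n u
    using that by blast
  obtain a where a: "nil1 a" "a \<noteq> 0"
    using nil1_exists by blast
  show ?thesis
  proof (cases "\<exists>u. half u \<and> u \<noteq> 0")
    case True
    then obtain u where u: "half u" "u \<noteq> 0"
      by blast
    show ?thesis
    proof (cases "\<exists>w. half w \<and> (\<forall>k. w \<noteq> k *s u)")
      case True
      then obtain w where w: "half w" "\<And>k. w \<noteq> k *s u"
        by blast
      have "\<exists>k\<in>{6, 7, 8}. is_J5 k"
        by (rule isomorphic_J5_6_8[OF a u(1) w(1) indep2I[OF u(2) w(2)] zero])
      then show ?thesis
        by auto
    next
      case False
      obtain v where v: "\<forall>p q s t. v \<noteq> p *s c + q *s f + s *s a + t *s u"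
        using not_spanned_by_four by blast
      obtain p q b w where d: "v = p *s c + q *s f + b + w" "nil1 b" "half w"
        by (rule decomposition[of v]) (rule that)
      obtain k where "w = k *s u"
        using False d(3) by blast
      \<comment> \<open>As the 1/2-space is a line, dimension five forces a second direction in the
        nilpotent part.\<close>
      then have "b \<noteq> l *s a" for l
        using v d(1) by blast
      then have "\<exists>k\<in>{10, 11}. is_J5 k"
        by (intro isomorphic_J5_10_11[OF a(1) d(2) indep2I[OF a(2)] u zero])
      then show ?thesis
        by auto
    qed
  next
    case False
    then have "is_J5 12"
      by (intro isomorphic_J5_12) blast
    then show ?thesis
      by (intro bexI[of _ 12]) auto
  qed
qed

end

context rank3_algebra
begin

text \<open>If the 0-space of \<open>c\<close> contains a nonzero element of square zero,
  \<open>peirce_nil_one_or_zero\<close> excludes one in the 1-space, and 1 - c takes the role of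
  \<open>c\<close>.\<close>

lemma nontrivial_idempotent_classification:
  assumes no: "\<And>e1 e2 e3. \<not> idempotent_triple e1 e2 e3" and c: "idempotent c" "c \<noteq> 0" "c \<noteq> \<one>"
  shows "\<exists>k\<in>{6..12}. is_J5 k"
proof -
  have peirce: "rank3_peirce (\<cdot>) \<one> e"
    if e: "idempotent e" "e \<noteq> 0" "e \<noteq> \<one>" and N: "\<And>n. e \<cdot> n = 0 \<Longrightarrow> n \<cdot> n = 0 \<Longrightarrow> n = 0" for e
  proof unfold_locales
    fix y assume y: "e \<cdot> y = 0"
    let ?f = "\<one> - e"
    have f: "idempotent ?f" "?f \<noteq> \<one>" and "?f \<cdot> y = y"
      using e y by (simp_all add: idempotent_def bilinear)
    obtain l n where n: "y = l *s ?f + n" "?f \<cdot> n = n" "n \<cdot> n = 0"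
      by (rule peirce_one_nilpotent_part[OF no f \<open>?f \<cdot> y = y\<close>]) (rule that)
    have "e \<cdot> n = 0"
      using n(2) by (simp add: bilinear)
    then have "n = 0"
      using N n(3) by blast
    then show "\<exists>l. y = l *s ?f"
      using n(1) by auto
  qed (use no e in auto)
  show ?thesis
  proof (cases "\<forall>n. c \<cdot> n = 0 \<longrightarrow> n \<cdot> n = 0 \<longrightarrow> n = 0")
    case True
    then interpret rank3_peirce "(\<cdot>)" "\<one>" c
      by (intro peirce) (use c in auto)
    show ?thesis
      by (rule isomorphic_J5_6_12)
  next
    case False
    then obtain y where y: "c \<cdot> y = 0" "y \<cdot> y = 0" "y \<noteq> 0"
      by blast
    have "n = 0" if "(\<one> - c) \<cdot> n = 0" "n \<cdot> n = 0" for n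
      using peirce_nil_one_or_zero[OF c(1) _ that(2) y(1,2)] that(1) y(3) by (simp add: bilinear)
    then interpret rank3_peirce "(\<cdot>)" "\<one>" "\<one> - c"
      by (intro peirce) (use c in \<open>auto simp: idempotent_def bilinear\<close>)
    show ?thesis
      by (rule isomorphic_J5_6_12)
  qed
qed

end

section \<open>Algebras without nontrivial idempotents\<close>

lemma generalized_inverse_matrix:
  fixes A :: "complex ^ 'n ^ 'n"
  shows "\<exists>S. A ** S ** A = A"
proof -
  have lin: "Vector_Spaces.linear (*s) (*s) ((*v) A)"
    by (rule matrix_vector_mul_linear_gen)
  obtain g where g: "Vector_Spaces.linear (*s) (*s) g" "\<forall>v\<in>range ((*v) A). A *v g v = v"
    using vec.linear_exists_right_inverse_on[OF lin vec.subspace_UNIV] by blast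
  have "(A ** matrix g ** A) *v x = A *v x" for x
  proof -
    have "(A ** matrix g ** A) *v x = A *v (matrix g *v (A *v x))"
      by (simp add: matrix_vector_mul_assoc matrix_mul_assoc)
    also have "\<dots> = A *v x"
      using g by (simp add: matrix_works)
    finally show ?thesis .
  qed
  then show ?thesis
    using matrix_eq by blast
qed

text \<open>If \<open>A S A = A\<close> then \<open>A\<^sup>2 S\<close> has the same trace as \<open>A\<close> and a smaller nilpotency index.\<close>

lemma trace_nilpotent:
  fixes A :: "complex ^ 'n ^ 'n"
  assumes "\<And>v. (((*v) A) ^^ Suc k) v = 0"
  shows "trace A = 0"
  using assms
proof (induction k arbitrary: A)
  case 0
  then have "A *v v = 0 *v v" for v
    by simp
  then have "A = 0"
    using matrix_eq by blast
  then show ?case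
    by (simp add: trace_def)
next
  case (Suc k)
  obtain S where S: "A ** S ** A = A"
    using generalized_inverse_matrix by blast
  define T where "T = A ** A ** S"
  have AST: "A *v (S *v (A *v v)) = A *v v" for v
    using S by (simp add: matrix_vector_mul_assoc matrix_mul_assoc)
  have T: "T *v v = A *v (A *v (S *v v))" for v
    by (simp add: T_def matrix_vector_mul_assoc matrix_mul_assoc)
  have "(((*v) T) ^^ Suc j) v = (((*v) A) ^^ Suc (Suc j)) (S *v v)" for j v
    by (induction j) (simp_all add: T AST)
  then have "trace T = 0"
    using Suc by (intro Suc.IH) metis
  \<comment> \<open>By cyclicity the trace of A A S is that of A S A = A.\<close>
  moreover have "trace T = trace A"
    unfolding T_def matrix_mul_assoc[symmetric] using S by (metis trace_mul_sym matrix_mul_assoc)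
  ultimately show ?case
    by simp
qed

lemma complex_cubic_roots:
  fixes p q w :: complex
  obtains r s t where "r + s + t = p" "r * s + r * t + s * t = q" "r * s * t = w"
proof -
  have "\<not> constant (poly [:- w, q, - p, 1:])"
    by (simp add: constant_degree)
  then obtain t where "poly [:- w, q, - p, 1:] t = 0"
    using fundamental_theorem_of_algebra by blast
  then have t: "- w + q * t - p * t * t + t * t * t = 0"
    by (simp add: algebra_simps)
  obtain r s where rs: "r + s = p - t" "r * s = - (- q + t * (p - t))"
    using complex_quadratic_roots[of "p - t" "- q + t * (p - t)"] by blast
  show ?thesis
  proof (rule that[of r s t])
    show "r + s + t = p"
      using rs(1) by simp
    show "r * s + r * t + s * t = q"
      using rs by algebra
    show "r * s * t = w"
      using rs t by algebra
  qed
qed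

context rank3_algebra
begin

section \<open>The nil ideal of an algebra without nontrivial idempotents\<close>

lemma square_square: "(x \<cdot> x) \<cdot> (x \<cdot> x) = x \<cdot> (x \<cdot> (x \<cdot> x))"
  using jordan[of x x] by (simp add: commute[of "x \<cdot> x" x])

lemma one_nonzero: "\<one> \<noteq> 0"
proof
  assume "\<one> = 0"
  obtain x where "\<And>a b c. a *s \<one> + b *s x + c *s (x \<cdot> x) = 0 \<Longrightarrow> a = 0 \<and> b = 0 \<and> c = 0"
    using generic by blast
  from this[of 1 0 0] show False
    using \<open>\<one> = 0\<close> by simp
qed

text \<open>Let A and B be the multiplications by \<open>n\<close> and n^2. They commute, and
  linearization gives 3 A B = 2 A^3 and B^2 = 2 A^2 B. Hence A B^2 equals both 2 A^3 B and (2/3) A^3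
  B, so A^3 B = 0 and 2 A^5 = 3 A^3 B = 0.\<close>

lemma cube_zero_power5:
  assumes "n \<cdot> (n \<cdot> n) = 0"
  shows "n \<cdot> (n \<cdot> (n \<cdot> (n \<cdot> (n \<cdot> w)))) = 0"
proof -
  let ?A = "\<lambda>w. n \<cdot> w"
  let ?B = "\<lambda>w. (n \<cdot> n) \<cdot> w"
  have AB: "?B (?A w) = ?A (?B w)" for w
    by (rule jordan)
  have 1: "3 *s ?A (?B w) = 2 *s ?A (?A (?A w))" for w
    using jordan_linearized_square[of n w n] assms
    by (simp add: commute[of w n] commute[of "n \<cdot> w" n] commute[of "n \<cdot> w" "n \<cdot> n"] commute[of "n \<cdot> n" n] AB vec_eq_iff)
  have 2: "?B (?B w) = 2 *s ?A (?A (?B w))" for w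
    using jordan_linearized_square[of n w "n \<cdot> n"] assms square_square[of n]
    by (simp add: commute[of w "n \<cdot> n"] commute[of "n \<cdot> w" "n \<cdot> n"] AB)
  have 3: "3 *s ?A (?B (?B w)) = 2 *s ?A (?A (?A (?B w)))"
    by (rule 1)
  have 4: "?A (?B (?B w)) = 2 *s ?A (?A (?A (?B w)))"
    by (simp add: 2 scale_right)
  have 5: "?A (?A (?A (?B w))) = 0"
    by (rule vec_lin2[OF 3 4]) (simp only: coords, algebra)
  have 6: "3 *s ?A (?A (?A (?B w))) = 2 *s ?A (?A (?A (?A (?A w))))"
    using 1[of "?A (?A w)"] by (simp add: AB)
  show ?thesis
    using 6 5 by simp
qed

definition tr :: "complex ^ 5 \<Rightarrow> complex" where
  "tr x = trace (matrix (\<lambda>y. x \<cdot> y))"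

lemma tr_add: "tr (x + y) = tr x + tr y" and tr_scale: "tr (c *s x) = c * tr x" and tr_one: "tr \<one> = 5"
  by (simp_all add: tr_def trace_def matrix_def bilinear sum.distrib sum_distrib_left axis_def)

lemma tr_diff: "tr (x - y) = tr x - tr y"
  using tr_add[of "x - y" y] by simp

lemma tr_zero [simp]: "tr 0 = 0"
  using tr_scale[of 0 0] by simp

lemma tr_cube_zero:
  assumes "n \<cdot> (n \<cdot> n) = 0"
  shows "tr n = 0"
  unfolding tr_def
proof (rule trace_nilpotent[where k = 4])
  have lin: "Vector_Spaces.linear (*s) (*s) (\<lambda>y. n \<cdot> y)"
    by unfold_locales (simp_all add: bilinear)
  have "((*v) (matrix (\<lambda>y. n \<cdot> y))) = (\<lambda>y. n \<cdot> y)"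
    by (simp add: fun_eq_iff matrix_works[OF lin])
  then show "((*v) (matrix (\<lambda>y. n \<cdot> y)) ^^ Suc 4) v = 0" for v
    by (simp add: eval_nat_numeral cube_zero_power5[OF assms])
qed

end

locale local_rank3 = rank3_algebra +
  assumes trivial: "idempotent g \<Longrightarrow> g = 0 \<or> g = \<one>"
begin

lemma quadratic_nilpotent:
  assumes "x \<cdot> x = a *s \<one> + b *s x"
  shows "\<exists>l. (x - l *s \<one>) \<cdot> (x - l *s \<one>) = 0"
  using quadratic_split[of \<one> x a b] assms trivial by (simp add: idempotent_def) blast

text \<open>A triple root of the cubic relation gives the claim. A root different from the other two
  yields an idempotent; as that is trivial, \<open>x\<close> already satisfies a quadratic
  equation.\<close>

lemma nilpotent_part: "\<exists>l. (x - l *s \<one>) \<cdot> ((x - l *s \<one>) \<cdot> (x - l *s \<one>)) = 0"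
proof -
  have quadratic: ?thesis if "x \<cdot> x = a *s \<one> + b *s x" for a b
    using quadratic_nilpotent[OF that] zero_right by metis
  obtain a b g d where rel: "a *s \<one> + b *s x + g *s (x \<cdot> x) + d *s (x \<cdot> (x \<cdot> x)) = 0"
    and nz: "\<not> (a = 0 \<and> b = 0 \<and> g = 0 \<and> d = 0)"
    using relation by blast
  show ?thesis
  proof (cases "d = 0")
    case True
    show ?thesis
    proof (cases "g = 0")
      case True
      have "b \<noteq> 0"
        using rel nz \<open>d = 0\<close> True one_nonzero by auto
      have "b *s x = (- a) *s \<one>"
        by (rule vec_lin1[OF rel]) (simp only: \<open>d = 0\<close> True coords, algebra)
      then have "(1 / b) *s (b *s x) = (1 / b) *s ((- a) *s \<one>)"
        by (rule arg_cong)
      then have "x = (- a / b) *s \<one>"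
        using \<open>b \<noteq> 0\<close> by simp
      then show ?thesis
        by (intro exI[of _ "- a / b"]) simp
    next
      case False
      have "g *s (x \<cdot> x) = (- a) *s \<one> + (- b) *s x"
        by (rule vec_lin1[OF rel]) (simp only: \<open>d = 0\<close> coords, algebra)
      then have "(1 / g) *s (g *s (x \<cdot> x)) = (1 / g) *s ((- a) *s \<one> + (- b) *s x)"
        by (rule arg_cong)
      then have "x \<cdot> x = (1 / g * (- a)) *s \<one> + (1 / g * (- b)) *s x"
        using False by (simp only: vec.scale_right_distrib vector_smult_assoc) simp
      then show ?thesis
        by (rule quadratic)
    qed
  next
    case False
    have "d *s (x \<cdot> (x \<cdot> x)) = (- a) *s \<one> + (- b) *s x + (- g) *s (x \<cdot> x)"
      by (rule vec_lin1[OF rel]) (simp only: coords, algebra)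
    then have "(1 / d) *s (d *s (x \<cdot> (x \<cdot> x))) = (1 / d) *s ((- a) *s \<one> + (- b) *s x + (- g) *s (x \<cdot> x))"
      by (rule arg_cong)
    then have x3: "x \<cdot> (x \<cdot> x) = (1 / d * (- a)) *s \<one> + (1 / d * (- b)) *s x + (1 / d * (- g)) *s (x \<cdot> x)"
      using False by (simp only: vec.scale_right_distrib vector_smult_assoc) simp
    obtain r s t where rst: "r + s + t = 1 / d * (- g)" "r * s + r * t + s * t = - (1 / d * (- b))" "r * s * t = 1 / d * (- a)"
      using complex_cubic_roots .
    have x3: "x \<cdot> (x \<cdot> x) = (r * s * t) *s \<one> - (r * s + r * t + s * t) *s x + (r + s + t) *s (x \<cdot> x)"
      unfolding x3 rst by (simp add: vec_eq_iff)
    have split: ?thesis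
      if roots: "x \<cdot> (x \<cdot> x) = (r * s * t) *s \<one> - (r * s + r * t + s * t) *s x + (r + s + t) *s (x \<cdot> x)"
        and ne: "t \<noteq> r" "t \<noteq> s" for r s t
    proof -
      text \<open>Modulo the cubic, \<open>(x - r) (x - s)\<close> is a nonzero multiple of an idempotent.\<close>
      define \<kappa> where "\<kappa> = (t - r) * (t - s)"
      define h where "h = x \<cdot> x - (r + s) *s x + (r * s) *s \<one>"
      have \<kappa>: "\<kappa> \<noteq> 0"
        using ne by (simp add: \<kappa>_def)
      have hh: "h \<cdot> h = \<kappa> *s h"
        unfolding h_def \<kappa>_def
        by (simp only: bilinear square_square roots commute[of "x \<cdot> x" x] one_left one_right vec_eq_iff coords)
          algebra
      have "1 / \<kappa> * (1 / \<kappa> * \<kappa>) = 1 / \<kappa>"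
        using \<kappa> by simp
      then have "idempotent ((1 / \<kappa>) *s h)"
        unfolding idempotent_def scale_left scale_right hh vector_smult_assoc by simp
      then have "(1 / \<kappa>) *s h = 0 \<or> (1 / \<kappa>) *s h = \<one>"
        by (rule trivial)
      then have "\<exists>e. (1 / \<kappa>) *s h = e *s \<one>"
        by (metis vec.scale_one vec.scale_zero_left)
      then obtain e where e: "(1 / \<kappa>) *s h = e *s \<one>"
        by blast
      have "\<kappa> *s ((1 / \<kappa>) *s h) = \<kappa> *s (e *s \<one>)"
        unfolding e ..
      then have h: "h = (\<kappa> * e) *s \<one>"
        using \<kappa> by simp
      have "x \<cdot> x = (\<kappa> * e - r * s) *s \<one> + (r + s) *s x"
        by (rule vec_lin1[OF h]) (simp only: h_def coords, algebra)
      then show ?thesis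
        by (rule quadratic)
    qed
    show ?thesis
    proof (cases "r = s \<and> s = t")
      case True
      have "(x - r *s \<one>) \<cdot> ((x - r *s \<one>) \<cdot> (x - r *s \<one>)) = 0"
      proof -
        have st: "s = r" "t = r"
          using True by auto
        show ?thesis
          by (simp only: bilinear one_left one_right x3[unfolded st] vec_eq_iff coords) algebra
      qed
      then show ?thesis
        by blast
    next
      case False
      \<comment> \<open>Among three roots that are not all equal, one differs from both others; the
        cubic is symmetric, so it can be called \<open>t\<close>.\<close>
      then consider "t \<noteq> r" "t \<noteq> s" | "r \<noteq> s" "r \<noteq> t" | "s \<noteq> r" "s \<noteq> t"
        by blast
      then show ?thesis
      proof cases
        case 1
        then show ?thesis
          using split[OF x3] by blast
      next
        case 2
        then show ?thesis
          using split[of s t r] x3 by (simp add: ac_simps)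
      next
        case 3
        then show ?thesis
          using split[of r t s] x3 by (simp add: ac_simps)
      qed
    qed
  qed
qed

text \<open>Encoded by the trace, a linear condition, so that closure under sums is immediate;
  \<open>nil_cube\<close> recovers nilpotency.\<close>

definition nil :: "complex ^ 5 \<Rightarrow> bool" where
  "nil x \<longleftrightarrow> tr x = 0"

lemma nil_cube:
  assumes "nil x"
  shows "x \<cdot> (x \<cdot> x) = 0"
proof -
  obtain l where l: "(x - l *s \<one>) \<cdot> ((x - l *s \<one>) \<cdot> (x - l *s \<one>)) = 0"
    using nilpotent_part by blast
  have "tr (x - l *s \<one>) = 0"
    by (rule tr_cube_zero[OF l])
  then have "l = 0"
    using assms by (simp add: tr_diff tr_scale tr_one nil_def)
  then show ?thesis
    using l by simp
qed

lemma nil_add: "nil x \<Longrightarrow> nil y \<Longrightarrow> nil (x + y)" and nil_scale: "nil x \<Longrightarrow> nil (c *s x)"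
  by (simp_all add: nil_def tr_add tr_scale)

lemma decompose_nil: "\<exists>l n. x = l *s \<one> + n \<and> nil n"
  by (rule exI[of _ "tr x / 5"], rule exI[of _ "x - (tr x / 5) *s \<one>"])
    (simp add: nil_def tr_diff tr_scale tr_one)

text \<open>For nilpotent \<open>z\<close> already z^2 z^2 = z z^3 = 0, so z^2 has cube zero and
  trace zero; polarization extends this to products.\<close>

lemma nil_mult:
  assumes "nil x" "nil y"
  shows "nil (x \<cdot> y)"
proof -
  have sq: "tr (z \<cdot> z) = 0" if "nil z" for z
    using nil_cube[OF that] square_square[of z] by (intro tr_cube_zero) simp
  have "(x + y) \<cdot> (x + y) = x \<cdot> x + 2 *s (x \<cdot> y) + y \<cdot> y"
    by (simp add: bilinear commute[of y x] vec_eq_iff)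
  then show ?thesis
    using sq[OF nil_add[OF assms]] sq assms by (simp add: nil_def tr_add tr_scale)
qed

end

context local_rank3
begin

text \<open>The part of (x + t y)^3 = 0 that is linear in \<open>t\<close>, isolated by t = 1 and t
  = -1.\<close>

lemma nil_square_mult:
  assumes x: "nil x" and y: "nil y"
  shows "(x \<cdot> x) \<cdot> y = (-2) *s (x \<cdot> (x \<cdot> y))"
proof -
  have cube: "(x + t *s y) \<cdot> ((x + t *s y) \<cdot> (x + t *s y)) = 0" for t
    by (rule nil_cube[OF nil_add[OF x nil_scale[OF y]]])
  have expand: "(x + t *s y) \<cdot> ((x + t *s y) \<cdot> (x + t *s y)) =
      x \<cdot> (x \<cdot> x) + t *s ((x \<cdot> x) \<cdot> y + 2 *s (x \<cdot> (x \<cdot> y)))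
      + (t * t) *s ((y \<cdot> y) \<cdot> x + 2 *s (y \<cdot> (x \<cdot> y))) + (t * t * t) *s (y \<cdot> (y \<cdot> y))" for t
    by (simp only: bilinear commute[of y x] commute[of "x \<cdot> x" y] commute[of "y \<cdot> y" x] vec_eq_iff coords) algebra
  have 1: "1 *s ((x \<cdot> x) \<cdot> y + 2 *s (x \<cdot> (x \<cdot> y))) + (1 * 1) *s ((y \<cdot> y) \<cdot> x + 2 *s (y \<cdot> (x \<cdot> y))) = 0"
    using cube[of 1] unfolding expand nil_cube[OF x] nil_cube[OF y] by simp
  have 2: "(-1) *s ((x \<cdot> x) \<cdot> y + 2 *s (x \<cdot> (x \<cdot> y))) + ((-1) * (-1)) *s ((y \<cdot> y) \<cdot> x + 2 *s (y \<cdot> (x \<cdot> y))) = 0"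
    using cube[of "-1"] unfolding expand nil_cube[OF x] nil_cube[OF y] by simp
  show ?thesis
    by (rule vec_lin2[OF 1 2]) (simp only: coords, algebra)
qed

lemma nil_no_eigenvector:
  assumes "nil y" "y \<cdot> u = k *s u" "k \<noteq> 0"
  shows "u = 0"
proof -
  have "y \<cdot> (y \<cdot> (y \<cdot> (y \<cdot> (y \<cdot> u)))) = 0"
    by (rule cube_zero_power5[OF nil_cube[OF assms(1)]])
  then show ?thesis
    using assms(2,3) by (simp add: scale_right)
qed

lemma one_part_zero:
  assumes "p *s \<one> + n = 0" "nil n"
  shows "p = 0"
proof -
  have "tr (p *s \<one> + n) = 0"
    by (simp add: assms(1))
  then show ?thesis
    using assms(2) by (simp add: tr_add tr_scale tr_one nil_def)
qed

text \<open>Were u = x (x y) nonzero, dimension four of the nil ideal would make x^2 = c u. Then x^2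
  y = -2 u turns \<open>u\<close> into an eigenvector of the nilpotent multiplication by
  \<open>y\<close> with eigenvalue -2/c.\<close>

lemma nil_mult_twice:
  assumes x: "nil x" and y: "nil y"
  shows "x \<cdot> (x \<cdot> y) = 0"
proof (rule ccontr)
  define u where "u = x \<cdot> (x \<cdot> y)"
  assume "\<not> ?thesis"
  then have u: "u \<noteq> 0"
    by (simp add: u_def)
  have xy: "nil (x \<cdot> y)" "nil u" "nil (x \<cdot> x)"
    unfolding u_def using nil_mult x y by blast+
  have x2y: "(x \<cdot> x) \<cdot> y = (-2) *s u"
    unfolding u_def by (rule nil_square_mult[OF x y])
  have x3: "x \<cdot> (x \<cdot> x) = 0"
    by (rule nil_cube[OF x])
  text \<open>Polarizing \<open>a\<^sup>2 z = - 2 a (a z)\<close> at \<open>x, x\<^sup>2, y\<close> gives \<open>x (x\<^sup>2 y) = - x\<^sup>2 (x y)\<close>, and the Jordan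
    identity says that the two products are equal.\<close>
  have xu: "x \<cdot> u = 0"
  proof -
    have lin: "(a \<cdot> b) \<cdot> z + a \<cdot> (b \<cdot> z) + b \<cdot> (a \<cdot> z) = 0" if "nil a" "nil b" "nil z" for a b z
    proof -
      have 1: "((a + b) \<cdot> (a + b)) \<cdot> z = (-2) *s ((a + b) \<cdot> ((a + b) \<cdot> z))"
        by (rule nil_square_mult[OF nil_add[OF that(1,2)] that(3)])
      have 2: "(a \<cdot> a) \<cdot> z = (-2) *s (a \<cdot> (a \<cdot> z))"
        by (rule nil_square_mult[OF that(1,3)])
      have 3: "(b \<cdot> b) \<cdot> z = (-2) *s (b \<cdot> (b \<cdot> z))"
        by (rule nil_square_mult[OF that(2,3)])
      show ?thesis
        by (rule vec_lin3[OF 1 2 3]) (simp only: bilinear commute[of b a] coords, algebra)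
    qed
    have "(x \<cdot> (x \<cdot> x)) \<cdot> y + x \<cdot> ((x \<cdot> x) \<cdot> y) + (x \<cdot> x) \<cdot> (x \<cdot> y) = 0"
      by (rule lin[OF x xy(3) y])
    then have "x \<cdot> ((x \<cdot> x) \<cdot> y) + (x \<cdot> x) \<cdot> (x \<cdot> y) = 0"
      by (simp add: x3)
    then have "2 *s (x \<cdot> ((x \<cdot> x) \<cdot> y)) = 0"
      using jordan[of x y] by (simp add: vec_eq_iff)
    then show ?thesis
      unfolding x2y by (simp add: bilinear)
  qed
  have "\<exists>c. x \<cdot> x = c *s u"
  proof -
    \<comment> \<open>The elements y, x y, u, x, x^2 of the nil ideal are dependent: either the
      first four with the unity form a basis that expresses x^2, or these are already
      dependent.\<close>
    obtain p \<alpha> \<beta> \<gamma> \<delta> \<epsilon> where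
      eq: "p *s \<one> + (\<alpha> *s y + \<beta> *s (x \<cdot> y) + \<gamma> *s u + \<delta> *s x + \<epsilon> *s (x \<cdot> x)) = 0"
      and nz: "\<not> (p = 0 \<and> \<alpha> = 0 \<and> \<beta> = 0 \<and> \<gamma> = 0 \<and> \<delta> = 0 \<and> \<epsilon> = 0)"
    proof (cases "indep5 \<one> y (x \<cdot> y) u x")
      case True
      obtain p \<alpha> \<beta> \<gamma> \<delta> where xx: "x \<cdot> x = p *s \<one> + \<alpha> *s y + \<beta> *s (x \<cdot> y) + \<gamma> *s u + \<delta> *s x"
        using indep5_span[OF True] by blast
      show ?thesis
        by (rule that[of p \<alpha> \<beta> \<gamma> \<delta> "- 1"]) (simp_all add: xx vec_eq_iff)
    next
      case False
      then obtain p \<alpha> \<beta> \<gamma> \<delta> where "p *s \<one> + \<alpha> *s y + \<beta> *s (x \<cdot> y) + \<gamma> *s u + \<delta> *s x = 0"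
        "\<not> (p = 0 \<and> \<alpha> = 0 \<and> \<beta> = 0 \<and> \<gamma> = 0 \<and> \<delta> = 0)"
        unfolding indep5_def by blast
      then show ?thesis
        by (intro that[of p \<alpha> \<beta> \<gamma> \<delta> 0]) (simp_all add: add.assoc)
    qed
    have "p = 0"
      using eq by (rule one_part_zero) (intro nil_add nil_scale x y xy)
    \<comment> \<open>Multiplication by \<open>x\<close> sends y, x y, u, x, x^2 to x y, u, 0, x^2,
      0; applied twice it isolates \<alpha>.\<close>
    have "x \<cdot> (\<alpha> *s y + \<beta> *s (x \<cdot> y) + \<gamma> *s u + \<delta> *s x + \<epsilon> *s (x \<cdot> x)) = 0"
      using eq \<open>p = 0\<close> by simp
    then have 1: "\<alpha> *s (x \<cdot> y) + \<beta> *s u + \<delta> *s (x \<cdot> x) = 0"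
      by (simp add: bilinear xu x3 u_def[symmetric])
    then have "x \<cdot> (\<alpha> *s (x \<cdot> y) + \<beta> *s u + \<delta> *s (x \<cdot> x)) = 0"
      by simp
    then have "\<alpha> = 0"
      using u by (simp add: bilinear xu x3 u_def[symmetric])
    have solve: ?thesis if eq: "b *s u + d *s (x \<cdot> x) = 0" and "d \<noteq> 0" for b d
    proof -
      have "d *s (x \<cdot> x) = (- b) *s u"
        by (rule vec_lin1[OF eq]) (simp only: coords, algebra)
      then have "(1 / d) *s (d *s (x \<cdot> x)) = (1 / d) *s ((- b) *s u)"
        by (rule arg_cong)
      then have "x \<cdot> x = (1 / d * (- b)) *s u"
        using \<open>d \<noteq> 0\<close> by simp
      then show ?thesis
        by blast
    qed
    show ?thesis
    proof (cases "\<delta> = 0")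
      case True
      then have "\<beta> = 0"
        using 1 \<open>\<alpha> = 0\<close> u by simp
      then have \<gamma>\<epsilon>: "\<gamma> *s u + \<epsilon> *s (x \<cdot> x) = 0"
        using eq \<open>p = 0\<close> \<open>\<alpha> = 0\<close> True by simp
      have "\<epsilon> \<noteq> 0"
        using \<gamma>\<epsilon> nz u \<open>p = 0\<close> \<open>\<alpha> = 0\<close> \<open>\<beta> = 0\<close> True by auto
      then show ?thesis
        by (rule solve[OF \<gamma>\<epsilon>])
    next
      case False
      then show ?thesis
        using solve[of \<beta> \<delta>] 1 \<open>\<alpha> = 0\<close> by simp
    qed
  qed
  then obtain c where c: "x \<cdot> x = c *s u"
    by blast
  have eq: "c *s (y \<cdot> u) = (-2) *s u"
    using x2y unfolding c by (simp add: scale_left commute[of u y])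
  then have "c \<noteq> 0"
    using u by auto
  have "(1 / c) *s (c *s (y \<cdot> u)) = (1 / c) *s ((-2) *s u)"
    unfolding eq ..
  then have "y \<cdot> u = (1 / c * (-2)) *s u"
    using \<open>c \<noteq> 0\<close> by simp
  then have "u = 0"
    by (rule nil_no_eigenvector[OF y]) (use \<open>c \<noteq> 0\<close> in simp)
  then show False
    using u by simp
qed

lemma nil_mult_three:
  assumes "nil x" "nil z" "nil y"
  shows "(x \<cdot> z) \<cdot> y = 0" "y \<cdot> (x \<cdot> z) = 0"
proof -
  have sq: "(a \<cdot> a) \<cdot> y = 0" if "nil a" for a
    using nil_square_mult[OF that assms(3)] nil_mult_twice[OF that assms(3)] by simp
  have "((x + z) \<cdot> (x + z)) \<cdot> y = 0"
    by (rule sq[OF nil_add[OF assms(1,2)]])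
  moreover have "((x + z) \<cdot> (x + z)) \<cdot> y = (x \<cdot> x) \<cdot> y + 2 *s ((x \<cdot> z) \<cdot> y) + (z \<cdot> z) \<cdot> y"
    by (simp only: bilinear commute[of z x] vec_eq_iff coords) algebra
  ultimately have "2 *s ((x \<cdot> z) \<cdot> y) = 0"
    using sq[OF assms(1)] sq[OF assms(2)] by simp
  then show "(x \<cdot> z) \<cdot> y = 0"
    by simp
  then show "y \<cdot> (x \<cdot> z) = 0"
    by (simp add: commute)
qed

end

context local_rank3
begin

section \<open>Algebras 1 to 5: normal forms of the product on the nil ideal\<close>

lemma indep5_squares:
  assumes v: "nil v1" "nil v2" and ind: "indep2 (v1 \<cdot> v1) (v1 \<cdot> v2)"
  shows "indep5 \<one> v1 v2 (v1 \<cdot> v1) (v1 \<cdot> v2)"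
  unfolding indep5_def
proof (intro allI impI)
  fix s a b c d assume eq: "s *s \<one> + a *s v1 + b *s v2 + c *s (v1 \<cdot> v1) + d *s (v1 \<cdot> v2) = 0"
  then have "s *s \<one> + (a *s v1 + b *s v2 + c *s (v1 \<cdot> v1) + d *s (v1 \<cdot> v2)) = 0"
    by (simp add: add.assoc)
  then have "s = 0"
    by (rule one_part_zero) (intro nil_add nil_scale nil_mult v)
  have "v1 \<cdot> (a *s v1 + b *s v2 + c *s (v1 \<cdot> v1) + d *s (v1 \<cdot> v2)) = 0"
    using eq \<open>s = 0\<close> by simp
  then have "a *s (v1 \<cdot> v1) + b *s (v1 \<cdot> v2) = 0"
    using v by (simp add: bilinear nil_mult_three)
  then have "a = 0" "b = 0"
    using ind unfolding indep2_def by blast+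
  then show "s = 0 \<and> a = 0 \<and> b = 0 \<and> c = 0 \<and> d = 0"
    using eq \<open>s = 0\<close> ind unfolding indep2_def by simp
qed

lemma isomorphic_J5_1:
  assumes v: "nil v1" "nil v2" and ind: "indep2 (v1 \<cdot> v1) (v1 \<cdot> v2)" and "v2 \<cdot> v2 = 0"
  shows "is_J5 1"
  unfolding J5_mult_def
  using nil_mult_three[OF v(1) v(1)] nil_mult_three[OF v(1) v(2)] v nil_mult[OF v(1) v(1)] nil_mult[OF v(1) v(2)] assms(4)
  by (intro isomorphic_J5I[OF indep5_squares[OF v ind]]) (simp_all add: table_simps)

lemma isomorphic_J5_2:
  assumes v: "nil v1" "nil v2" and ind: "indep2 (v1 \<cdot> v1) (v1 \<cdot> v2)" and "v2 \<cdot> v2 = v1 \<cdot> v1"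
  shows "is_J5 2"
  unfolding J5_mult_def
  using nil_mult_three[OF v(1) v(1)] nil_mult_three[OF v(1) v(2)] v nil_mult[OF v(1) v(1)] nil_mult[OF v(1) v(2)] assms(4)
  by (intro isomorphic_J5I[OF indep5_squares[OF v ind]]) (simp_all add: table_simps)

lemma isomorphic_J5_2_orthogonal:
  assumes v: "nil u" "nil w" and ind: "indep2 (u \<cdot> u) (w \<cdot> w)" and uw: "u \<cdot> w = 0"
  shows "is_J5 2"
proof (rule isomorphic_J5_2[of "u + w" "u - w"])
  have "nil (u + (-1) *s w)"
    by (intro nil_add nil_scale v)
  then show "nil (u - w)"
    by simp
  show "nil (u + w)"
    by (intro nil_add v)
  have 1: "(u + w) \<cdot> (u + w) = 1 *s (u \<cdot> u) + 1 *s (w \<cdot> w)" and 2: "(u + w) \<cdot> (u - w) = 1 *s (u \<cdot> u) + (-1) *s (w \<cdot> w)"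
    by (simp_all add: bilinear uw commute[of w u])
  show "indep2 ((u + w) \<cdot> (u + w)) ((u + w) \<cdot> (u - w))"
    unfolding 1 2 by (rule indep2_comb[OF ind]) simp
  show "(u - w) \<cdot> (u - w) = (u + w) \<cdot> (u + w)"
    by (simp add: bilinear uw commute[of w u])
qed

text \<open>Here \<open>x\<close>, \<open>y\<close> and their squares span the nil ideal, so x y is
  a combination of the squares. This single relation is a binary quadratic form; a double factor
  gives algebra 1 and distinct factors give algebra 2.\<close>

lemma isomorphic_J5_1_2:
  assumes x: "nil x" and y: "nil y" and ind: "indep2 (x \<cdot> x) (y \<cdot> y)"
  shows "\<exists>k\<in>{1, 2}. is_J5 k"
proof -
  define p q where "p = x \<cdot> x" and "q = y \<cdot> y"
  have pq: "indep2 p q" "nil p" "nil q"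
    using ind nil_mult x y by (simp_all add: p_def q_def)
  have act: "x \<cdot> p = 0" "x \<cdot> q = 0" "y \<cdot> p = 0" "y \<cdot> q = 0" "x \<cdot> (x \<cdot> y) = 0" "y \<cdot> (x \<cdot> y) = 0"
    unfolding p_def q_def using nil_mult_three x y by blast+
  \<comment> \<open>Eliminating x y leaves a^2 p = b^2 q.\<close>
  have zero: "a = 0 \<and> b = 0" if 1: "a *s p + b *s (x \<cdot> y) = 0" and 2: "a *s (x \<cdot> y) + b *s q = 0" for a b
  proof -
    have "(a * a) *s p + (- (b * b)) *s q = 0"
      by (rule vec_lin2[OF 1 2]) (simp only: coords, algebra)
    then show ?thesis
      using pq(1) unfolding indep2_def by fastforce
  qed
  have indep: "indep5 \<one> x y p q"
    unfolding indep5_def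
  proof (intro allI impI)
    fix s a b c d assume eq: "s *s \<one> + a *s x + b *s y + c *s p + d *s q = 0"
    then have "s *s \<one> + (a *s x + b *s y + c *s p + d *s q) = 0"
      by (simp add: add.assoc)
    then have "s = 0"
      by (rule one_part_zero) (intro nil_add nil_scale x y pq)
    then have *: "z \<cdot> (a *s x + b *s y + c *s p + d *s q) = 0" for z
      using eq by simp
    have "a = 0 \<and> b = 0"
      using *[of x] *[of y] by (intro zero) (simp_all add: bilinear act p_def[symmetric] q_def[symmetric] commute[of y x])
    then show "s = 0 \<and> a = 0 \<and> b = 0 \<and> c = 0 \<and> d = 0"
      using eq \<open>s = 0\<close> pq(1) unfolding indep2_def by simp
  qed
  obtain s a b \<alpha> \<beta> where xy: "x \<cdot> y = s *s \<one> + a *s x + b *s y + \<alpha> *s p + \<beta> *s q"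
    using indep5_span[OF indep] by blast
  have "s *s \<one> + (a *s x + b *s y + \<alpha> *s p + \<beta> *s q + (-1) *s (x \<cdot> y)) = 0"
    by (simp add: xy vec_eq_iff)
  then have "s = 0"
    by (rule one_part_zero) (intro nil_add nil_scale nil_mult x y pq)
  have "a = 0 \<and> b = 0"
  proof (rule zero)
    have "x \<cdot> (a *s x + b *s y + \<alpha> *s p + \<beta> *s q) = 0" "y \<cdot> (a *s x + b *s y + \<alpha> *s p + \<beta> *s q) = 0"
      using act(5,6) xy \<open>s = 0\<close> by simp_all
    then show "a *s p + b *s (x \<cdot> y) = 0" "a *s (x \<cdot> y) + b *s q = 0"
      by (simp_all add: bilinear act p_def[symmetric] q_def[symmetric] commute[of y x])
  qed
  then have xy: "x \<cdot> y = \<alpha> *s p + \<beta> *s q"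
    using xy \<open>s = 0\<close> by simp
  text \<open>The relation \<open>x y = \<alpha> x\<^sup>2 + \<beta> y\<^sup>2\<close> is split into linear factors.\<close>
  have nil_comb: "nil (k *s x + l *s y)" for k l
    by (intro nil_add nil_scale x y)
  have square: "(k *s x + l *s y) \<cdot> (k' *s x + l' *s y) =
      (k * k' + (k * l' + l * k') * \<alpha>) *s p + (l * l' + (k * l' + l * k') * \<beta>) *s q" for k l k' l'
    by (simp only: bilinear xy commute[of y x] p_def[symmetric] q_def[symmetric] vec_eq_iff coords) algebra
  show ?thesis
  proof (cases "\<beta> = 0")
    case True
    \<comment> \<open>The relation x y = \<alpha> x^2 factors as x (y - \<alpha> x) = 0.\<close>
    have "is_J5 2"
    proof (rule isomorphic_J5_2_orthogonal[of "1 *s x + 0 *s y" "(- \<alpha>) *s x + 1 *s y"])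
      show "indep2 ((1 *s x + 0 *s y) \<cdot> (1 *s x + 0 *s y)) (((- \<alpha>) *s x + 1 *s y) \<cdot> ((- \<alpha>) *s x + 1 *s y))"
        unfolding square by (rule indep2_comb[OF pq(1)]) (simp add: True)
      show "(1 *s x + 0 *s y) \<cdot> ((- \<alpha>) *s x + 1 *s y) = 0"
        unfolding square by (simp add: True)
    qed (rule nil_comb)+
    then show ?thesis
      by blast
  next
    case False
    \<comment> \<open>Chosen so that the relation becomes (y - r x) (y - t x) = 0 after division by
      \<beta>.\<close>
    obtain r t where rt: "r + t = 1 / \<beta>" "r * t = - (- (\<alpha> / \<beta>))"
      using complex_quadratic_roots[of "1 / \<beta>" "- (\<alpha> / \<beta>)"] by blast
    have \<alpha>: "\<alpha> = \<beta> * (r * t)" and \<beta>: "\<beta> * (r + t) = 1"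
      using rt False by simp_all
    show ?thesis
    proof (cases "r = t")
      case True
      have "is_J5 1"
      proof (rule isomorphic_J5_1[of "1 *s x + 0 *s y" "(- r) *s x + 1 *s y"])
        show "indep2 ((1 *s x + 0 *s y) \<cdot> (1 *s x + 0 *s y)) ((1 *s x + 0 *s y) \<cdot> ((- r) *s x + 1 *s y))"
          unfolding square by (rule indep2_comb[OF pq(1)]) (simp add: False)
        have "(- r) * (- r) + ((- r) * 1 + 1 * (- r)) * \<alpha> = 0" "1 * 1 + ((- r) * 1 + 1 * (- r)) * \<beta> = 0"
          using \<alpha> \<beta> True by algebra+
        then show "((- r) *s x + 1 *s y) \<cdot> ((- r) *s x + 1 *s y) = 0"
          unfolding square by simp
      qed (rule nil_comb)+
      then show ?thesis
        by blast
    next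
      case False
      have "is_J5 2"
      proof (rule isomorphic_J5_2_orthogonal[of "(- r) *s x + 1 *s y" "(- t) *s x + 1 *s y"])
        have *: "((- r) * (- r) + ((- r) * 1 + 1 * (- r)) * \<alpha>) * (1 * 1 + ((- t) * 1 + 1 * (- t)) * \<beta>)
            - (1 * 1 + ((- r) * 1 + 1 * (- r)) * \<beta>) * ((- t) * (- t) + ((- t) * 1 + 1 * (- t)) * \<alpha>)
            = \<beta> * (r - t) * (r - t) * (r - t)"
          using \<alpha> \<beta> by algebra
        show "indep2 (((- r) *s x + 1 *s y) \<cdot> ((- r) *s x + 1 *s y)) (((- t) *s x + 1 *s y) \<cdot> ((- t) *s x + 1 *s y))"
          unfolding square by (rule indep2_comb[OF pq(1)], subst *) (use False \<open>\<beta> \<noteq> 0\<close> in simp)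
        have "(- r) * (- t) + ((- r) * 1 + 1 * (- t)) * \<alpha> = 0" "1 * 1 + ((- r) * 1 + 1 * (- t)) * \<beta> = 0"
          using \<alpha> \<beta> by algebra+
        then show "((- r) *s x + 1 *s y) \<cdot> ((- t) *s x + 1 *s y) = 0"
          unfolding square by simp
      qed (rule nil_comb)+
      then show ?thesis
        by blast
    qed
  qed
qed

text \<open>All squares, and by polarization all products, are multiples of p = v^2, so the product
  is a quadratic form times \<open>p\<close>. As \<open>v\<close> has value 1, only the form on a
  plane orthogonal to it, modulo \<open>p\<close>, remains to be diagonalized.\<close>

lemma isomorphic_J5_3_5:
  assumes no: "\<And>x y. nil x \<Longrightarrow> nil y \<Longrightarrow> \<not> indep2 (x \<cdot> x) (y \<cdot> y)" and v: "nil v" "v \<cdot> v \<noteq> 0"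
  shows "\<exists>k\<in>{3, 4, 5}. is_J5 k"
proof -
  define p where "p = v \<cdot> v"
  have p: "p \<noteq> 0" "nil p" "v \<cdot> p = 0" "p \<cdot> p = 0"
    unfolding p_def using v nil_mult nil_mult_three by auto
  have square: "\<exists>k. x \<cdot> x = k *s p" if x: "nil x" for x
  proof -
    obtain s t where st: "s *s p + t *s (x \<cdot> x) = 0" "\<not> (s = 0 \<and> t = 0)"
      using no[OF v(1) x] unfolding indep2_def p_def by blast
    have "t \<noteq> 0"
      using st p(1) by auto
    have "t *s (x \<cdot> x) = (- s) *s p"
      by (rule vec_lin1[OF st(1)]) (simp only: coords, algebra)
    then have "(1 / t) *s (t *s (x \<cdot> x)) = (1 / t) *s ((- s) *s p)"
      by (rule arg_cong)
    then have "x \<cdot> x = (1 / t * (- s)) *s p"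
      using \<open>t \<noteq> 0\<close> by simp
    then show ?thesis
      by blast
  qed
  have product: "\<exists>k. x \<cdot> y = k *s p" if x: "nil x" and y: "nil y" for x y
  proof -
    obtain a b d where abd: "x \<cdot> x = a *s p" "y \<cdot> y = b *s p" "(x + y) \<cdot> (x + y) = d *s p"
      using square x y nil_add[OF x y] by meson
    have "x \<cdot> y = (1/2 * (d - a - b)) *s p"
      by (rule vec_lin1[OF abd(3)]) (simp only: bilinear abd(1,2) commute[of y x] coords, algebra)
    then show ?thesis
      by blast
  qed
  define M where "M x \<longleftrightarrow> nil x \<and> v \<cdot> x = 0" for x
  have M_comb: "M (a *s x + b *s y)" if "M x" "M y" for a b x y
    using that by (simp add: M_def nil_add nil_scale bilinear)
  have decomp: "\<exists>s b m. z = s *s \<one> + b *s v + m \<and> M m" for z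
  proof -
    obtain s n where n: "z = s *s \<one> + n" "nil n"
      using decompose_nil by blast
    obtain b where b: "v \<cdot> n = b *s p"
      using product[OF v(1) n(2)] by blast
    have "nil (1 *s n + (- b) *s v)"
      by (intro nil_add nil_scale n(2) v(1))
    moreover have "v \<cdot> (1 *s n + (- b) *s v) = 0"
      by (simp add: bilinear b p_def[symmetric])
    ultimately have "M (1 *s n + (- b) *s v)"
      unfolding M_def by blast
    moreover have "z = s *s \<one> + b *s v + (1 *s n + (- b) *s v)"
      by (simp add: n(1))
    ultimately show ?thesis
      by blast
  qed
  have new: "\<exists>m. M m \<and> (\<forall>s t. m \<noteq> s *s a + t *s b)" for a b
  proof -
    obtain z where z: "\<forall>r q s t. z \<noteq> r *s \<one> + q *s v + s *s a + t *s b"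
      using not_spanned_by_four by blast
    obtain r q m where m: "z = r *s \<one> + q *s v + m" "M m"
      using decomp by blast
    have "m \<noteq> s *s a + t *s b" for s t
      using z m(1) by (metis add.assoc)
    then show ?thesis
      using m(2) by blast
  qed
  obtain u where u: "M u" "\<forall>s t. u \<noteq> s *s p + t *s 0"
    using new by blast
  obtain w where w: "M w" "\<forall>s t. w \<noteq> s *s p + t *s u"
    using new by blast
  have uwp: "a = 0 \<and> b = 0 \<and> d = 0" if eq: "a *s u + b *s w + d *s p = 0" for a b d
  proof -
    have "b = 0"
      by (rule coefficient_zero[of d p a u b w]) (use eq in \<open>simp add: ac_simps\<close>, use w(2) in blast)
    moreover have "a = 0"
      by (rule coefficient_zero[of d p 0 0 a u]) (use eq \<open>b = 0\<close> in \<open>simp add: ac_simps\<close>, use u(2) in blast)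
    ultimately show ?thesis
      using eq p(1) by simp
  qed
  have nil_uw: "nil u" "nil w"
    using u(1) w(1) by (simp_all add: M_def)
  obtain \<alpha> where uu: "u \<cdot> u = \<alpha> *s p"
    using square[OF nil_uw(1)] by blast
  obtain \<beta> where uw: "u \<cdot> w = \<beta> *s p"
    using product[OF nil_uw] by blast
  obtain \<gamma> where ww: "w \<cdot> w = \<gamma> *s p"
    using square[OF nil_uw(2)] by blast
  obtain a b r s x y where x_def: "x = a *s u + b *s w" and y_def: "y = r *s u + s *s w"
    and det: "a * s - b * r \<noteq> 0" and xy0: "x \<cdot> y = 0"
    and squares: "x \<cdot> x = 0 \<and> y \<cdot> y = 0 \<or> x \<cdot> x = p \<and> y \<cdot> y = 0 \<or> x \<cdot> x = p \<and> y \<cdot> y = p"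
    by (rule diagonal_pair[OF uu uw ww]) (rule that)
  have "M x" "M y"
    unfolding x_def y_def using M_comb u(1) w(1) by auto
  then have xy: "nil x" "nil y" "v \<cdot> x = 0" "v \<cdot> y = 0"
    by (simp_all add: M_def)
  have xyp: "x \<cdot> p = 0" "y \<cdot> p = 0"
    unfolding p_def using nil_mult_three(2)[OF v(1) v(1)] xy by blast+
  have indep: "indep5 \<one> v x y p"
    unfolding indep5_def
  proof (intro allI impI)
    fix g h i j k assume eq: "g *s \<one> + h *s v + i *s x + j *s y + k *s p = 0"
    then have "g *s \<one> + (h *s v + i *s x + j *s y + k *s p) = 0"
      by (simp add: add.assoc)
    then have "g = 0"
      by (rule one_part_zero) (intro nil_add nil_scale xy v p)
    have "v \<cdot> (h *s v + i *s x + j *s y + k *s p) = 0"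
      using eq \<open>g = 0\<close> by simp
    then have "h = 0"
      using p by (simp add: bilinear xy p_def[symmetric])
    have "(i * a + j * r) *s u + (i * b + j * s) *s w + k *s p = 0"
      by (rule vec_lin1[OF eq]) (simp only: \<open>g = 0\<close> \<open>h = 0\<close> x_def y_def coords, algebra)
    from uwp[OF this] have ij: "i * a + j * r = 0" "i * b + j * s = 0" "k = 0"
      by auto
    then have "i * (a * s - b * r) = 0" "j * (a * s - b * r) = 0"
      by algebra+
    then show "g = 0 \<and> h = 0 \<and> i = 0 \<and> j = 0 \<and> k = 0"
      using det \<open>g = 0\<close> \<open>h = 0\<close> ij(3) by simp
  qed
  consider "x \<cdot> x = 0" "y \<cdot> y = 0" | "x \<cdot> x = p" "y \<cdot> y = 0" | "x \<cdot> x = p" "y \<cdot> y = p"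
    using squares by blast
  then show ?thesis
  proof cases
    case 1
    then have "is_J5 3"
      unfolding J5_mult_def using xy(3,4) xyp xy0 p(3,4) p_def[symmetric]
      by (intro isomorphic_J5I[OF indep]) (simp_all add: table_simps)
    then show ?thesis
      by blast
  next
    case 2
    then have "is_J5 4"
      unfolding J5_mult_def using xy(3,4) xyp xy0 p(3,4) p_def[symmetric]
      by (intro isomorphic_J5I[OF indep]) (simp_all add: table_simps)
    then show ?thesis
      by blast
  next
    case 3
    then have "is_J5 5"
      unfolding J5_mult_def using xy(3,4) xyp xy0 p(3,4) p_def[symmetric]
      by (intro isomorphic_J5I[OF indep]) (simp_all add: table_simps)
    then show ?thesis
      by blast
  qed
qed

lemma local_classification: "\<exists>k\<in>{1..5}. is_J5 k"
proof (cases "\<exists>x y. nil x \<and> nil y \<and> indep2 (x \<cdot> x) (y \<cdot> y)")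
  case True
  then have "\<exists>k\<in>{1, 2}. is_J5 k"
    using isomorphic_J5_1_2 by blast
  then show ?thesis
    by auto
next
  case False
  obtain v where v: "\<And>a b c. a *s \<one> + b *s v + c *s (v \<cdot> v) = 0 \<Longrightarrow> a = 0 \<and> b = 0 \<and> c = 0"
    using generic by blast
  obtain l n where n: "v = l *s \<one> + n" "nil n"
    using decompose_nil by blast
  \<comment> \<open>Otherwise (v - l)^2 = 0 would be a quadratic relation for an element of degree
    three.\<close>
  have "n \<cdot> n \<noteq> 0"
  proof
    assume "n \<cdot> n = 0"
    have "n = v - l *s \<one>"
      using n(1) by simp
    then have "(v - l *s \<one>) \<cdot> (v - l *s \<one>) = 0"
      using \<open>n \<cdot> n = 0\<close> by simp
    then have "(l * l) *s \<one> + (- 2 * l) *s v + 1 *s (v \<cdot> v) = 0"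
      by (rule vec_lin1) (simp only: bilinear one_left one_right coords, algebra)
    then show False
      using v[of "l * l" "- 2 * l" 1] by simp
  qed
  then have "\<exists>k\<in>{3, 4, 5}. is_J5 k"
    using isomorphic_J5_3_5[OF _ n(2)] False by blast
  then show ?thesis
    by auto
qed

end

section \<open>The classification\<close>

lemma (in rank3_algebra) classification: "\<exists>k\<in>{1..16}. is_J5 k"
proof (cases "\<exists>e1 e2 e3. idempotent_triple e1 e2 e3")
  case True
  then have "\<exists>k\<in>{13, 14, 15, 16}. is_J5 k"
    using idempotent_triple_classification by blast
  then show ?thesis
    by auto
next
  case no: False
  show ?thesis
  proof (cases "\<exists>c. idempotent c \<and> c \<noteq> 0 \<and> c \<noteq> \<one>")
    case True
    then have "\<exists>k\<in>{6..12}. is_J5 k"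
      using no nontrivial_idempotent_classification by blast
    then show ?thesis
      by auto
  next
    case False
    then interpret local_rank3 "(\<cdot>)" "\<one>"
      by unfold_locales blast
    show ?thesis
      using local_classification by auto
  qed
qed

theorem theorem3p4:
  fixes sc :: "complex \<Rightarrow> 'a::ab_group_add \<Rightarrow> 'a"
    and mul :: "'a \<Rightarrow> 'a \<Rightarrow> 'a"
    and one :: 'a
  assumes "jordan_algebra sc mul one"
    and "jordan_algebra.has_rank sc mul one 3"
    and "vector_space.dim sc (UNIV :: 'a set) = 5"
  shows "\<exists>!k. k \<in> {1..16} \<and> isomorphic_to_J5 sc mul k"
proof -
  obtain m e where m: "rank3_algebra m e" "algebra_isomorphic sc mul (*s) m"
    using rank3_algebra_transport[OF assms] by blast
  obtain k where k: "k \<in> {1..16}" "algebra_isomorphic (*s) m (*s) (J5_mult k)"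
    using rank3_algebra.classification[OF m(1)] by blast
  have "isomorphic_to_J5 sc mul k"
    unfolding isomorphic_to_J5_iff[OF k(1)] by (rule algebra_isomorphic_trans[OF m(2) k(2)])
  then show ?thesis
    using k(1) isomorphic_to_J5_unique by blast
qed

end
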